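(* Assume (A1), let $M>0$, $W\in\dot W^{2,\infty}$ with $\|W\|_{W^{2,\infty}}\le M$, $f\in L^2([0,T];L^2)$, and let $u\in L^2([0,T];H^2)\cap H^1([0,T];L^2)$ be the unique strong solution of $(\partial_t-\mathcal L_W)u=f$, $u(0)=0$. Then for every $1\le s<\beta+1-d/2$, $$\|u\|_{L^2([0,T];H^{-s+2})}+\|u\|_{L^\infty([0,T];H^{-s+1})}+\|\partial_tu\|_{L^2([0,T];H^{-s})}\le C\|f\|_{L^2([0,T];H^{-s})},$$ with $C=C(s,d,T,M,\|\phi\|_{H^{k}})$, $k=\min(\beta,\lfloor s-1+d/2\rfloor+1)$.
   Context: $\mathbb T^d=\mathbb R^d/\mathbb Z^d$; $H^s$ periodic Sobolev spaces with norm $\|u\|_{H^s}^2=\sum_k(1+|k|^2)^s|\hat u_k|^2$ (for all real $s$); $W^{2,\infty}$ Sobolev space with derivatives up to order 2 in $L^\infty$; a dot denotes mean-zero subspace; Bochner spaces $L^p([0,T];B)$, $H^1([0,T];B)$. Assumption (A1): $\phi$ is a probability density on $\mathbb T^d$ with $\phi\in H^\beta$, $\beta\ge3+d$ an even integer. $\rho_W$ is the unique solution in $L^2([0,T];H^{\beta+1})\cap H^1([0,T];H^{\beta-1})$ of $\partial_t\rho=\Delta\rho+\nabla\cdot(\rho\nabla W*\rho)$, $\rho(0)=\phi$. $\mathcal L_Wu=\Delta u+\nabla\cdot(u\nabla W*\rho_W)+\nabla\cdot(\rho_W\nabla W*u)$. *)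

theory Defs
  imports "HOL-Analysis.Analysis" "HOL-Probability.Essential_Supremum"
begin

text \<open>The torus T^d = R^d/Z^d is represented by the unit cube [0,1]^d
  (a fundamental domain); a function on the torus is a real function on
  real^'d of which only the values on the cube matter.  The dimension d is
  CARD('d).\<close>

definition cube :: "(real^'d) set" where
  "cube = cbox 0 One"

definition tfrac :: "real^'d \<Rightarrow> real^'d" where
  "tfrac x = (\<chi> i. frac (x $ i))"

definition kdot :: "int^'d \<Rightarrow> real^'d \<Rightarrow> real" where
  "kdot k x = (\<Sum>i\<in>UNIV. real_of_int (k $ i) * x $ i)"

definition ksq :: "int^'d \<Rightarrow> real" where
  "ksq k = (\<Sum>i\<in>UNIV. (real_of_int (k $ i))^2)"

definition fc :: "(real^'d \<Rightarrow> real) \<Rightarrow> int^'d \<Rightarrow> complex" where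
  "fc g k = (LINT x|lebesgue_on cube. complex_of_real (g x) * cis (- 2 * pi * kdot k x))"

definition in_L1 :: "(real^'d \<Rightarrow> real) \<Rightarrow> bool" where
  "in_L1 g \<longleftrightarrow> integrable (lebesgue_on cube) g"

definition in_L2 :: "(real^'d \<Rightarrow> real) \<Rightarrow> bool" where
  "in_L2 g \<longleftrightarrow> g \<in> borel_measurable (lebesgue_on cube)
      \<and> integrable (lebesgue_on cube) (\<lambda>x. (g x)^2)"

definition hweight :: "real \<Rightarrow> (real^'d \<Rightarrow> real) \<Rightarrow> int^'d \<Rightarrow> real" where
  "hweight s g k = (1 + ksq k) powr s * (cmod (fc g k))^2"

definition in_H :: "real \<Rightarrow> (real^'d \<Rightarrow> real) \<Rightarrow> bool" where
  "in_H s g \<longleftrightarrow> in_L2 g \<and> (hweight s g) summable_on UNIV"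

definition hnorm :: "real \<Rightarrow> (real^'d \<Rightarrow> real) \<Rightarrow> real" where
  "hnorm s g = sqrt (infsum (hweight s g) UNIV)"

definition in_L2H :: "real \<Rightarrow> real \<Rightarrow> (real \<Rightarrow> real^'d \<Rightarrow> real) \<Rightarrow> bool" where
  "in_L2H s T u \<longleftrightarrow>
     (\<forall>k. (\<lambda>t. fc (u t) k) \<in> borel_measurable (lebesgue_on {0..T}))
     \<and> (AE t in lebesgue_on {0..T}. in_H s (u t))
     \<and> integrable (lebesgue_on {0..T}) (\<lambda>t. (hnorm s (u t))^2)"

definition L2H_norm :: "real \<Rightarrow> real \<Rightarrow> (real \<Rightarrow> real^'d \<Rightarrow> real) \<Rightarrow> real" where
  "L2H_norm s T u = sqrt (LINT t|lebesgue_on {0..T}. (hnorm s (u t))^2)"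

definition LinfH_norm :: "real \<Rightarrow> real \<Rightarrow> (real \<Rightarrow> real^'d \<Rightarrow> real) \<Rightarrow> ereal" where
  "LinfH_norm s T u = esssup (lebesgue_on {0..T}) (\<lambda>t. ereal (hnorm s (u t)))"

text \<open>H^1([0,T]; H^s) with weak time derivative v: u, v in L^2([0,T];H^s) and
  u(t) = u(0) + int_0^t v, expressed Fourier-coefficientwise, for every t
  (so u denotes the continuous representative).\<close>
definition in_H1H :: "real \<Rightarrow> real \<Rightarrow> (real \<Rightarrow> real^'d \<Rightarrow> real)
    \<Rightarrow> (real \<Rightarrow> real^'d \<Rightarrow> real) \<Rightarrow> bool" where
  "in_H1H s T u v \<longleftrightarrow> in_L2H s T u \<and> in_L2H s T v
     \<and> (\<forall>t\<in>{0..T}. \<forall>k. fc (u t) k = fc (u 0) k + (LINT \<tau>|lebesgue_on {0..t}. fc (v \<tau>) k))"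

definition weak_pd :: "(real^'d \<Rightarrow> real) \<Rightarrow> 'd \<Rightarrow> (real^'d \<Rightarrow> real) \<Rightarrow> bool" where
  "weak_pd g i h \<longleftrightarrow> in_L1 g \<and> in_L1 h \<and>
     (\<forall>k. fc h k = \<i> * complex_of_real (2 * pi * real_of_int (k $ i)) * fc g k)"

definition ess_bdd_by :: "(real^'d \<Rightarrow> real) \<Rightarrow> real \<Rightarrow> bool" where
  "ess_bdd_by g B \<longleftrightarrow> g \<in> borel_measurable (lebesgue_on cube)
     \<and> (AE x in lebesgue_on cube. \<bar>g x\<bar> \<le> B)"

definition W2inf_mean0_bdd :: "(real^'d \<Rightarrow> real) \<Rightarrow> ('d \<Rightarrow> real^'d \<Rightarrow> real)
    \<Rightarrow> ('d \<Rightarrow> 'd \<Rightarrow> real^'d \<Rightarrow> real) \<Rightarrow> real \<Rightarrow> bool" where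
  "W2inf_mean0_bdd W Wd Wdd M \<longleftrightarrow>
     fc W 0 = 0
     \<and> (\<forall>i. weak_pd W i (Wd i)) \<and> (\<forall>i j. weak_pd (Wd i) j (Wdd i j))
     \<and> (\<exists>a b c. ess_bdd_by W a \<and> (\<forall>i. ess_bdd_by (Wd i) (b i))
          \<and> (\<forall>i j. ess_bdd_by (Wdd i j) (c i j))
          \<and> a + (\<Sum>i\<in>UNIV. b i) + (\<Sum>i\<in>UNIV. \<Sum>j\<in>UNIV. c i j) \<le> M)"

definition tconv :: "(real^'d \<Rightarrow> real) \<Rightarrow> (real^'d \<Rightarrow> real) \<Rightarrow> real^'d \<Rightarrow> real" where
  "tconv g h x = (LINT y|lebesgue_on cube. g (tfrac (x - y)) * h y)"

definition fc_div :: "('d \<Rightarrow> real^'d \<Rightarrow> real) \<Rightarrow> int^'d \<Rightarrow> complex" where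
  "fc_div F k = (\<Sum>i\<in>UNIV. \<i> * complex_of_real (2 * pi * real_of_int (k $ i)) * fc (F i) k)"

definition fc_lap :: "(real^'d \<Rightarrow> real) \<Rightarrow> int^'d \<Rightarrow> complex" where
  "fc_lap g k = - complex_of_real (4 * pi^2 * ksq k) * fc g k"

definition prob_density :: "(real^'d \<Rightarrow> real) \<Rightarrow> bool" where
  "prob_density \<phi> \<longleftrightarrow> \<phi> \<in> borel_measurable (lebesgue_on cube)
     \<and> (AE x in lebesgue_on cube. 0 \<le> \<phi> x)
     \<and> integrable (lebesgue_on cube) \<phi> \<and> (LINT x|lebesgue_on cube. \<phi> x) = 1"

definition agg_diff_sol :: "nat \<Rightarrow> real \<Rightarrow> (real^'d \<Rightarrow> real) \<Rightarrow> ('d \<Rightarrow> real^'d \<Rightarrow> real)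
    \<Rightarrow> (real \<Rightarrow> real^'d \<Rightarrow> real) \<Rightarrow> (real \<Rightarrow> real^'d \<Rightarrow> real) \<Rightarrow> bool" where
  "agg_diff_sol \<beta> T \<phi> Wd \<rho> vr \<longleftrightarrow>
     in_L2H (real \<beta> + 1) T \<rho> \<and> in_H1H (real \<beta> - 1) T \<rho> vr
     \<and> (\<forall>k. fc (\<rho> 0) k = fc \<phi> k)
     \<and> (AE t in lebesgue_on {0..T}. \<forall>k.
          fc (vr t) k = fc_lap (\<rho> t) k
            + fc_div (\<lambda>i x. \<rho> t x * tconv (Wd i) (\<rho> t) x) k)"

definition lin_sol :: "real \<Rightarrow> ('d \<Rightarrow> real^'d \<Rightarrow> real) \<Rightarrow> (real \<Rightarrow> real^'d \<Rightarrow> real)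
    \<Rightarrow> (real \<Rightarrow> real^'d \<Rightarrow> real) \<Rightarrow> (real \<Rightarrow> real^'d \<Rightarrow> real) \<Rightarrow> (real \<Rightarrow> real^'d \<Rightarrow> real) \<Rightarrow> bool" where
  "lin_sol T Wd \<rho> f u v \<longleftrightarrow>
     in_L2H 2 T u \<and> in_H1H 0 T u v
     \<and> (\<forall>k. fc (u 0) k = 0)
     \<and> (AE t in lebesgue_on {0..T}. \<forall>k.
          fc (v t) k = fc_lap (u t) k
            + fc_div (\<lambda>i x. u t x * tconv (Wd i) (\<rho> t) x + \<rho> t x * tconv (Wd i) (u t) x) k
            + fc (f t) k)"

end

(*
  Everything is done on Fourier coefficients. Pairing the linear equation with u in H^{1-s}, the
  drift terms are controlled by products of u with rho and with grad W * rho. Multiplication by h is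
  bounded on H^{-(s-1)} as soon as the coefficients of h are summable with weight |k|^{s-1}
  (Peetre and Young), which rho in H^k guarantees because k > s - 1 + d/2. Gronwall then gives the
  estimate for u, and the equation gives the one for its time derivative.

  It remains to bound rho in H^k, uniformly in time, by its initial datum. The Fourier series of rho
  is a classical solution, hence nonnegative by the minimum principle, hence of L^1 norm one. So
  grad W * rho is bounded by M, which closes the L^2 estimate; the H^m estimates follow by induction
  on m, since grad W in H^1 bounds the weighted coefficients of grad W * rho by the H^{m-1} norm.
*)
theory Submission
  imports Defs
begin

section \<open>Weights on the frequency lattice\<close>

text \<open>The constant may see the initial density only through its norm of order
  \<open>kk\<close>, while \<open>\<rho>\<close> is given with order \<open>\<beta> + 1\<close>.
  That regularity is therefore used qualitatively, to make sums converge and series classical, and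
  never enters a bound. This shapes the induction for \<open>\<rho>\<close>: at each level the flux
  is estimated linearly in the norm of that level, with a coefficient taken from the level below;
  the lowest level has nothing below it, so a sign and the mass must supply the drift bound there.
  The equations are stated for coefficients, but a sign is a property of functions. Uniqueness of
  Fourier coefficients, inversion and the convolution theorem are what connects the two sides. The
  equations hold only for almost every time and mode by mode. Estimates are therefore made for
  finite sets of modes, where the square of a primitive is computed by Fubini instead of
  differentiation, and the supremum over all finite sets is taken at the end.\<close>

definition hw :: "real \<Rightarrow> int^'d \<Rightarrow> real" where
  "hw s k = (1 + ksq k) powr s"

lemma ksq_nonneg [simp]: "0 \<le> ksq k"
  unfolding ksq_def by (intro sum_nonneg) auto

lemma one_plus_ksq_pos [simp]: "0 < 1 + ksq k" "1 + ksq k \<noteq> 0" "1 \<le> 1 + ksq k"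
  using ksq_nonneg[of k] by linarith+

lemma hw_pos [simp]: "0 < hw s k" "0 \<le> hw s k" "hw s k \<noteq> 0"
  by (auto simp: hw_def less_imp_le add_nonneg_eq_0_iff powr_eq_0_iff)

lemma hw_add: "hw (a + b) k = hw a k * hw b k"
  by (simp add: hw_def powr_add)

lemma hw_0 [simp]: "hw 0 k = 1"
  by (simp add: hw_def)

lemma hw_1: "hw 1 k = 1 + ksq k"
  by (simp add: hw_def)

lemma hw_mono: "a \<le> b \<Longrightarrow> hw a k \<le> hw b k"
  unfolding hw_def by (rule powr_mono) auto

lemma hw_half_sq: "(hw (s/2) k)\<^sup>2 = hw s k"
  by (simp add: power2_eq_square flip: hw_add)

lemma ksq_minus: "ksq (- k) = ksq k"
  by (simp add: ksq_def)

lemma ksq_diff_le: "ksq (k - l) \<le> 2 * ksq k + 2 * ksq l"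
proof -
  have "(real_of_int ((k - l) $ i))\<^sup>2 \<le> 2 * (real_of_int (k $ i))\<^sup>2 + 2 * (real_of_int (l $ i))\<^sup>2" for i
    using zero_le_power2[of "real_of_int (k $ i) + real_of_int (l $ i)"]
    by (simp add: power2_eq_square algebra_simps)
  then have "ksq (k - l) \<le> (\<Sum>i\<in>UNIV. 2 * (real_of_int (k $ i))\<^sup>2 + 2 * (real_of_int (l $ i))\<^sup>2)"
    unfolding ksq_def by (intro sum_mono)
  also have "\<dots> = 2 * ksq k + 2 * ksq l"
    by (simp add: ksq_def sum.distrib sum_distrib_left)
  finally show ?thesis .
qed

lemma one_plus_ksq_diff_le: "1 + ksq (k - l) \<le> 2 * (1 + ksq k) * (1 + ksq l)"
proof -
  have "1 + ksq (k - l) \<le> 2 + 2 * ksq k + 2 * ksq l" using ksq_diff_le[of k l] by simp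
  also have "\<dots> \<le> 2 * (1 + ksq k) * (1 + ksq l)" by (simp add: algebra_simps)
  finally show ?thesis .
qed

text \<open>Peetre's inequality. Both signs of \<open>s\<close> rest on the same quadratic bound;
  for \<open>s < 0\<close> it is applied to \<open>k - l\<close> and the result is multiplied by
  \<open>hw s k * hw s (k - l)\<close>. Even a negative order costs the other factor the positive
  weight \<open>\<bar>s\<bar>\<close>.\<close>

lemma peetre: "hw s k \<le> 2 powr \<bar>s\<bar> * (hw s (k - l) * hw \<bar>s\<bar> l)"
proof (cases "s \<ge> 0")
  case True
  have "1 + ksq k \<le> 2 * (1 + ksq (k - l)) * (1 + ksq l)"
    using one_plus_ksq_diff_le[of "k - l" "- l"] by (simp add: ksq_minus)
  then have "hw s k \<le> (2 * (1 + ksq (k - l)) * (1 + ksq l)) powr s"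
    unfolding hw_def using True by (intro powr_mono2) auto
  then show ?thesis using True by (simp add: hw_def powr_mult mult.assoc del: distrib_left_numeral)
next
  case False
  have "(1 + ksq (k - l)) powr (- s) \<le> (2 * (1 + ksq k) * (1 + ksq l)) powr (- s)"
    using False one_plus_ksq_diff_le by (intro powr_mono2) (auto intro: less_imp_le)
  then have "hw (- s) (k - l) \<le> 2 powr \<bar>s\<bar> * (hw (- s) k * hw \<bar>s\<bar> l)"
    using False by (simp add: hw_def powr_mult mult.assoc del: distrib_left_numeral)
  then have "hw s k * hw s (k - l) * hw (- s) (k - l)
      \<le> hw s k * hw s (k - l) * (2 powr \<bar>s\<bar> * (hw (- s) k * hw \<bar>s\<bar> l))"
    by (intro mult_left_mono) auto
  moreover have "hw s k * hw s (k - l) * hw (- s) (k - l) = hw s k"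
    using hw_add[of s "-s" "k - l"] by simp
  moreover have "hw s k * hw s (k - l) * (2 powr \<bar>s\<bar> * (hw (- s) k * hw \<bar>s\<bar> l))
      = 2 powr \<bar>s\<bar> * (hw s (k - l) * hw \<bar>s\<bar> l)"
    using hw_add[of s "-s" k] by (simp add: algebra_simps)
  ultimately show ?thesis by simp
qed

text \<open>The two conclusions belong together: a divergent \<open>infsum\<close> defaults to 0, so
  a bound on its value is informative only along with summability.\<close>

lemma summable_infsum_le_of_finite_sums:
  fixes f :: "'a \<Rightarrow> real"
  assumes nn: "\<And>x. 0 \<le> f x" and le: "\<And>K. finite K \<Longrightarrow> sum f K \<le> C"
  shows "f summable_on UNIV" "infsum f UNIV \<le> C"
proof -
  show 1: "f summable_on UNIV"
    by (rule nonneg_bdd_above_summable_on) (auto simp: nn le intro!: bdd_aboveI[of _ C])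
  show "infsum f UNIV \<le> C"
    by (rule infsum_le_finite_sums[OF 1]) (auto simp: le)
qed

lemma infsum_cauchy_schwarz:
  fixes a b :: "'a \<Rightarrow> real"
  assumes a0: "\<And>x. 0 \<le> a x" and b0: "\<And>x. 0 \<le> b x"
    and a: "(\<lambda>x. (a x)\<^sup>2) summable_on UNIV" and b: "(\<lambda>x. (b x)\<^sup>2) summable_on UNIV"
  shows "(\<lambda>x. a x * b x) summable_on UNIV"
    "(\<Sum>\<^sub>\<infinity>x. a x * b x) \<le> sqrt (\<Sum>\<^sub>\<infinity>x. (a x)\<^sup>2) * sqrt (\<Sum>\<^sub>\<infinity>x. (b x)\<^sup>2)"
proof -
  have le: "(\<Sum>x\<in>K. a x * b x) \<le> sqrt (\<Sum>\<^sub>\<infinity>x. (a x)\<^sup>2) * sqrt (\<Sum>\<^sub>\<infinity>x. (b x)\<^sup>2)"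
    if "finite K" for K
  proof -
    have "(\<Sum>x\<in>K. a x * b x)\<^sup>2 \<le> (\<Sum>x\<in>K. (a x)\<^sup>2) * (\<Sum>x\<in>K. (b x)\<^sup>2)"
      by (rule Cauchy_Schwarz_ineq_sum)
    also have "\<dots> \<le> (\<Sum>\<^sub>\<infinity>x. (a x)\<^sup>2) * (\<Sum>\<^sub>\<infinity>x. (b x)\<^sup>2)"
      using that a b by (intro mult_mono finite_sum_le_infsum) (auto intro: sum_nonneg infsum_nonneg)
    finally have "(\<Sum>x\<in>K. a x * b x) \<le> sqrt ((\<Sum>\<^sub>\<infinity>x. (a x)\<^sup>2) * (\<Sum>\<^sub>\<infinity>x. (b x)\<^sup>2))"
      by (rule real_le_rsqrt)
    then show ?thesis by (simp add: real_sqrt_mult)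
  qed
  show "(\<lambda>x. a x * b x) summable_on UNIV"
    "(\<Sum>\<^sub>\<infinity>x. a x * b x) \<le> sqrt (\<Sum>\<^sub>\<infinity>x. (a x)\<^sup>2) * sqrt (\<Sum>\<^sub>\<infinity>x. (b x)\<^sup>2)"
    using le a0 b0 by (auto intro!: summable_infsum_le_of_finite_sums)
qed

text \<open>Young's inequality for l^2 and l^1: Cauchy-Schwarz with weight \<open>y\<close>,
  exchange of the sums, and translation invariance of the sum over \<open>k\<close>. With finite
  index sets no convergence of the convolution has to be known beforehand.\<close>

lemma young_l1_l2_finite:
  fixes x y :: "'a::ab_group_add \<Rightarrow> real"
  assumes x0: "\<And>k. 0 \<le> x k" and y0: "\<And>k. 0 \<le> y k"
    and x: "(\<lambda>k. (x k)\<^sup>2) summable_on UNIV" and y: "y summable_on UNIV"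
    and K: "finite K" and L: "finite L"
  shows "(\<Sum>k\<in>K. (\<Sum>l\<in>L. x (k - l) * y l)\<^sup>2) \<le> (infsum y UNIV)\<^sup>2 * (\<Sum>\<^sub>\<infinity>k. (x k)\<^sup>2)"
proof -
  define S where "S = infsum y UNIV"
  define N where "N = (\<Sum>\<^sub>\<infinity>k. (x k)\<^sup>2)"
  have S: "sum y L \<le> S" unfolding S_def using finite_sum_le_infsum[OF y L] y0 by auto
  have S0: "0 \<le> S" unfolding S_def by (rule infsum_nonneg) (use y0 in auto)
  have N0: "0 \<le> N" unfolding N_def by (rule infsum_nonneg) auto
  have 1: "(\<Sum>l\<in>L. x (k - l) * y l)\<^sup>2 \<le> S * (\<Sum>l\<in>L. (x (k - l))\<^sup>2 * y l)" for k
  proof -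
    have "(\<Sum>l\<in>L. x (k - l) * y l)\<^sup>2 = (\<Sum>l\<in>L. (x (k - l) * sqrt (y l)) * sqrt (y l))\<^sup>2"
      using y0 by (simp add: mult.assoc)
    also have "\<dots> \<le> (\<Sum>l\<in>L. (x (k - l) * sqrt (y l))\<^sup>2) * (\<Sum>l\<in>L. (sqrt (y l))\<^sup>2)"
      by (rule Cauchy_Schwarz_ineq_sum)
    also have "\<dots> = (\<Sum>l\<in>L. (x (k - l))\<^sup>2 * y l) * sum y L"
      using y0 by (simp add: power_mult_distrib)
    also have "\<dots> \<le> (\<Sum>l\<in>L. (x (k - l))\<^sup>2 * y l) * S"
      using S y0 by (intro mult_left_mono sum_nonneg) auto
    finally show ?thesis by (simp add: mult.commute)
  qed
  have 2: "(\<Sum>k\<in>K. (x (k - l))\<^sup>2) \<le> N" for l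
  proof -
    have "(\<Sum>k\<in>K. (x (k - l))\<^sup>2) = (\<Sum>k\<in>(\<lambda>k. k - l) ` K. (x k)\<^sup>2)"
      by (subst sum.reindex) (auto simp: inj_on_def)
    also have "\<dots> \<le> N" unfolding N_def
      using K x by (intro finite_sum_le_infsum) auto
    finally show ?thesis .
  qed
  have "(\<Sum>k\<in>K. (\<Sum>l\<in>L. x (k - l) * y l)\<^sup>2) \<le> (\<Sum>k\<in>K. S * (\<Sum>l\<in>L. (x (k - l))\<^sup>2 * y l))"
    by (intro sum_mono 1)
  also have "\<dots> = S * (\<Sum>l\<in>L. y l * (\<Sum>k\<in>K. (x (k - l))\<^sup>2))"
    by (subst sum_distrib_left[symmetric], subst sum.swap) (simp add: sum_distrib_left mult.commute)
  also have "\<dots> \<le> S * (\<Sum>l\<in>L. y l * N)"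
    using S0 y0 2 by (intro mult_left_mono sum_mono) auto
  also have "\<dots> = S * (sum y L * N)" by (simp add: sum_distrib_right)
  also have "\<dots> \<le> S * (S * N)"
    using S S0 N0 by (intro mult_left_mono mult_right_mono) auto
  finally show ?thesis by (simp add: S_def N_def power2_eq_square mult.assoc)
qed

abbreviation hm :: "real \<Rightarrow> (int^'d \<Rightarrow> complex) \<Rightarrow> int^'d \<Rightarrow> real" where
  "hm s c k \<equiv> hw s k * (cmod (c k))\<^sup>2"

text \<open>Peetre's inequality distributes the weight over the two factors, then Young's inequality
  applies. The possibly negative order \<open>s\<close> always falls on \<open>X\<close>, and
  \<open>Y\<close> pays with a positive weight. \<open>Z\<close> enters through
  \<open>has_sum\<close> because it will be the coefficient sequence of a product of
  functions.\<close>

lemma weighted_convolution: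
  fixes X Y Z :: "int^'d \<Rightarrow> complex"
  assumes Z: "\<And>k. ((\<lambda>l. X (k - l) * Y l) has_sum Z k) UNIV"
    and X: "(\<lambda>k. hm s X k) summable_on UNIV"
    and Y: "(\<lambda>l. hw (\<bar>s\<bar>/2) l * cmod (Y l)) summable_on UNIV"
    and K: "finite K"
  shows "(\<Sum>k\<in>K. hm s Z k)
    \<le> 2 powr \<bar>s\<bar> * (\<Sum>\<^sub>\<infinity>l. hw (\<bar>s\<bar>/2) l * cmod (Y l))\<^sup>2 * (\<Sum>\<^sub>\<infinity>k. hm s X k)"
proof -
  define x where "x k = hw (s/2) k * cmod (X k)" for k
  define y where "y l = hw (\<bar>s\<bar>/2) l * cmod (Y l)" for l
  define c where "c = 2 powr \<bar>s/2\<bar>"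
  have c2: "c\<^sup>2 = 2 powr \<bar>s\<bar>" by (simp add: c_def power2_eq_square flip: powr_add)
  have c0: "0 \<le> c" by (simp add: c_def)
  have xsq: "(x k)\<^sup>2 = hm s X k" for k
    by (simp add: x_def power_mult_distrib hw_half_sq)
  have xs: "(\<lambda>k. (x k)\<^sup>2) summable_on UNIV" using X by (simp add: xsq)
  define B where "B = c\<^sup>2 * ((infsum y UNIV)\<^sup>2 * (\<Sum>\<^sub>\<infinity>k. (x k)\<^sup>2))"
  have fin: "(\<Sum>k\<in>K. hw s k * (cmod (\<Sum>l\<in>L. X (k - l) * Y l))\<^sup>2) \<le> B" if L: "finite L" for L
  proof -
    have "hw s k * (cmod (\<Sum>l\<in>L. X (k - l) * Y l))\<^sup>2 \<le> c\<^sup>2 * (\<Sum>l\<in>L. x (k - l) * y l)\<^sup>2" for k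
    proof -
      have "hw (s/2) k * cmod (\<Sum>l\<in>L. X (k - l) * Y l) \<le> hw (s/2) k * (\<Sum>l\<in>L. cmod (X (k - l)) * cmod (Y l))"
        by (intro mult_left_mono order_trans[OF norm_sum]) (auto simp: norm_mult)
      also have "\<dots> = (\<Sum>l\<in>L. hw (s/2) k * (cmod (X (k - l)) * cmod (Y l)))"
        by (simp add: sum_distrib_left)
      also have "\<dots> \<le> (\<Sum>l\<in>L. (c * (hw (s/2) (k - l) * hw (\<bar>s\<bar>/2) l)) * (cmod (X (k - l)) * cmod (Y l)))"
        using peetre[of "s/2" k] by (intro sum_mono mult_right_mono) (auto simp: c_def)
      also have "\<dots> = c * (\<Sum>l\<in>L. x (k - l) * y l)"
        by (simp add: sum_distrib_left x_def y_def algebra_simps)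
      finally have "(hw (s/2) k * cmod (\<Sum>l\<in>L. X (k - l) * Y l))\<^sup>2 \<le> (c * (\<Sum>l\<in>L. x (k - l) * y l))\<^sup>2"
        by (intro power_mono) auto
      then show ?thesis by (simp add: power_mult_distrib hw_half_sq)
    qed
    then have "(\<Sum>k\<in>K. hw s k * (cmod (\<Sum>l\<in>L. X (k - l) * Y l))\<^sup>2) \<le> (\<Sum>k\<in>K. c\<^sup>2 * (\<Sum>l\<in>L. x (k - l) * y l)\<^sup>2)"
      by (intro sum_mono)
    also have "\<dots> \<le> B"
      unfolding B_def sum_distrib_left[symmetric]
      by (intro mult_left_mono young_l1_l2_finite xs K L) (use Y in \<open>auto simp: x_def y_def\<close>)
    finally show ?thesis .
  qed
  \<comment> \<open>With \<open>K\<close> fixed, the limit over \<open>L\<close> passes through a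
    finite sum.\<close>
  have "((\<lambda>L. \<Sum>k\<in>K. hw s k * (cmod (\<Sum>l\<in>L. X (k - l) * Y l))\<^sup>2) \<longlongrightarrow> (\<Sum>k\<in>K. hm s Z k)) (finite_subsets_at_top UNIV)"
    using Z unfolding has_sum_def by (intro tendsto_intros)
  then have "(\<Sum>k\<in>K. hm s Z k) \<le> B"
    by (rule tendsto_upperbound) (auto intro!: eventually_finite_subsets_at_top_weakI fin)
  then show ?thesis by (simp add: B_def c2 xsq y_def[abs_def] mult.assoc)
qed

lemma summable_on_int_powr:
  assumes "p > 1/2"
  shows "(\<lambda>n::int. (1 + (real_of_int n)\<^sup>2) powr (- p)) summable_on UNIV"
proof -
  define f where "f n = (1 + (real_of_int n)\<^sup>2) powr (- p)" for n :: int
  have s: "summable (\<lambda>n. f (int n))"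
  proof (rule summable_comparison_test'[where N = 1])
    show "summable (\<lambda>n. real n powr (- 2 * p))" using assms by (simp add: summable_real_powr_iff)
    fix n :: nat assume n: "n \<ge> 1"
    have "f (int n) \<le> ((real n)\<^sup>2) powr (- p)" unfolding f_def using n assms by (intro powr_mono2') auto
    also have "(real n)\<^sup>2 = real n powr 2" using n by simp
    also have "(real n powr 2) powr (- p) = real n powr (- 2 * p)" by (simp only: powr_powr) simp
    finally show "norm (f (int n)) \<le> real n powr (- 2 * p)" by (simp add: f_def)
  qed
  have 1: "(\<lambda>n. f (int n)) summable_on UNIV"
    by (rule summable_nonneg_imp_summable_on[OF s]) (simp add: f_def)
  have 2: "f summable_on (range int)"
    by (subst summable_on_reindex) (use 1 in \<open>auto simp: o_def\<close>)
  have 3: "f summable_on ((\<lambda>n. - int n) ` UNIV)"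
    by (subst summable_on_reindex) (use 1 in \<open>auto simp: o_def f_def inj_on_def\<close>)
  have "range int \<union> range (\<lambda>n. - int n) = UNIV"
  proof -
    have "x \<in> range int \<union> range (\<lambda>n. - int n)" for x :: int
      by (cases x rule: int_cases2) auto
    then show ?thesis by blast
  qed
  then show ?thesis using summable_on_union[OF 2 3] by (simp add: f_def[abs_def])
qed

text \<open>Every \<open>1 + (k $ i)\<^sup>2\<close> is at most \<open>1 + ksq k\<close>, so their
  product is at most the \<open>d\<close>-th power of the latter. With exponent
  \<open>p = al / d > 1/2\<close> per coordinate the lattice sum is dominated by a product of
  convergent one-dimensional sums.\<close>

lemma lattice_sum_summable:
  assumes "al > real CARD('d) / 2"
  shows "(\<lambda>k::int^'d. hw (- al) k) summable_on UNIV"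
proof -
  define p where "p = al / real CARD('d)"
  have p: "p > 1/2" using assms by (simp add: p_def field_simps)
  define f where "f n = (1 + (real_of_int n)\<^sup>2) powr (- p)" for n :: int
  have f: "f summable_on UNIV" unfolding f_def by (rule summable_on_int_powr[OF p])
  have f0: "0 \<le> f n" for n by (simp add: f_def)
  have le: "hw (- al) k \<le> (\<Prod>i\<in>UNIV. f (k $ i))" for k :: "int^'d"
  proof -
    have "(\<Prod>i\<in>UNIV. (1 + (real_of_int (k $ i))\<^sup>2)) \<le> (\<Prod>i\<in>(UNIV::'d set). 1 + ksq k)"
      by (intro prod_mono conjI add_left_mono) (auto simp: ksq_def intro: member_le_sum)
    then have 1: "(\<Prod>i\<in>UNIV. (1 + (real_of_int (k $ i))\<^sup>2)) \<le> (1 + ksq k) ^ CARD('d)" by simp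
    have "hw (- al) k = ((1 + ksq k) ^ CARD('d)) powr (- p)"
      by (subst powr_realpow[symmetric]) (simp_all add: hw_def p_def powr_powr)
    also have "\<dots> \<le> (\<Prod>i\<in>UNIV. (1 + (real_of_int (k $ i))\<^sup>2)) powr (- p)"
      using p 1 by (intro powr_mono2') (auto intro!: prod_pos add_pos_nonneg)
    also have "\<dots> = (\<Prod>i\<in>UNIV. f (k $ i))"
      unfolding f_def by (simp add: prod_powr_distrib)
    finally show ?thesis .
  qed
  show ?thesis
  proof (rule summable_infsum_le_of_finite_sums(1)[where C = "(infsum f UNIV) ^ CARD('d)"])
    fix K :: "(int^'d) set" assume K: "finite K"
    \<comment> \<open>All coordinates occurring in \<open>K\<close>: then \<open>K\<close> embeds
      into the finite box of functions with values in \<open>R\<close>, over which a product of sums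
      expands.\<close>
    define R where "R = (\<Union>k\<in>K. range (\<lambda>i. k $ i))"
    have R: "finite R" using K by (auto simp: R_def)
    have "(\<Sum>k\<in>K. hw (- al) k) \<le> (\<Sum>k\<in>K. \<Prod>i\<in>UNIV. f (k $ i))" by (intro sum_mono le)
    also have "\<dots> = (\<Sum>g\<in>vec_nth ` K. \<Prod>i\<in>UNIV. f (g i))"
      by (subst sum.reindex) (auto simp: inj_on_def vec_nth_inject)
    also have "\<dots> \<le> (\<Sum>g\<in>PiE (UNIV :: 'd set) (\<lambda>_. R). \<Prod>i\<in>UNIV. f (g i))"
      by (rule sum_mono2) (use R in \<open>auto simp: R_def f0 intro!: prod_nonneg finite_PiE\<close>)
    also have "\<dots> = (\<Prod>i\<in>(UNIV::'d set). \<Sum>n\<in>R. f n)" using R by (subst prod_sum_PiE) auto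
    also have "\<dots> \<le> (\<Prod>i\<in>(UNIV::'d set). infsum f UNIV)"
      using R f f0 by (intro prod_mono conjI sum_nonneg finite_sum_le_infsum) auto
    finally show "(\<Sum>k\<in>K. hw (- al) k) \<le> (infsum f UNIV) ^ CARD('d)" by simp
  qed auto
qed

section \<open>Integration and characters on the torus\<close>

lemma sum_Basis_nth [simp]: "(\<Sum>b\<in>(Basis :: (real^'d) set). b $ i) = 1"
proof -
  have "(\<Sum>b\<in>(Basis :: (real^'d) set). b $ i) = (\<Sum>b\<in>(Basis :: (real^'d) set). b \<bullet> axis i 1)"
    by (simp add: cart_eq_inner_axis)
  also have "\<dots> = (\<Sum>b\<in>(Basis :: (real^'d) set). if b = axis i 1 then 1 else 0)"
    by (intro sum.cong refl inner_Basis) (auto simp: axis_in_Basis_iff)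
  also have "\<dots> = 1" by (simp add: axis_in_Basis_iff)
  finally show ?thesis .
qed

lemma mem_cube: "x \<in> (cube :: (real^'d) set) \<longleftrightarrow> (\<forall>i. 0 \<le> x $ i \<and> x $ i \<le> 1)"
  by (simp add: cube_def mem_box_cart)

lemma mem_box_open_cube: "x \<in> box 0 (One :: real^'d) \<longleftrightarrow> (\<forall>i. 0 < x $ i \<and> x $ i < 1)"
  by (simp add: mem_box_cart)

lemma tfrac_in_cube: "tfrac x \<in> cube"
  by (auto simp: mem_cube tfrac_def less_imp_le[OF frac_lt_1])

lemma cube_sets [simp, measurable]: "(cube :: (real^'d) set) \<in> sets borel" "(cube :: (real^'d) set) \<in> sets lebesgue"
  by (auto simp: cube_def)

abbreviation \<T> :: "(real^'d) measure" where
  "\<T> \<equiv> lebesgue_on cube"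

lemma emeasure_cube: "emeasure lborel (cube :: (real^'d) set) = 1"
  by (simp add: cube_def emeasure_lborel_cbox_eq inner_Basis inner_sum_left_Basis)

lemma finite_measure_cube [simp]: "finite_measure (\<T> :: (real^'d) measure)"
  by (intro finite_measureI) (simp add: emeasure_restrict_space emeasure_cube)

lemma measure_cube: "measure \<T> (cube :: (real^'d) set) = 1"
  by (simp add: measure_restrict_space) (simp add: measure_def emeasure_cube)

lemma space_lebesgue_on_cube [simp]: "space (\<T> :: (real^'d) measure) = cube"
  by simp

lemma frontier_cube_null: "AE x in (\<T> :: (real^'d) measure). x \<in> box 0 One"
proof -
  have "negligible (cube - box 0 (One :: real^'d))"
    unfolding cube_def by (rule negligible_frontier_interval)
  then have "cube - box 0 (One :: real^'d) \<in> null_sets lebesgue"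
    by (simp add: negligible_iff_null_sets)
  then have "AE x in lebesgue. x \<notin> cube - box 0 (One :: real^'d)" by (rule AE_not_in)
  then show ?thesis by (subst AE_restrict_space_iff) (auto elim!: eventually_mono)
qed

lemma AE_lebesgue_on_cube: "(AE x in \<T>. P x) \<longleftrightarrow> (AE x in lborel. x \<in> (cube :: (real^'d) set) \<longrightarrow> P x)"
  by (subst AE_restrict_space_iff) (auto simp: AE_completion_iff)

section \<open>Invariance of the integral under reflection and translation modulo 1\<close>

lemma lborel_reflect_translate: "distr lborel borel (\<lambda>z. c - z :: real^'d) = lborel"
proof -
  have "(lborel :: (real^'d) measure) = density (distr lborel borel (\<lambda>x. c + (-1) *\<^sub>R x)) (\<lambda>_. \<bar>- 1 :: real\<bar> ^ DIM(real^'d))"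
    by (rule lborel_affine) simp
  then show ?thesis by (simp add: density_1)
qed

lemma borel_measurable_tfrac [measurable]: "tfrac \<in> borel_measurable borel"
proof (rule borel_measurable_euclidean_space[THEN iffD2], rule ballI)
  fix b :: "real^'d" assume "b \<in> Basis"
  then obtain i where b: "b = axis i 1" by (auto simp: Basis_vec_def)
  have "(\<lambda>x. tfrac x \<bullet> b) = (\<lambda>x::real^'d. frac (x $ i))"
    by (simp add: b cart_eq_inner_axis[symmetric] tfrac_def)
  moreover have "(\<lambda>x::real^'d. frac (x $ i)) \<in> borel_measurable borel"
    unfolding frac_def by measurable
  ultimately show "(\<lambda>x. tfrac x \<bullet> b) \<in> borel_measurable borel" by simp
qed

lemma nn_integral_reflect_translate:
  assumes [measurable]: "f \<in> borel_measurable borel"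
  shows "(\<integral>\<^sup>+ z. f (c - z :: real^'d) \<partial>lborel) = (\<integral>\<^sup>+ z. f z \<partial>lborel)"
proof -
  have "(\<integral>\<^sup>+ z. f z \<partial>lborel) = (\<integral>\<^sup>+ z. f z \<partial>distr lborel borel (\<lambda>z. c - z))"
    by (simp add: lborel_reflect_translate)
  also have "\<dots> = (\<integral>\<^sup>+ z. f (c - z) \<partial>lborel)" by (subst nn_integral_distr) auto
  finally show ?thesis by simp
qed

text \<open>Contains exactly one point of each class modulo the lattice, which the closed cube does
  not; the two differ by a null set.\<close>

definition half_open_cube :: "(real^'d) set" where
  "half_open_cube = {x. \<forall>i. 0 \<le> x $ i \<and> x $ i < 1}"

lemma half_open_cube_sets [measurable]: "half_open_cube \<in> sets borel"
  unfolding half_open_cube_def by measurable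

definition zvec :: "int^'d \<Rightarrow> real^'d" where
  "zvec n = (\<chi> i. real_of_int (n $ i))"

lemma half_open_translate_iff: "x - zvec n \<in> half_open_cube \<longleftrightarrow> n = (\<chi> i. \<lfloor>x $ i\<rfloor>)"
proof -
  have "0 \<le> x $ i - real_of_int (n $ i) \<and> x $ i - real_of_int (n $ i) < 1 \<longleftrightarrow> n $ i = \<lfloor>x $ i\<rfloor>" for i
    by linarith
  then show ?thesis by (simp add: half_open_cube_def zvec_def vec_eq_iff)
qed

lemma tfrac_eq: "tfrac x = x - zvec (\<chi> i. \<lfloor>x $ i\<rfloor>)"
  by (simp add: tfrac_def zvec_def vec_eq_iff frac_def)

lemma nn_integral_count_unique:
  fixes c :: ennreal
  shows "(\<integral>\<^sup>+ n. indicator {m} n * c \<partial>count_space (UNIV :: (int^'d) set)) = c"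
  by (subst nn_integral_multc) auto

lemma nn_integral_half_open_eq:
  "(\<integral>\<^sup>+ y. indicator half_open_cube y * f y \<partial>lborel) = (\<integral>\<^sup>+ y. indicator (cube :: (real^'d) set) y * f y \<partial>lborel)"
proof (rule nn_integral_cong_AE)
  have "AE y in lborel. y \<in> (cube :: (real^'d) set) \<longrightarrow> y \<in> box 0 One"
    using frontier_cube_null[where 'd='d] unfolding AE_lebesgue_on_cube by simp
  then show "AE y in lborel. indicator half_open_cube y * f y = indicator (cube :: (real^'d) set) y * f y"
  proof eventually_elim
    case (elim y)
    then have "y \<in> half_open_cube \<longleftrightarrow> y \<in> cube"
      unfolding mem_cube mem_box_open_cube half_open_cube_def by (auto intro: less_imp_le)
    then show ?case by (simp add: indicator_def)
  qed
qed

text \<open>Folding: \<open>tfrac (x - y)\<close> is the only lattice translate of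
  \<open>x - y\<close> in the half-open cube, so the integrand is a sum over translates. After
  Tonelli each summand is reflected and shifted over the whole space, and the sum collapses again
  because exactly one translate of \<open>x - z\<close> lies in the cube.\<close>

lemma nn_integral_tfrac:
  fixes g :: "real^'d \<Rightarrow> ennreal"
  assumes [measurable]: "g \<in> borel_measurable borel"
  shows "(\<integral>\<^sup>+ y. indicator cube y * g (tfrac (x - y)) \<partial>lborel) = (\<integral>\<^sup>+ z. indicator cube z * g z \<partial>lborel)"
proof -
  let ?I = "half_open_cube :: (real^'d) set"
  let ?C = "count_space (UNIV :: (int^'d) set)"
  have "(\<integral>\<^sup>+ y. indicator cube y * g (tfrac (x - y)) \<partial>lborel) = (\<integral>\<^sup>+ y. indicator ?I y * g (tfrac (x - y)) \<partial>lborel)"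
    by (rule nn_integral_half_open_eq[symmetric])
  also have "\<dots> = (\<integral>\<^sup>+ y. (\<integral>\<^sup>+ n. indicator ?I y * indicator ?I (x - y - zvec n) * g (x - y - zvec n) \<partial>?C) \<partial>lborel)"
  proof (rule nn_integral_cong)
    fix y :: "real^'d"
    define m where "m = (\<chi> i. \<lfloor>(x - y) $ i\<rfloor>)"
    have "indicator ?I y * indicator ?I (x - y - zvec n) * g (x - y - zvec n)
        = indicator {m} n * (indicator ?I y * g (tfrac (x - y)))" for n
      unfolding indicator_def half_open_translate_iff m_def[symmetric] tfrac_eq by auto
    then show "indicator ?I y * g (tfrac (x - y))
        = (\<integral>\<^sup>+ n. indicator ?I y * indicator ?I (x - y - zvec n) * g (x - y - zvec n) \<partial>?C)"
      by (simp add: nn_integral_count_unique)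
  qed
  also have "\<dots> = (\<integral>\<^sup>+ n. (\<integral>\<^sup>+ y. indicator ?I y * indicator ?I (x - y - zvec n) * g (x - y - zvec n) \<partial>lborel) \<partial>?C)"
    by (rule nn_integral_count_space_nn_integral) auto
  also have "\<dots> = (\<integral>\<^sup>+ n. (\<integral>\<^sup>+ z. indicator ?I (x - z - zvec n) * indicator ?I z * g z \<partial>lborel) \<partial>?C)"
  proof (rule nn_integral_cong)
    fix n :: "int^'d"
    have "(\<integral>\<^sup>+ z. indicator ?I (x - z - zvec n) * indicator ?I z * g z \<partial>lborel)
      = (\<integral>\<^sup>+ y. indicator ?I (x - (x - zvec n - y) - zvec n) * indicator ?I (x - zvec n - y) * g (x - zvec n - y) \<partial>lborel)"
      by (rule nn_integral_reflect_translate[symmetric]) measurable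
    also have "\<dots> = (\<integral>\<^sup>+ y. indicator ?I y * indicator ?I (x - y - zvec n) * g (x - y - zvec n) \<partial>lborel)"
      by (simp add: algebra_simps)
    finally show "(\<integral>\<^sup>+ y. indicator ?I y * indicator ?I (x - y - zvec n) * g (x - y - zvec n) \<partial>lborel)
       = (\<integral>\<^sup>+ z. indicator ?I (x - z - zvec n) * indicator ?I z * g z \<partial>lborel)" ..
  qed
  also have "\<dots> = (\<integral>\<^sup>+ z. (\<integral>\<^sup>+ n. indicator ?I (x - z - zvec n) * indicator ?I z * g z \<partial>?C) \<partial>lborel)"
    by (rule nn_integral_count_space_nn_integral[symmetric]) auto
  also have "\<dots> = (\<integral>\<^sup>+ z. indicator ?I z * g z \<partial>lborel)"
  proof (rule nn_integral_cong)
    fix z :: "real^'d"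
    define m where "m = (\<chi> i. \<lfloor>(x - z) $ i\<rfloor>)"
    have "indicator ?I (x - z - zvec n) * indicator ?I z * g z = indicator {m} n * (indicator ?I z * g z)" for n
      unfolding indicator_def half_open_translate_iff m_def[symmetric] by auto
    then show "(\<integral>\<^sup>+ n. indicator ?I (x - z - zvec n) * indicator ?I z * g z \<partial>?C) = indicator ?I z * g z"
      by (simp add: nn_integral_count_unique)
  qed
  also have "\<dots> = (\<integral>\<^sup>+ z. indicator cube z * g z \<partial>lborel)" by (rule nn_integral_half_open_eq)
  finally show ?thesis .
qed

lemma distr_tfrac:
  "distr (restrict_space lborel (cube :: (real^'d) set)) borel (\<lambda>y. tfrac (x - y)) = distr (restrict_space lborel cube) borel (\<lambda>y. y)"
proof (rule measure_eqI)
  fix A :: "(real^'d) set" assume "A \<in> sets (distr (restrict_space lborel (cube :: (real^'d) set)) borel (\<lambda>y. tfrac (x - y)))"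
  then have [measurable]: "A \<in> sets borel" by simp
  have m1: "(\<lambda>y. tfrac (x - y)) \<in> measurable (restrict_space lborel (cube :: (real^'d) set)) borel"
    by (intro measurable_restrict_space1) measurable
  have m2: "(\<lambda>y. y) \<in> measurable (restrict_space lborel (cube :: (real^'d) set)) borel"
    by (intro measurable_restrict_space1) measurable
  have "emeasure (distr (restrict_space lborel (cube :: (real^'d) set)) borel (\<lambda>y. tfrac (x - y))) A
    = (\<integral>\<^sup>+ y. indicator A (tfrac (x - y)) \<partial>restrict_space lborel cube)"
    using m1 by (subst nn_integral_distr[symmetric]) auto
  also have "\<dots> = (\<integral>\<^sup>+ y. indicator cube y * indicator A (tfrac (x - y)) \<partial>lborel)"
    by (subst nn_integral_restrict_space) (auto simp: mult.commute)
  also have "\<dots> = (\<integral>\<^sup>+ y. indicator cube y * indicator A y \<partial>lborel)" by (rule nn_integral_tfrac) auto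
  also have "\<dots> = (\<integral>\<^sup>+ y. indicator A y \<partial>restrict_space lborel cube)"
    by (subst nn_integral_restrict_space) (auto simp: mult.commute)
  also have "\<dots> = emeasure (distr (restrict_space lborel (cube :: (real^'d) set)) borel (\<lambda>y. y)) A"
    using m2 by (subst nn_integral_distr[symmetric]) auto
  finally show "emeasure (distr (restrict_space lborel (cube :: (real^'d) set)) borel (\<lambda>y. tfrac (x - y))) A
    = emeasure (distr (restrict_space lborel (cube :: (real^'d) set)) borel (\<lambda>y. y)) A" .
qed auto

text \<open>Bridge between the Lebesgue measure of the definitions and the Borel measure on which
  image measures and Fubini are applied.\<close>

lemma integral_lebesgue_on_cube_borel:
  fixes f :: "real^'d \<Rightarrow> 'b::{banach, second_countable_topology}"
  assumes [measurable]: "f \<in> borel_measurable borel"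
  shows "integral\<^sup>L \<T> f = integral\<^sup>L (restrict_space lborel cube) f"
    "integrable \<T> f \<longleftrightarrow> integrable (restrict_space lborel cube) f"
  by (auto simp: integral_restrict_space integrable_restrict_space integral_completion integrable_completion)

lemma integral_tfrac:
  fixes f :: "real^'d \<Rightarrow> 'b::{banach, second_countable_topology}"
  assumes [measurable]: "f \<in> borel_measurable borel"
  shows "(LINT y|\<T>. f (tfrac (x - y))) = (LINT y|\<T>. f y)"
    "integrable \<T> (\<lambda>y. f (tfrac (x - y))) \<longleftrightarrow> integrable \<T> f"
proof -
  have m1: "(\<lambda>y. tfrac (x - y)) \<in> measurable (restrict_space lborel (cube :: (real^'d) set)) borel"
    by (intro measurable_restrict_space1) measurable
  have m2: "(\<lambda>y. y) \<in> measurable (restrict_space lborel (cube :: (real^'d) set)) borel"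
    by (intro measurable_restrict_space1) measurable
  show "(LINT y|\<T>. f (tfrac (x - y))) = (LINT y|\<T>. f y)"
    using arg_cong[OF distr_tfrac[of x], of "\<lambda>M. integral\<^sup>L M f"] m1 m2
    by (simp add: integral_lebesgue_on_cube_borel integral_distr)
  show "integrable \<T> (\<lambda>y. f (tfrac (x - y))) \<longleftrightarrow> integrable \<T> f"
    using arg_cong[OF distr_tfrac[of x], of "\<lambda>M. integrable M f"] m1 m2
    by (simp add: integral_lebesgue_on_cube_borel integrable_distr_eq)
qed

text \<open>A measure preserving map pulls null sets back to null sets. As this holds for each fixed
  \<open>x\<close>, changing representatives leaves \<open>tconv\<close> unchanged at every point,
  not just almost everywhere.\<close>

lemma AE_tfrac:
  assumes "AE z in (\<T> :: (real^'d) measure). P z"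
  shows "AE y in (\<T> :: (real^'d) measure). P (tfrac (x - y))"
proof -
  obtain N where N: "N \<in> null_sets lborel" "{z \<in> space lborel. \<not> (z \<in> (cube :: (real^'d) set) \<longrightarrow> P z)} \<subseteq> N"
    using assms unfolding AE_lebesgue_on_cube by (auto elim!: AE_E simp: null_sets_def)
  then have [measurable]: "N \<in> sets borel" by (auto simp: null_sets_def)
  have "(\<integral>\<^sup>+ y. indicator cube y * indicator N (tfrac (x - y)) \<partial>lborel) = (\<integral>\<^sup>+ z. indicator cube z * indicator N z \<partial>lborel)"
    by (rule nn_integral_tfrac) measurable
  also have "\<dots> \<le> (\<integral>\<^sup>+ z. indicator N z \<partial>lborel)"
    by (intro nn_integral_mono) (auto simp: indicator_def)
  also have "\<dots> = 0" using N(1) by (auto simp: null_sets_def)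
  finally have "AE y in lborel. indicator (cube :: (real^'d) set) y * indicator N (tfrac (x - y)) = (0::ennreal)"
    by (subst (asm) le_zero_eq, subst (asm) nn_integral_0_iff_AE) auto
  then show ?thesis
    unfolding AE_lebesgue_on_cube
  proof eventually_elim
    case (elim y)
    then show ?case using N(2) tfrac_in_cube[of "x - y"] by (auto simp: indicator_def split: if_splits)
  qed
qed

section \<open>Characters, orthogonality and uniqueness of Fourier coefficients\<close>

definition ek :: "int^'d \<Rightarrow> real^'d \<Rightarrow> complex" where
  "ek k x = cis (2 * pi * kdot k x)"

lemma kdot_add: "kdot (k + l) x = kdot k x + kdot l x"
  and kdot_minus: "kdot (- k) x = - kdot k x"
  and kdot_diff_right: "kdot k (x - y) = kdot k x - kdot k y"
  and kdot_add_right: "kdot k (x + y) = kdot k x + kdot k y"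
  by (simp_all add: kdot_def algebra_simps sum.distrib sum_subtractf flip: sum_negf)

lemma kdot_zvec: "kdot k (zvec n) = real_of_int (\<Sum>i\<in>UNIV. k $ i * n $ i)"
  by (simp add: kdot_def zvec_def)

lemma ek_add: "ek (k + l) x = ek k x * ek l x"
  by (simp add: ek_def kdot_add cis_mult distrib_left)

lemma ek_add_right: "ek k (x + y) = ek k x * ek k y"
  by (simp add: ek_def kdot_add_right cis_mult distrib_left)

lemma ek_minus: "ek (- k) x = cnj (ek k x)"
  by (simp add: ek_def kdot_minus cis_cnj)

lemma ek_0 [simp]: "ek 0 x = 1"
  by (simp add: ek_def kdot_def)

lemma norm_ek [simp]: "cmod (ek k x) = 1"
  by (simp add: ek_def)

lemma ek_zvec [simp]: "ek k (zvec n) = 1"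
  unfolding ek_def kdot_zvec by (rule cis_multiple_2pi) auto

lemma ek_diff_zvec: "ek k (x - zvec n) = ek k x"
proof -
  have "ek k (x - zvec n + zvec n) = ek k (x - zvec n) * ek k (zvec n)" by (rule ek_add_right)
  then show ?thesis by simp
qed

lemma ek_tfrac: "ek k (tfrac x) = ek k x"
  by (simp add: tfrac_eq ek_diff_zvec)

lemma ek_diff_right: "ek k (x - y) = ek k x * cnj (ek k y)"
  by (simp add: ek_def kdot_diff_right cis_cnj cis_mult right_diff_distrib)

lemma continuous_on_ek [continuous_intros]: "continuous_on S (ek k)"
  unfolding ek_def kdot_def cis_conv_exp by (intro continuous_intros)

lemma borel_measurable_ek [measurable]: "ek k \<in> borel_measurable borel"
  by (rule borel_measurable_continuous_onI) (rule continuous_on_ek)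

lemma borel_measurable_ek_lebesgue [measurable]: "ek k \<in> borel_measurable \<T>"
  by (intro measurable_restrict_space1 measurable_completion) simp

lemma integrable_const_cube [simp]: "integrable \<T> (\<lambda>x::real^'d. c :: 'b::{banach, second_countable_topology})"
  by (rule finite_measure.integrable_const[OF finite_measure_cube])

lemma integrable_mult_bounded:
  fixes g h :: "real^'d \<Rightarrow> 'b::{real_normed_field, banach, second_countable_topology}"
  assumes "integrable \<T> g" "h \<in> borel_measurable \<T>"
    and "AE x in \<T>. norm (h x) \<le> B"
  shows "integrable \<T> (\<lambda>x. g x * h x)"
proof (rule Bochner_Integration.integrable_bound)
  show "integrable \<T> (\<lambda>x. of_real B * g x)" using assms(1) by simp
  show "(\<lambda>x. g x * h x) \<in> borel_measurable \<T>" using assms by simp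
  show "AE x in \<T>. norm (g x * h x) \<le> norm (of_real B * g x)"
    using assms(3)
  proof eventually_elim
    case (elim x)
    then have "norm (h x) \<le> \<bar>B\<bar>" by simp
    then show ?case by (simp add: norm_mult mult_left_mono mult.commute[of "\<bar>B\<bar>"])
  qed
qed

text \<open>By invariance the integral equals \<open>ek k x\<close> times the integral of the
  conjugate, for every \<open>x\<close>. Comparing \<open>x = 0\<close> with a point where the
  character is \<open>-1\<close> forces it to vanish, without computing any integral.\<close>

lemma integral_ek: "(LINT x|\<T>. ek (k :: int^'d) x) = (if k = 0 then 1 else 0)"
proof (cases "k = 0")
  case True
  then show ?thesis by (simp add: measure_cube)
next
  case False
  then obtain i where i: "k $ i \<noteq> 0" by (auto simp: vec_eq_iff)
  define I where "I = (LINT x|\<T>. ek k x)"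
  define J where "J = (LINT x|\<T>. cnj (ek k x))"
  have *: "I = ek k x * J" for x
  proof -
    have "I = (LINT y|\<T>. ek k (tfrac (x - y)))"
      unfolding I_def by (rule integral_tfrac(1)[symmetric]) simp
    then show ?thesis by (simp add: ek_tfrac ek_diff_right J_def)
  qed
  have 1: "I = J" using *[of 0] by (simp add: ek_def kdot_def)
  define x :: "real^'d" where "x = axis i (1 / (2 * real_of_int (k $ i)))"
  have "kdot k x = 1/2"
    using i unfolding kdot_def x_def axis_def by (simp add: if_distrib[of "\<lambda>a. _ * a"] cong: if_cong)
  then have "ek k x = cis (2 * pi * (1/2))" by (simp only: ek_def)
  then have "ek k x = -1" by simp
  then have "I = 0" using *[of x] 1 by simp
  then show ?thesis using False by (simp add: I_def)
qed

text \<open>For the uniqueness of Fourier coefficients, the torus is embedded into \<open>complex^'d\<close>, where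
  trigonometric polynomials are restrictions of polynomial functions, so that the
  Stone--Weierstrass theorem applies.\<close>

inductive_set trig_poly :: "(real^'d \<Rightarrow> complex) set" where
  base: "(\<lambda>x. c * ek k x) \<in> trig_poly"
| add: "f \<in> trig_poly \<Longrightarrow> g \<in> trig_poly \<Longrightarrow> (\<lambda>x. f x + g x) \<in> trig_poly"

lemma trig_poly_mult_base: "f \<in> trig_poly \<Longrightarrow> (\<lambda>x. c * ek k x * f x) \<in> trig_poly"
proof (induction rule: trig_poly.induct)
  case (base c' k')
  have "(\<lambda>x. c * ek k x * (c' * ek k' x)) = (\<lambda>x. (c * c') * ek (k + k') x)" by (auto simp: ek_add)
  then show ?case by (simp add: trig_poly.base)
next
  case (add f g)
  then show ?case using trig_poly.add[OF add.IH] by (simp add: distrib_left)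
qed

lemma trig_poly_mult: "f \<in> trig_poly \<Longrightarrow> g \<in> trig_poly \<Longrightarrow> (\<lambda>x. f x * g x) \<in> trig_poly"
proof (induction rule: trig_poly.induct)
  case (base c k)
  then show ?case by (rule trig_poly_mult_base)
next
  case (add f h)
  then show ?case using trig_poly.add[OF add.IH] by (simp add: distrib_right)
qed

lemma trig_poly_const: "(\<lambda>x. c) \<in> trig_poly"
  using trig_poly.base[of c 0] by simp

lemma trig_poly_sum: "finite I \<Longrightarrow> (\<And>i. i \<in> I \<Longrightarrow> f i \<in> trig_poly) \<Longrightarrow> (\<lambda>x. \<Sum>i\<in>I. f i x) \<in> trig_poly"
  by (induction I rule: finite_induct) (auto intro: trig_poly_const trig_poly.add)

lemma trig_poly_orthogonal:
  fixes g :: "real^'d \<Rightarrow> complex"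
  assumes g: "integrable \<T> g" and 0: "\<And>k. (LINT x|\<T>. g x * ek k x) = 0"
  assumes "f \<in> trig_poly"
  shows "integrable \<T> (\<lambda>x. g x * f x) \<and> (LINT x|\<T>. g x * f x) = 0"
  using assms(3)
proof (induction rule: trig_poly.induct)
  case (base c k)
  have "integrable \<T> (\<lambda>x. g x * ek k x)"
    by (rule integrable_mult_bounded[OF g, where B = 1]) auto
  then show ?case using 0[of k] by (simp add: mult.left_commute)
next
  case (add f h)
  then show ?case by (simp add: distrib_left)
qed

definition torus_embed :: "real^'d \<Rightarrow> complex^'d" where
  "torus_embed x = (\<chi> i. cis (2 * pi * x $ i))"

lemma continuous_on_torus_embed: "continuous_on S torus_embed"
  unfolding torus_embed_def cis_conv_exp by (intro continuous_intros)

lemma ek_axis: "ek (axis i 1) x = cis (2 * pi * x $ i)"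
  unfolding ek_def kdot_def axis_def
  by (simp add: if_distrib[of real_of_int] if_distrib[of "\<lambda>a. a * _"] cong: if_cong)

text \<open>A real linear functional of the embedded point is a combination of sines and cosines of
  the coordinates, hence of the characters of index \<open>axis i 1\<close> and
  \<open>- axis i 1\<close>; closure of \<open>trig_poly\<close> under sums and products does the
  rest.\<close>

lemma real_polynomial_trig_poly:
  fixes p :: "complex^'d \<Rightarrow> real"
  assumes "real_polynomial_function p"
  shows "(\<lambda>x. complex_of_real (p (torus_embed x))) \<in> trig_poly"
  using assms
proof (induction rule: real_polynomial_function.induct)
  case (linear f)
  then interpret f: bounded_linear f .
  have decomp: "z = (\<Sum>i\<in>UNIV. Re (z $ i) *\<^sub>R axis i 1 + Im (z $ i) *\<^sub>R axis i \<i>)" for z :: "complex^'d"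
  proof (subst vec_eq_iff, rule allI)
    fix j
    have "(\<Sum>i\<in>UNIV. Re (z $ i) *\<^sub>R axis i 1 + Im (z $ i) *\<^sub>R axis i \<i>) $ j
        = (\<Sum>i\<in>UNIV. if i = j then complex_of_real (Re (z $ j)) + complex_of_real (Im (z $ j)) * \<i> else 0)"
      unfolding sum_component by (intro sum.cong) (auto simp: axis_def scaleR_conv_of_real[where 'a=complex])
    also have "\<dots> = z $ j" by (simp add: complex_eq_iff)
    finally show "z $ j = (\<Sum>i\<in>UNIV. Re (z $ i) *\<^sub>R axis i 1 + Im (z $ i) *\<^sub>R axis i \<i>) $ j" by simp
  qed
  have "complex_of_real (f (torus_embed x)) =
     (\<Sum>i\<in>UNIV. ((f (axis i 1) / 2 - \<i> / 2 * f (axis i \<i>)) * ek (axis i 1) x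
        + (f (axis i 1) / 2 + \<i> / 2 * f (axis i \<i>)) * ek (- axis i 1) x))" for x
  proof -
    have "f (torus_embed x) = (\<Sum>i\<in>UNIV. cos (2 * pi * x $ i) * f (axis i 1) + sin (2 * pi * x $ i) * f (axis i \<i>))"
      by (subst decomp) (simp add: f.sum f.add f.scaleR torus_embed_def)
    then show ?thesis
      unfolding ek_minus ek_axis of_real_sum
      by (auto intro!: sum.cong simp: complex_eq_iff algebra_simps)
  qed
  then show ?case
    by (simp only:) (intro trig_poly_sum trig_poly.add trig_poly.base; simp)
next
  case (const c)
  then show ?case by (rule trig_poly_const)
next
  case (add f g)
  then show ?case using trig_poly.add[OF add.IH] by simp
next
  case (mult f g)
  then show ?case using trig_poly_mult[OF mult.IH] by simp
qed

text \<open>Coordinates with the same \<open>cis\<close> differ by an integer, which is 0 as soon as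
  one of the two points is interior. Only boundary points are glued, so a function vanishing on the
  boundary descends to the image.\<close>

lemma torus_embed_eq_cases:
  assumes x: "x \<in> cube" and y: "y \<in> cube" and eq: "torus_embed x = torus_embed y"
  shows "x = y \<or> x \<notin> box 0 One \<and> y \<notin> box 0 One"
proof (rule disjCI)
  assume "\<not> (x \<notin> box 0 One \<and> y \<notin> box 0 One)"
  then have o: "x \<in> box 0 One \<or> y \<in> box 0 One" by auto
  show "x = y"
  proof (subst vec_eq_iff, rule allI)
    fix i
    have "cis (2 * pi * x $ i) = cis (2 * pi * y $ i)"
      using eq by (simp add: torus_embed_def vec_eq_iff)
    then have "cis (2 * pi * (x $ i - y $ i)) = 1"
      by (simp add: right_diff_distrib flip: cis_divide)
    then have "cos (2 * pi * (x $ i - y $ i)) = 1" by (simp add: complex_eq_iff)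
    then obtain n :: int where "2 * pi * (x $ i - y $ i) = real_of_int n * (2 * pi)"
      unfolding cos_one_2pi_int by auto
    then have "(x $ i - y $ i) * (2 * pi) = real_of_int n * (2 * pi)" by (simp only: mult.commute)
    then have n: "x $ i - y $ i = real_of_int n" unfolding mult_cancel_right by simp
    have "\<bar>x $ i - y $ i\<bar> < 1"
    proof -
      have "0 \<le> x $ i" "x $ i \<le> 1" "0 \<le> y $ i" "y $ i \<le> 1" using x y by (auto simp: mem_cube)
      moreover have "0 < x $ i \<and> x $ i < 1 \<or> 0 < y $ i \<and> y $ i < 1" using o by (auto simp: mem_box_open_cube)
      ultimately show ?thesis by linarith
    qed
    then have "n = 0" using n by linarith
    then show "x $ i = y $ i" using n by simp
  qed
qed

text \<open>The function \<open>h\<close> descends to \<open>F\<close> on the compact image of the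
  embedding, where polynomials approximate it uniformly; against these the integral of
  \<open>g\<close> vanishes, and the error is at most \<open>e\<close> times the L^1 norm of
  \<open>g\<close>.\<close>

lemma integral_continuous_orthogonal_real:
  fixes g :: "real^'d \<Rightarrow> complex" and h :: "real^'d \<Rightarrow> real"
  assumes g: "integrable \<T> g" and 0: "\<And>k. (LINT x|\<T>. g x * ek k x) = 0"
  assumes h: "continuous_on cube h" and h0: "\<And>x. x \<in> cube \<Longrightarrow> x \<notin> box 0 One \<Longrightarrow> h x = 0"
  shows "(LINT x|\<T>. g x * complex_of_real (h x)) = 0"
proof -
  have ccube: "compact (cube :: (real^'d) set)" by (simp add: cube_def)
  define S where "S = torus_embed ` (cube :: (real^'d) set)"
  have S: "compact S" unfolding S_def by (rule compact_continuous_image[OF continuous_on_torus_embed ccube])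
  define F where "F z = h (SOME x. x \<in> cube \<and> torus_embed x = z)" for z
  have F: "F (torus_embed x) = h x" if "x \<in> cube" for x
  proof -
    define y where "y = (SOME y. y \<in> cube \<and> torus_embed y = torus_embed x)"
    have "y \<in> cube \<and> torus_embed y = torus_embed x"
      unfolding y_def by (rule someI[where x = x]) (use that in auto)
    then have "h y = h x" using torus_embed_eq_cases[of y x] that h0 by auto
    then show ?thesis by (simp add: F_def y_def)
  qed
  \<comment> \<open>The preimage of a closed set under \<open>F\<close> is the image of a compact
    subset of the cube, so no continuous inverse of the embedding is required.\<close>
  have Fc: "continuous_on S F"
  proof (subst continuous_on_closed_vimage)
    show "closed S" using S by (rule compact_imp_closed)
    show "\<forall>B. closed B \<longrightarrow> closed (F -` B \<inter> S)"
    proof (intro allI impI)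
      fix B :: "real set" assume B: "closed B"
      have "F -` B \<inter> S = torus_embed ` (h -` B \<inter> cube)" using F by (auto simp: S_def)
      moreover have "compact (h -` B \<inter> cube)"
        using continuous_closed_preimage[OF h compact_imp_closed[OF ccube] B] ccube
        by (metis Int_commute Int_assoc Int_absorb closed_Int_compact)
      ultimately show "closed (F -` B \<inter> S)"
        by (metis compact_continuous_image compact_imp_closed continuous_on_torus_embed)
    qed
  qed
  have hm: "(\<lambda>x. complex_of_real (h x)) \<in> borel_measurable \<T>"
    by (intro continuous_imp_measurable_on_sets_lebesgue continuous_intros h) simp
  obtain B where B: "\<And>x. x \<in> cube \<Longrightarrow> \<bar>h x\<bar> \<le> B"
    using compact_imp_bounded[OF compact_continuous_image[OF h ccube]] by (auto simp: bounded_iff)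
  have gh: "integrable \<T> (\<lambda>x. g x * complex_of_real (h x))"
    by (rule integrable_mult_bounded[OF g hm, where B = B]) (use B in auto)
  define N where "N = (LINT x|\<T>. cmod (g x))"
  have N: "0 \<le> N" by (simp add: N_def)
  have "cmod (LINT x|\<T>. g x * complex_of_real (h x)) \<le> e * N" if e: "e > 0" for e
  proof -
    obtain p where p: "real_polynomial_function p" "\<And>z. z \<in> S \<Longrightarrow> \<bar>F z - p z\<bar> < e"
      using Stone_Weierstrass_real_polynomial_function[OF S Fc e] by blast
    define q where "q x = complex_of_real (p (torus_embed x))" for x :: "real^'d"
    have q: "integrable \<T> (\<lambda>x. g x * q x)" "(LINT x|\<T>. g x * q x) = 0"
      using trig_poly_orthogonal[OF g 0 real_polynomial_trig_poly[OF p(1)]] by (auto simp: q_def)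
    have "(LINT x|\<T>. g x * complex_of_real (h x)) = (LINT x|\<T>. g x * complex_of_real (h x) - g x * q x)"
      using gh q by simp
    also have "cmod \<dots> \<le> (LINT x|\<T>. e * cmod (g x))"
    proof (rule Bochner_Integration.integral_norm_bound_integral)
      fix x :: "real^'d" assume "x \<in> space \<T>"
      then have x: "x \<in> cube" by simp
      then have "\<bar>h x - p (torus_embed x)\<bar> < e" using p(2)[of "torus_embed x"] F[OF x] by (auto simp: S_def)
      moreover have "cmod (g x * complex_of_real (h x) - g x * q x) = cmod (g x) * \<bar>h x - p (torus_embed x)\<bar>"
        by (simp add: q_def norm_mult flip: right_diff_distrib of_real_diff)
      ultimately show "cmod (g x * complex_of_real (h x) - g x * q x) \<le> e * cmod (g x)"
        by (simp add: mult_left_mono mult.commute[of e])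
    qed (use g gh q in auto)
    finally show ?thesis by (simp add: N_def)
  qed
  then have *: "cmod (LINT x|\<T>. g x * complex_of_real (h x)) \<le> e * N" if "e > 0" for e
    using that by blast
  have "((\<lambda>e. e * N) \<longlongrightarrow> 0 * N) (at_right 0)" by (intro tendsto_intros)
  then have "cmod (LINT x|\<T>. g x * complex_of_real (h x)) \<le> 0 * N"
    by (rule tendsto_lowerbound) (auto simp: eventually_at_right_field intro!: * exI[of _ 1])
  then show ?thesis by simp
qed

lemma integral_continuous_orthogonal:
  fixes g h :: "real^'d \<Rightarrow> complex"
  assumes g: "integrable \<T> g" and 0: "\<And>k. (LINT x|\<T>. g x * ek k x) = 0"
  assumes h: "continuous_on cube h" and h0: "\<And>x. x \<in> cube \<Longrightarrow> x \<notin> box 0 One \<Longrightarrow> h x = 0"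
    and B: "\<And>x. x \<in> cube \<Longrightarrow> cmod (h x) \<le> B"
  shows "integrable \<T> (\<lambda>x. g x * h x)" "(LINT x|\<T>. g x * h x) = 0"
proof -
  have int: "integrable \<T> (\<lambda>x. g x * h x)"
    if h: "continuous_on cube h" and B: "\<And>x. x \<in> cube \<Longrightarrow> cmod (h x) \<le> B" for h
    by (rule integrable_mult_bounded[OF g continuous_imp_measurable_on_sets_lebesgue[OF h], where B = B]) (use B in auto)
  show "integrable \<T> (\<lambda>x. g x * h x)" by (rule int[OF h B])
  have R: "(LINT x|\<T>. g x * complex_of_real (Re (h x))) = 0"
    by (rule integral_continuous_orthogonal_real[OF g 0]) (use h h0 in \<open>auto intro!: continuous_intros\<close>)
  have I: "(LINT x|\<T>. g x * complex_of_real (Im (h x))) = 0"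
    by (rule integral_continuous_orthogonal_real[OF g 0]) (use h h0 in \<open>auto intro!: continuous_intros\<close>)
  have "g x * h x = g x * complex_of_real (Re (h x)) + \<i> * (g x * complex_of_real (Im (h x)))" for x
    by (subst complex_eq[of "h x"]) (simp add: algebra_simps)
  moreover have "integrable \<T> (\<lambda>x. g x * complex_of_real (Re (h x)))"
    "integrable \<T> (\<lambda>x. g x * complex_of_real (Im (h x)))"
    using order_trans[OF abs_Re_le_cmod B] order_trans[OF abs_Im_le_cmod B]
    by (auto intro!: int continuous_intros h)
  ultimately show "(LINT x|\<T>. g x * h x) = 0" using R I by simp
qed

text \<open>Testing with the conjugate of \<open>g\<close> would give the integral of
  \<open>(cmod (g x))\<^sup>2\<close>, but \<open>g\<close> is only integrable. Its bounded
  substitute \<open>\<psi> (g x)\<close> keeps \<open>g x * \<psi> (g x)\<close> nonnegative and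
  dominated by \<open>cmod (g x)\<close>. It is approximated by continuous test functions, and
  dominated convergence shows that its integral is 0.\<close>

lemma fourier_uniqueness:
  fixes g :: "real^'d \<Rightarrow> complex"
  assumes g: "integrable \<T> g" and 0: "\<And>k. (LINT x|\<T>. g x * ek k x) = 0"
  shows "AE x in \<T>. g x = 0"
proof -
  have "g measurable_on cube"
    using g by (subst measurable_on_iff_borel_measurable) auto
  then obtain N and gn :: "nat \<Rightarrow> real^'d \<Rightarrow> complex" where N: "negligible N" and gn: "\<And>n. continuous_on UNIV (gn n)"
    and lim: "\<And>x. x \<notin> N \<Longrightarrow> (\<lambda>n. gn n x) \<longlonglongrightarrow> (if x \<in> cube then g x else 0)"
    unfolding measurable_on_def by blast
  define \<psi> :: "complex \<Rightarrow> complex" where "\<psi> z = cnj z / complex_of_real (1 + cmod z)" for z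
  have nz: "complex_of_real (1 + cmod z) \<noteq> 0" for z
    by (metis add_nonneg_eq_0_iff norm_ge_zero of_real_eq_0_iff zero_le_one zero_neq_one)
  have \<psi>c: "continuous_on UNIV \<psi>" unfolding \<psi>_def by (intro continuous_intros) (use nz in auto)
  have \<psi>1: "cmod (\<psi> z) \<le> 1" for z by (simp add: \<psi>_def norm_divide del: of_real_add) (smt (verit) divide_le_eq_1 norm_ge_zero)
  have mult: "z * \<psi> z = complex_of_real ((cmod z)\<^sup>2 / (1 + cmod z))" for z
    by (simp add: \<psi>_def complex_mult_cnj cmod_power2)
  define F where "F = (cube - box 0 One :: (real^'d) set)"
  have F: "closed F" "F \<noteq> {}"
  proof -
    show "closed F" unfolding F_def cube_def by (intro closed_Diff) auto
    have "0 \<in> F" by (simp add: F_def mem_cube mem_box_open_cube)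
    then show "F \<noteq> {}" by auto
  qed
  \<comment> \<open>Cutoff vanishing on the faces and tending to 1 inside, as orthogonality is
    available only for test functions that are 0 on the boundary.\<close>
  define \<eta> where "\<eta> n x = min 1 (real n * infdist x F)" for n and x :: "real^'d"
  have \<eta>c: "continuous_on S (\<eta> n)" for n S unfolding \<eta>_def by (intro continuous_intros)
  have \<eta>01: "0 \<le> \<eta> n x" "\<eta> n x \<le> 1" for n x by (auto simp: \<eta>_def infdist_nonneg)
  have \<eta>lim: "(\<lambda>n. \<eta> n x) \<longlonglongrightarrow> 1" if "x \<in> box 0 One" for x
  proof -
    have "infdist x F > 0" using that F by (intro infdist_pos_not_in_closed) (auto simp: F_def)
    then obtain n0 :: nat where n0: "1 < real n0 * infdist x F" using ex_less_of_nat_mult by blast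
    have "\<eta> n x = 1" if "n \<ge> n0" for n
    proof -
      have "real n0 * infdist x F \<le> real n * infdist x F" using that by (intro mult_right_mono) (auto simp: infdist_nonneg)
      then show ?thesis using n0 by (simp add: \<eta>_def)
    qed
    then show ?thesis by (intro tendsto_eventually) (auto simp: eventually_sequentially)
  qed
  define h where "h n x = complex_of_real (\<eta> n x) * \<psi> (gn n x)" for n x
  have h1: "cmod (h n x) \<le> 1" for n x
    using mult_mono[of "\<eta> n x" 1 "cmod (\<psi> (gn n x))" 1] \<eta>01 \<psi>1 by (simp add: h_def norm_mult)
  have hc: "continuous_on cube (h n)" for n
    unfolding h_def using gn[of n] \<psi>c
    by (intro continuous_on_mult continuous_on_of_real \<eta>c continuous_on_compose2[OF \<psi>c] continuous_on_subset[OF gn]) auto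
  have h0: "h n x = 0" if "x \<in> cube" "x \<notin> box 0 One" for n x
    using that by (simp add: h_def \<eta>_def F_def)
  note orth = integral_continuous_orthogonal[OF g 0 hc h0 h1]
  have AEN: "AE x in \<T>. x \<notin> N"
  proof -
    have "AE x in lebesgue. x \<notin> N"
      using N by (intro AE_not_in) (simp add: negligible_iff_null_sets)
    then show ?thesis by (subst AE_restrict_space_iff) (auto elim!: eventually_mono)
  qed
  have lim2: "AE x in \<T>. (\<lambda>n. g x * h n x) \<longlonglongrightarrow> g x * \<psi> (g x)"
    using AEN frontier_cube_null AE_space
  proof eventually_elim
    case (elim x)
    then have "(\<lambda>n. gn n x) \<longlonglongrightarrow> g x" using lim[of x] by simp
    then have "(\<lambda>n. \<psi> (gn n x)) \<longlonglongrightarrow> \<psi> (g x)"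
      using \<psi>c by (intro continuous_on_tendsto_compose[OF \<psi>c]) auto
    then have "(\<lambda>n. g x * (complex_of_real (\<eta> n x) * \<psi> (gn n x))) \<longlonglongrightarrow> g x * (complex_of_real 1 * \<psi> (g x))"
      using elim by (intro tendsto_intros \<eta>lim)
    then show ?case by (simp add: h_def)
  qed
  have mlim: "(\<lambda>x. g x * \<psi> (g x)) \<in> borel_measurable \<T>"
    using g borel_measurable_continuous_onI[OF \<psi>c]
    by (intro borel_measurable_times measurable_compose[of g _ borel \<psi>]) auto
  have bd: "AE x in \<T>. cmod (g x * h n x) \<le> cmod (g x)" for n
    using h1 by (auto simp: norm_mult mult_left_le)
  have mn: "(\<lambda>x. g x * h n x) \<in> borel_measurable \<T>" for n
    using orth(1) by auto
  have I: "integrable \<T> (\<lambda>x. g x * \<psi> (g x))"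
    by (rule integrable_dominated_convergence[OF mlim mn _ lim2 bd]) (use g in auto)
  have "(\<lambda>n. LINT x|\<T>. g x * h n x) \<longlonglongrightarrow> (LINT x|\<T>. g x * \<psi> (g x))"
    by (rule integral_dominated_convergence[OF mlim mn _ lim2 bd]) (use g in auto)
  then have "(LINT x|\<T>. g x * \<psi> (g x)) = 0"
    by (simp add: orth(2) LIMSEQ_const_iff)
  then have z: "complex_of_real (LINT x|\<T>. (cmod (g x))\<^sup>2 / (1 + cmod (g x))) = 0"
    unfolding mult by (subst integral_complex_of_real[symmetric])
  have I2: "integrable \<T> (\<lambda>x. (cmod (g x))\<^sup>2 / (1 + cmod (g x)))"
    using I unfolding mult by (simp add: complex_of_real_integrable_eq del: of_real_divide of_real_power)
  have "AE x in \<T>. (cmod (g x))\<^sup>2 / (1 + cmod (g x)) = 0"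
    using z by (subst integral_nonneg_eq_0_iff_AE[OF I2, symmetric]) auto
  then show ?thesis
  proof eventually_elim
    case (elim x)
    have "1 + cmod (g x) \<noteq> 0" by (smt (verit) norm_ge_zero)
    then show ?case using elim by simp
  qed
qed

section \<open>Fourier series, products and convolutions\<close>

definition ts :: "(int^'d \<Rightarrow> complex) \<Rightarrow> real^'d \<Rightarrow> complex" where
  "ts c x = (\<Sum>\<^sub>\<infinity>k. c k * ek k x)"

abbreviation l1 :: "(int^'d \<Rightarrow> complex) \<Rightarrow> bool" where
  "l1 c \<equiv> (\<lambda>k. cmod (c k)) summable_on UNIV"

lemma uniform_limit_ts:
  assumes "l1 c"
  shows "uniform_limit UNIV (\<lambda>K x. \<Sum>k\<in>K. c k * ek k x) (ts c) (finite_subsets_at_top UNIV)"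
  unfolding ts_def
  by (rule Weierstrass_m_test_general[where M = "\<lambda>k. cmod (c k)"]) (use assms in \<open>auto simp: norm_mult\<close>)

lemma ts_has_sum:
  assumes "l1 c" shows "((\<lambda>k. c k * ek k x) has_sum ts c x) UNIV"
  unfolding ts_def by (rule has_sum_infsum, rule abs_summable_summable) (use assms in \<open>simp add: norm_mult\<close>)

lemma continuous_on_ts:
  assumes "l1 c" shows "continuous_on UNIV (ts c)"
  by (rule uniform_limit_theorem[OF _ uniform_limit_ts[OF assms]])
     (auto intro!: eventually_finite_subsets_at_top_weakI continuous_intros)

lemma borel_measurable_ts [measurable]: "l1 c \<Longrightarrow> ts c \<in> borel_measurable borel"
  by (rule borel_measurable_continuous_onI) (rule continuous_on_ts)

lemma borel_measurable_lebesgue_on_cube: "f \<in> borel_measurable borel \<Longrightarrow> f \<in> borel_measurable \<T>"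
  by (intro measurable_restrict_space1 measurable_completion) simp

lemma norm_ts_le:
  assumes "l1 c" shows "cmod (ts c x) \<le> (\<Sum>\<^sub>\<infinity>k. cmod (c k))"
  unfolding ts_def using norm_infsum_bound[of "\<lambda>k. c k * ek k x" UNIV] assms by (simp add: norm_mult)

lemma ts_tfrac: "ts c (tfrac x) = ts c x"
  by (simp add: ts_def ek_tfrac)

lemma ts_real:
  assumes "\<And>k. c (- k) = cnj (c k)"
  shows "Im (ts c x) = 0"
proof -
  have "bij (uminus :: int^'d \<Rightarrow> int^'d)" by (rule bij_uminus)
  then have "ts c x = (\<Sum>\<^sub>\<infinity>k. c (- k) * ek (- k) x)"
    unfolding ts_def by (subst infsum_reindex_bij_betw[of uminus UNIV UNIV, symmetric]) auto
  also have "\<dots> = cnj (ts c x)" by (simp add: ts_def assms ek_minus flip: infsum_cnj complex_cnj_mult)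
  finally show ?thesis by (simp add: complex_eq_iff)
qed

text \<open>Absolutely summable coefficients give uniform convergence, which permits termwise
  integration against any integrable function.\<close>

lemma integral_mult_ts:
  assumes g: "integrable \<T> g" and c: "l1 c"
  shows "integrable \<T> (\<lambda>x. g x * ts c x)"
    "((\<lambda>k. c k * (LINT x|\<T>. g x * ek k x)) has_sum (LINT x|\<T>. g x * ts c x)) UNIV"
proof -
  show 1: "integrable \<T> (\<lambda>x. g x * ts c x)"
    by (rule integrable_mult_bounded[OF g borel_measurable_lebesgue_on_cube[OF borel_measurable_ts[OF c]]])
       (use norm_ts_le[OF c] in auto)
  have gek: "integrable \<T> (\<lambda>x. g x * ek k x)" for k
    by (rule integrable_mult_bounded[OF g, where B = 1]) auto
  define N where "N = (LINT x|\<T>. cmod (g x))"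
  have N: "0 \<le> N" by (simp add: N_def)
  have sum: "(\<Sum>k\<in>K. c k * (LINT x|\<T>. g x * ek k x)) = (LINT x|\<T>. g x * (\<Sum>k\<in>K. c k * ek k x))" for K
  proof -
    have "(\<Sum>k\<in>K. c k * (LINT x|\<T>. g x * ek k x)) = (LINT x|\<T>. (\<Sum>k\<in>K. c k * (g x * ek k x)))"
      using gek by simp
    then show ?thesis by (simp add: sum_distrib_left mult.left_commute)
  qed
  have intK: "integrable \<T> (\<lambda>x. g x * (\<Sum>k\<in>K. c k * ek k x))" for K
    using gek by (simp add: sum_distrib_left mult.left_commute[of "g _"])
  show "((\<lambda>k. c k * (LINT x|\<T>. g x * ek k x)) has_sum (LINT x|\<T>. g x * ts c x)) UNIV"
    unfolding has_sum_def
  proof (rule tendstoI)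
    fix e :: real assume e: "e > 0"
    define e' where "e' = e / (N + 1)"
    have e': "e' > 0" "e' * N < e" using e N by (auto simp: e'_def field_simps)
    show "\<forall>\<^sub>F K in finite_subsets_at_top UNIV. dist (\<Sum>k\<in>K. c k * (LINT x|\<T>. g x * ek k x)) (LINT x|\<T>. g x * ts c x) < e"
      using uniform_limitD[OF uniform_limit_ts[OF c] e'(1)]
    proof eventually_elim
      case (elim K)
      have "dist (\<Sum>k\<in>K. c k * (LINT x|\<T>. g x * ek k x)) (LINT x|\<T>. g x * ts c x)
        = cmod (LINT x|\<T>. g x * (\<Sum>k\<in>K. c k * ek k x) - g x * ts c x)"
        using intK 1 by (simp add: sum dist_norm)
      also have "\<dots> \<le> (LINT x|\<T>. e' * cmod (g x))"
      proof (rule Bochner_Integration.integral_norm_bound_integral)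
        fix x
        have "cmod ((\<Sum>k\<in>K. c k * ek k x) - ts c x) \<le> e'" using elim by (auto simp: dist_norm less_imp_le)
        then show "cmod (g x * (\<Sum>k\<in>K. c k * ek k x) - g x * ts c x) \<le> e' * cmod (g x)"
          by (simp add: norm_mult mult_left_mono mult.commute[of e'] flip: right_diff_distrib)
      qed (use intK 1 g in auto)
      also have "\<dots> < e" using e' by (simp add: N_def)
      finally show ?case .
    qed
  qed
qed

lemma fc_eq: "fc g k = (LINT x|\<T>. complex_of_real (g x) * ek (- k) x)"
  by (simp add: fc_def ek_def kdot_minus)

lemma fc_uminus: "fc g (- k) = cnj (fc g k)"
proof -
  have "complex_of_real (g x) * ek (- (- k)) x = cnj (complex_of_real (g x) * ek (- k) x)" for x
    by (simp add: ek_minus)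
  then show ?thesis unfolding fc_eq by (simp only: Bochner_Integration.integral_cnj)
qed

lemma in_L2_imp_in_L1: "in_L2 g \<Longrightarrow> in_L1 g"
  unfolding in_L2_def in_L1_def
  by (rule finite_measure.square_integrable_imp_integrable[OF finite_measure_cube]) auto

lemma norm_fc_le:
  assumes "in_L1 g" shows "cmod (fc g k) \<le> (LINT x|\<T>. \<bar>g x\<bar>)"
proof -
  have "cmod (fc g k) \<le> (LINT x|\<T>. cmod (complex_of_real (g x) * ek (- k) x))"
    unfolding fc_eq by (rule integral_norm_bound)
  then show ?thesis by (simp add: norm_mult)
qed

lemma integrable_fc:
  "in_L1 g \<Longrightarrow> integrable \<T> (\<lambda>x. complex_of_real (g x) * ek k x)"
  by (rule integrable_mult_bounded[where B = 1]) (auto simp: in_L1_def)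

lemma fc_add: "in_L1 g \<Longrightarrow> in_L1 h \<Longrightarrow> fc (\<lambda>x. g x + h x) k = fc g k + fc h k"
  unfolding fc_eq by (simp add: distrib_right integrable_fc)

lemma integral_ek_mult: "(LINT x|\<T>. ek k x * ek l x) = (if k + l = 0 then 1 else 0)"
  by (simp add: integral_ek flip: ek_add)

text \<open>By orthogonality the series has the same coefficients as \<open>g\<close>, and
  uniqueness applies to the difference.\<close>

lemma fourier_inversion:
  assumes g: "in_L1 g" and c: "l1 (fc g)"
  shows "AE x in \<T>. complex_of_real (g x) = ts (fc g) x"
proof -
  have t1: "integrable \<T> (\<lambda>x. ts (fc g) x * ek k x)" for k
    using integral_mult_ts(1)[OF _ c, of "ek k"] integrable_mult_bounded[of "\<lambda>_. 1" "ek k" 1]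
    by (simp add: mult.commute)
  have t0: "integrable \<T> (\<lambda>x. ts (fc g) x)" using t1[of 0] by simp
  have "AE x in \<T>. complex_of_real (g x) - ts (fc g) x = 0"
  proof (rule fourier_uniqueness)
    show "integrable \<T> (\<lambda>x. complex_of_real (g x) - ts (fc g) x)"
      using g t0 by (auto simp: in_L1_def)
    fix k
    have "((\<lambda>l. fc g l * (LINT x|\<T>. ek k x * ek l x)) has_sum (LINT x|\<T>. ek k x * ts (fc g) x)) UNIV"
      by (rule integral_mult_ts(2)[OF _ c]) (use integrable_mult_bounded[of "\<lambda>_. 1" "ek k" 1] in simp)
    moreover have "((\<lambda>l. fc g l * (LINT x|\<T>. ek k x * ek l x)) has_sum fc g (- k)) UNIV"
    proof -
      have "((\<lambda>l. fc g l * (LINT x|\<T>. ek k x * ek l x)) has_sum fc g (- k)) {- k}"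
        by (rule has_sum_finiteI) (auto simp: integral_ek_mult)
      then show ?thesis
        by (rule has_sum_cong_neutral[THEN iffD1, rotated -1]) (auto simp: integral_ek_mult add_eq_0_iff)
    qed
    ultimately have "(LINT x|\<T>. ek k x * ts (fc g) x) = fc g (- k)" by (rule has_sum_unique)
    then show "(LINT x|\<T>. (complex_of_real (g x) - ts (fc g) x) * ek k x) = 0"
      using integrable_fc[OF g] t1 by (simp add: left_diff_distrib fc_eq mult.commute[of "ek _ _"])
  qed
  then show ?thesis by simp
qed

text \<open>Only \<open>h\<close> is expanded into its uniformly convergent series; \<open>g\<close>
  is merely integrable. The asymmetry suits the drift terms, each of which has one factor with
  summable coefficients.\<close>

lemma fc_product:
  assumes g: "in_L1 g" and h: "in_L1 h" and c: "l1 (fc h)"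
  shows "in_L1 (\<lambda>x. g x * h x)" "((\<lambda>l. fc g (k - l) * fc h l) has_sum fc (\<lambda>x. g x * h x) k) UNIV"
proof -
  note inv = fourier_inversion[OF h c]
  show gh: "in_L1 (\<lambda>x. g x * h x)"
    unfolding in_L1_def
  proof (rule integrable_mult_bounded)
    show "AE x in \<T>. norm (h x) \<le> (\<Sum>\<^sub>\<infinity>k. cmod (fc h k))"
      using inv
    proof eventually_elim
      case (elim x)
      then show ?case using norm_ts_le[OF c, of x] by (metis norm_of_real real_norm_def)
    qed
  qed (use g h in \<open>auto simp: in_L1_def\<close>)
  have "((\<lambda>l. fc h l * (LINT x|\<T>. (complex_of_real (g x) * ek (- k) x) * ek l x))
      has_sum (LINT x|\<T>. (complex_of_real (g x) * ek (- k) x) * ts (fc h) x)) UNIV"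
    by (rule integral_mult_ts(2)[OF integrable_fc[OF g] c])
  moreover have "(LINT x|\<T>. (complex_of_real (g x) * ek (- k) x) * ek l x) = fc g (k - l)" for l
    unfolding fc_eq mult.assoc ek_add[symmetric] by simp
  moreover have "(LINT x|\<T>. (complex_of_real (g x) * ek (- k) x) * ts (fc h) x) = fc (\<lambda>x. g x * h x) k"
    unfolding fc_eq[of "\<lambda>x. g x * h x"]
  proof (rule integral_cong_AE)
    show "(\<lambda>x. complex_of_real (g x) * ek (- k) x * ts (fc h) x) \<in> borel_measurable \<T>"
      using integral_mult_ts(1)[OF integrable_fc[OF g] c, of "- k"] by auto
    show "(\<lambda>x. complex_of_real (g x * h x) * ek (- k) x) \<in> borel_measurable \<T>"
      using integrable_fc[OF gh] by auto
    show "AE x in \<T>. complex_of_real (g x) * ek (- k) x * ts (fc h) x = complex_of_real (g x * h x) * ek (- k) x"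
      using inv by eventually_elim (simp add: mult.commute mult.left_commute)
  qed
  ultimately show "((\<lambda>l. fc g (k - l) * fc h l) has_sum fc (\<lambda>x. g x * h x) k) UNIV"
    by (simp add: mult.commute)
qed

lemma bessel:
  assumes g: "in_L2 g" and K: "finite K"
  shows "(\<Sum>k\<in>K. (cmod (fc g k))\<^sup>2) \<le> (LINT x|\<T>. (g x)\<^sup>2)"
proof -
  have g1: "in_L1 g" by (rule in_L2_imp_in_L1[OF g])
  define p where "p x = (\<Sum>k\<in>K. fc g k * ek k x)" for x
  define S where "S = (\<Sum>k\<in>K. (cmod (fc g k))\<^sup>2)"
  have i1: "integrable \<T> (\<lambda>x. complex_of_real (g x) * cnj (p x))"
    unfolding p_def using integrable_fc[OF g1]
    by (simp add: sum_distrib_left ek_minus[symmetric] mult.left_commute[of "complex_of_real _"])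
  have ekint: "integrable \<T> (ek k)" for k
    using integrable_mult_bounded[of "\<lambda>_. 1" "ek k" 1] by simp
  have pp: "p x * cnj (p x) = (\<Sum>k\<in>K. \<Sum>l\<in>K. (fc g k * cnj (fc g l)) * ek (k + - l) x)" for x
    by (simp add: p_def sum_product ek_add ek_minus mult.assoc mult.left_commute[of "ek _ _"] del: add_uminus_conv_diff)
  have i2: "integrable \<T> (\<lambda>x. p x * cnj (p x))"
    unfolding pp by (intro Bochner_Integration.integrable_sum integrable_mult_right ekint)
  have v1: "(LINT x|\<T>. complex_of_real (g x) * cnj (p x)) = complex_of_real S"
  proof -
    have "(LINT x|\<T>. complex_of_real (g x) * cnj (p x))
        = (LINT x|\<T>. (\<Sum>k\<in>K. cnj (fc g k) * (complex_of_real (g x) * ek (- k) x)))"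
      by (simp add: p_def sum_distrib_left ek_minus mult.left_commute)
    also have "\<dots> = (\<Sum>k\<in>K. cnj (fc g k) * fc g k)"
      using integrable_fc[OF g1] by (simp add: fc_eq)
    also have "\<dots> = complex_of_real S"
      by (simp add: S_def complex_mult_cnj cmod_power2 mult.commute[of "cnj _"])
    finally show ?thesis .
  qed
  have v2: "(LINT x|\<T>. p x * cnj (p x)) = complex_of_real S"
  proof -
    have "(LINT x|\<T>. p x * cnj (p x))
       = (LINT x|\<T>. (\<Sum>k\<in>K. \<Sum>l\<in>K. (fc g k * cnj (fc g l)) * ek (k + - l) x))"
      by (simp only: pp)
    also have "\<dots> = (\<Sum>k\<in>K. \<Sum>l\<in>K. (fc g k * cnj (fc g l)) * (if k = l then 1 else 0))"
      by (simp add: integral_ek ekint Bochner_Integration.integral_sum Bochner_Integration.integrable_sum integrable_mult_right)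
    also have "\<dots> = complex_of_real S"
      using K by (simp add: S_def complex_mult_cnj cmod_power2 if_distrib[of "\<lambda>a. _ * a"] cong: if_cong)
    finally show ?thesis .
  qed
  have i3: "integrable \<T> (\<lambda>x. (g x)\<^sup>2)" using g by (simp add: in_L2_def)
  have eq: "(cmod (complex_of_real (g x) - p x))\<^sup>2 = (g x)\<^sup>2 - 2 * Re (complex_of_real (g x) * cnj (p x)) + Re (p x * cnj (p x))" for x
    by (simp only: cmod_power2) (simp add: power2_eq_square algebra_simps)
  have "0 \<le> (LINT x|\<T>. (cmod (complex_of_real (g x) - p x))\<^sup>2)" by simp
  also have "\<dots> = (LINT x|\<T>. (g x)\<^sup>2) - 2 * (LINT x|\<T>. Re (complex_of_real (g x) * cnj (p x)))
       + (LINT x|\<T>. Re (p x * cnj (p x)))"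
    unfolding eq using i3 integrable_Re[OF i1] integrable_Re[OF i2]
    by (subst Bochner_Integration.integral_add; (subst Bochner_Integration.integral_diff)?) auto
  also have "\<dots> = (LINT x|\<T>. (g x)\<^sup>2) - 2 * S + S"
    using v1 v2 integral_Re[OF i1] integral_Re[OF i2] by simp
  finally show ?thesis by (simp add: S_def)
qed

text \<open>This is the zeroth coefficient of \<open>g * g\<close> in the product formula, since
  \<open>fc g (- l)\<close> is the conjugate of \<open>fc g l\<close> for real
  \<open>g\<close>.\<close>

lemma parseval:
  assumes g: "in_L1 g" and c: "l1 (fc g)"
  shows "in_L2 g" "((\<lambda>k. (cmod (fc g k))\<^sup>2) has_sum (LINT x|\<T>. (g x)\<^sup>2)) UNIV"
proof -
  note p = fc_product[OF g g c]
  have i: "integrable \<T> (\<lambda>x. (g x)\<^sup>2)" using p(1) by (simp add: in_L1_def power2_eq_square)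
  then show "in_L2 g" using g by (auto simp: in_L2_def in_L1_def)
  have "((\<lambda>l. fc g (0 - l) * fc g l) has_sum complex_of_real (LINT x|\<T>. (g x)\<^sup>2)) UNIV"
    using p(2)[of 0] by (simp add: fc_eq[of "\<lambda>x. g x * g x"] power2_eq_square flip: of_real_mult)
  moreover have "fc g (0 - l) * fc g l = complex_of_real ((cmod (fc g l))\<^sup>2)" for l
    by (simp add: fc_uminus complex_mult_cnj cmod_power2 mult.commute[of "cnj _"])
  ultimately show "((\<lambda>k. (cmod (fc g k))\<^sup>2) has_sum (LINT x|\<T>. (g x)\<^sup>2)) UNIV"
    by (simp add: has_sum_of_real_iff del: of_real_power)
qed


section \<open>Convolution on the torus and its Fourier coefficients\<close>

lemma ess_bdd_by_nonneg:
  assumes "ess_bdd_by (g :: real^'d \<Rightarrow> real) B" shows "0 \<le> B"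
proof (rule ccontr)
  assume "\<not> 0 \<le> B"
  then have "AE x in (\<T> :: (real^'d) measure). False"
    using assms unfolding ess_bdd_by_def by (auto elim!: eventually_mono)
  then have "ae_filter (\<T> :: (real^'d) measure) = bot"
    by (simp add: trivial_limit_def)
  then have "emeasure (\<T> :: (real^'d) measure) cube = 0"
    by (simp add: ae_filter_eq_bot_iff)
  then show False by (simp add: emeasure_restrict_space emeasure_cube)
qed

text \<open>Fubini requires joint measurability of \<open>g (tfrac (x - y))\<close>, which is
  immediate for Borel functions; convolutions are therefore computed with Borel
  representatives.\<close>

lemma borel_representative:
  fixes g :: "real^'d \<Rightarrow> real"
  assumes "g \<in> borel_measurable \<T>"
  obtains g' where "g' \<in> borel_measurable borel" "AE x in \<T>. g x = g' x"
proof -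
  have "(\<lambda>x. if x \<in> cube then g x else 0) \<in> borel_measurable (completion lborel)"
    using assms by (subst borel_measurable_if) auto
  then obtain g' where g': "g' \<in> borel_measurable lborel" "AE x in lborel. (if x \<in> cube then g x else 0) = g' x"
    using completion_ex_borel_measurable_real by blast
  have "AE x in \<T>. g x = g' x"
    unfolding AE_lebesgue_on_cube using g'(2) by eventually_elim auto
  then show ?thesis using g'(1) that by auto
qed

lemma ess_bdd_borel_representative:
  fixes g :: "real^'d \<Rightarrow> real"
  assumes "ess_bdd_by g B"
  obtains g' where "g' \<in> borel_measurable borel" "AE x in \<T>. g x = g' x" "\<And>x. \<bar>g' x\<bar> \<le> B"
proof -
  obtain g1 where g1: "g1 \<in> borel_measurable borel" "AE x in \<T>. g x = g1 x"
    using assms borel_representative unfolding ess_bdd_by_def by blast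
  \<comment> \<open>Truncation turns the almost everywhere bound into one at every point.\<close>
  define g' where "g' x = max (- B) (min B (g1 x))" for x
  have "AE x in \<T>. \<bar>g x\<bar> \<le> B" using assms by (simp add: ess_bdd_by_def)
  with g1(2) have "AE x in \<T>. g x = g' x"
    by eventually_elim (auto simp: g'_def)
  moreover have "g' \<in> borel_measurable borel" using g1(1) unfolding g'_def by measurable
  moreover have "\<bar>g' x\<bar> \<le> B" for x using ess_bdd_by_nonneg[OF assms] by (auto simp: g'_def)
  ultimately show ?thesis using that by blast
qed

lemma ess_bdd_in_L1: "ess_bdd_by g B \<Longrightarrow> in_L1 g"
  unfolding ess_bdd_by_def in_L1_def using integrable_mult_bounded[of "\<lambda>_. 1::real" g B] by simp

lemma tfrac_neg_tfrac: "tfrac (- tfrac (y - x)) = tfrac (x - y)"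
proof (subst vec_eq_iff, rule allI)
  fix i
  have "- frac (y $ i - x $ i) = (x $ i - y $ i) + real_of_int \<lfloor>y $ i - x $ i\<rfloor>"
    by (simp add: frac_def)
  then have "tfrac (- tfrac (y - x)) $ i = frac ((x $ i - y $ i) + real_of_int \<lfloor>y $ i - x $ i\<rfloor>)"
    by (simp add: tfrac_def)
  also have "\<dots> = frac (x $ i - y $ i)" unfolding frac_def floor_add_int[symmetric] by simp
  finally show "tfrac (- tfrac (y - x)) $ i = tfrac (x - y) $ i" by (simp add: tfrac_def)
qed

text \<open>A translation is a composition of two reflections of the kind already treated.\<close>

lemma integral_tfrac_left:
  fixes f :: "real^'d \<Rightarrow> 'b::{banach, second_countable_topology}"
  assumes [measurable]: "f \<in> borel_measurable borel"
  shows "(LINT x|\<T>. f (tfrac (x - y))) = (LINT x|\<T>. f x)"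
proof -
  have "(LINT x|\<T>. f (tfrac (x - y))) = (LINT x|\<T>. f (tfrac (- tfrac (y - x))))"
    by (simp add: tfrac_neg_tfrac)
  also have "\<dots> = (LINT x|\<T>. f (tfrac (- x)))"
    by (rule integral_tfrac(1)[of "\<lambda>x. f (tfrac (- x))"]) measurable
  also have "\<dots> = (LINT x|\<T>. f x)"
    using integral_tfrac(1)[of f 0] by simp
  finally show ?thesis .
qed

lemma borel_measurable_lebesgue_on_cong_AE:
  fixes f g :: "'a::euclidean_space \<Rightarrow> 'b::euclidean_space"
  assumes S: "S \<in> sets lebesgue" and f: "f \<in> borel_measurable (lebesgue_on S)"
    and ae: "AE x in lebesgue_on S. f x = g x"
  shows "g \<in> borel_measurable (lebesgue_on S)"
proof -
  have "(\<lambda>x. if x \<in> S then f x else 0) \<in> borel_measurable lebesgue"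
    using f S by (simp add: borel_measurable_if)
  moreover have "AE x in lebesgue. x \<in> S \<longrightarrow> f x = g x"
    using ae S by (subst (asm) AE_restrict_space_iff) auto
  then have "AE x in lebesgue. (if x \<in> S then f x else 0) = (if x \<in> S then g x else 0)"
    by eventually_elim auto
  ultimately have "(\<lambda>x. if x \<in> S then g x else 0) \<in> borel_measurable lebesgue"
    by (rule borel_measurable_AE)
  then show ?thesis using S by (simp add: borel_measurable_if)
qed

lemma tconv_cong_AE:
  assumes g: "AE z in \<T>. g z = g' z" and h: "AE z in \<T>. h z = h' z"
    and [measurable]: "g' \<in> borel_measurable borel" "h' \<in> borel_measurable borel" "h \<in> borel_measurable \<T>"
  shows "tconv g h x = tconv g' h' x"
proof -
  have ae: "AE y in \<T>. g (tfrac (x - y)) * h y = g' (tfrac (x - y)) * h' y"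
    using AE_tfrac[OF g, of x] h by eventually_elim simp
  have m2: "(\<lambda>y. g' (tfrac (x - y)) * h' y) \<in> borel_measurable \<T>"
    by (rule borel_measurable_lebesgue_on_cube) measurable
  have m1: "(\<lambda>y. g (tfrac (x - y)) * h y) \<in> borel_measurable \<T>"
    by (rule borel_measurable_lebesgue_on_cong_AE[OF _ m2]) (use ae in \<open>auto elim!: eventually_mono\<close>)
  show ?thesis unfolding tconv_def by (rule integral_cong_AE[OF m1 m2 ae])
qed

text \<open>For the coefficients, \<open>ek (- k) x\<close> splits into its values at
  \<open>x - y\<close> and \<open>y\<close>; after Fubini the inner integral over \<open>x\<close>
  is that of a translate over a full period. Boundedness of \<open>g\<close> makes the integrand
  jointly integrable and gives the pointwise bound.\<close>

lemma tconv_facts: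
  fixes g h :: "real^'d \<Rightarrow> real"
  assumes g: "ess_bdd_by g B" and h: "in_L1 h"
  shows "tconv g h \<in> borel_measurable borel"
    and "\<bar>tconv g h x\<bar> \<le> B * (LINT y|\<T>. \<bar>h y\<bar>)"
    and "fc (tconv g h) k = fc g k * fc h k"
proof -
  let ?lb = "restrict_space lborel cube :: (real^'d) measure"
  interpret lb: finite_measure ?lb
    by (intro finite_measureI) (simp add: emeasure_restrict_space emeasure_cube)
  interpret P: pair_sigma_finite ?lb ?lb ..
  obtain g' where g'm [measurable]: "g' \<in> borel_measurable borel" and gg: "AE x in \<T>. g x = g' x"
    and gB: "\<And>x. \<bar>g' x\<bar> \<le> B" using ess_bdd_borel_representative[OF g] by blast
  obtain h' where h'm [measurable]: "h' \<in> borel_measurable borel" and hh: "AE x in \<T>. h x = h' x"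
    using borel_representative h unfolding in_L1_def by blast
  have hm: "h \<in> borel_measurable \<T>" using h by (auto simp: in_L1_def)
  have [measurable]: "(\<lambda>x. x) \<in> borel_measurable ?lb" by (intro measurable_restrict_space1) simp
  have h'm2: "h' \<in> borel_measurable ?lb" by measurable
  have B0: "0 \<le> B" by (rule ess_bdd_by_nonneg[OF g])
  have T: "tconv g h = tconv g' h'"
    by (rule ext) (rule tconv_cong_AE[OF gg hh g'm h'm hm])
  have h'1: "integrable \<T> h'"
    using h hh borel_measurable_lebesgue_on_cube[OF h'm] unfolding in_L1_def
    by (subst integrable_cong_AE[of _ _ h]) (auto elim!: eventually_mono)
  have h'2: "integrable ?lb h'" using h'1 by (simp add: integral_lebesgue_on_cube_borel)
  have Nh: "(LINT y|\<T>. \<bar>h y\<bar>) = (LINT y|\<T>. \<bar>h' y\<bar>)"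
    using hh hm borel_measurable_lebesgue_on_cube[OF h'm] by (intro integral_cong_AE) (auto elim!: eventually_mono)
  have Tlb: "tconv g' h' x = (LINT y|?lb. g' (tfrac (x - y)) * h' y)" for x
    unfolding tconv_def by (rule integral_lebesgue_on_cube_borel(1)) measurable
  have int1: "integrable \<T> (\<lambda>y. g' (tfrac (x - y)) * h' y)" for x
  proof -
    have "integrable \<T> (\<lambda>y. h' y * g' (tfrac (x - y)))"
      by (rule integrable_mult_bounded[OF h'1]) (auto intro!: borel_measurable_lebesgue_on_cube gB)
    then show ?thesis by (simp add: mult.commute)
  qed
  have Tm: "tconv g' h' \<in> borel_measurable borel"
    unfolding Tlb[abs_def] by (rule lb.borel_measurable_lebesgue_integral) measurable
  then show "tconv g h \<in> borel_measurable borel" by (simp add: T)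
  show bd: "\<bar>tconv g h x\<bar> \<le> B * (LINT y|\<T>. \<bar>h y\<bar>)" for x
  proof -
    have "norm (LINT y|\<T>. g' (tfrac (x - y)) * h' y) \<le> (LINT y|\<T>. B * \<bar>h' y\<bar>)"
      by (rule Bochner_Integration.integral_norm_bound_integral[OF int1])
         (use h'1 gB in \<open>auto simp: abs_mult intro!: mult_right_mono\<close>)
    then show ?thesis unfolding T Nh by (simp add: tconv_def)
  qed
  define G where "G x y = complex_of_real (g' (tfrac (x - y)) * h' y) * ek (- k) x" for x y
  have Gm [measurable]: "(\<lambda>(x, y). G x y) \<in> borel_measurable (?lb \<Otimes>\<^sub>M ?lb)"
    unfolding G_def by measurable
  have Gint: "integrable (?lb \<Otimes>\<^sub>M ?lb) (\<lambda>(x, y). G x y)"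
  proof (rule P.Fubini_integrable[OF Gm])
    have mm: "(\<lambda>x. LINT y|?lb. cmod (G x y)) \<in> borel_measurable ?lb"
      by (rule lb.borel_measurable_lebesgue_integral) measurable
    show "integrable ?lb (\<lambda>x. LINT y|?lb. cmod (case (x, y) of (x, y) \<Rightarrow> G x y))"
    proof (rule lb.integrable_const_bound[where B = "LINT y|?lb. B * \<bar>h' y\<bar>"])
      show "AE x in ?lb. norm (LINT y|?lb. cmod (case (x, y) of (x, y) \<Rightarrow> G x y)) \<le> (LINT y|?lb. B * \<bar>h' y\<bar>)"
      proof (rule AE_I2)
        fix x
        have "norm (LINT y|?lb. cmod (G x y)) = (LINT y|?lb. cmod (G x y))" by simp
        also have "\<dots> \<le> (LINT y|?lb. B * \<bar>h' y\<bar>)"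
          by (rule integral_mono')
             (use h'2 gB B0 in \<open>auto simp: G_def norm_mult abs_mult intro!: mult_right_mono\<close>)
        finally show "norm (LINT y|?lb. cmod (case (x, y) of (x, y) \<Rightarrow> G x y)) \<le> (LINT y|?lb. B * \<bar>h' y\<bar>)" by simp
      qed
    qed (use mm in simp)
    show "AE x in ?lb. integrable ?lb (\<lambda>y. case (x, y) of (x, y) \<Rightarrow> G x y)"
    proof (rule AE_I2)
      fix x
      have "integrable ?lb (\<lambda>y. g' (tfrac (x - y)) * h' y)"
        using int1[of x] by (subst integral_lebesgue_on_cube_borel(2)[symmetric]) auto
      then show "integrable ?lb (\<lambda>y. case (x, y) of (x, y) \<Rightarrow> G x y)"
        unfolding G_def prod.case by (intro integrable_mult_left integrable_of_real)
    qed
  qed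
  have fcg: "fc g k = (LINT x|\<T>. complex_of_real (g' x) * ek (- k) x)"
    unfolding fc_eq using gg ess_bdd_in_L1[OF g] borel_measurable_lebesgue_on_cube[OF g'm]
    by (intro integral_cong_AE) (auto simp: in_L1_def elim!: eventually_mono)
  have fch: "fc h k = (LINT x|\<T>. complex_of_real (h' x) * ek (- k) x)"
    unfolding fc_eq using hh hm borel_measurable_lebesgue_on_cube[OF h'm]
    by (intro integral_cong_AE) (auto elim!: eventually_mono)
  have inner: "(LINT x|?lb. G x y) = complex_of_real (h' y) * ek (- k) y * fc g k" for y
  proof -
    define \<phi> where "\<phi> z = complex_of_real (g' z) * ek (- k) z" for z
    have [measurable]: "\<phi> \<in> borel_measurable borel" unfolding \<phi>_def by measurable
    have "G x y = complex_of_real (h' y) * ek (- k) y * \<phi> (tfrac (x - y))" for x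
    proof -
      have "ek (- k) x = ek (- k) (x - y) * ek (- k) y" by (simp flip: ek_add_right)
      then show ?thesis by (simp add: G_def \<phi>_def ek_tfrac)
    qed
    then have "(LINT x|?lb. G x y) = complex_of_real (h' y) * ek (- k) y * (LINT x|?lb. \<phi> (tfrac (x - y)))" by simp
    also have "(LINT x|?lb. \<phi> (tfrac (x - y))) = (LINT x|\<T>. \<phi> (tfrac (x - y)))"
      by (rule integral_lebesgue_on_cube_borel(1)[symmetric]) measurable
    also have "\<dots> = fc g k" unfolding fcg \<phi>_def[symmetric] by (rule integral_tfrac_left) measurable
    finally show ?thesis .
  qed
  have "fc (tconv g h) k = (LINT x|?lb. complex_of_real (tconv g' h' x) * ek (- k) x)"
    unfolding fc_eq T by (rule integral_lebesgue_on_cube_borel(1)) (use Tm in measurable)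
  also have "\<dots> = (LINT x|?lb. LINT y|?lb. G x y)"
    by (rule Bochner_Integration.integral_cong) (simp_all add: G_def Tlb flip: integral_complex_of_real)
  also have "\<dots> = (LINT y|?lb. LINT x|?lb. G x y)"
    using P.Fubini_integral[OF Gint] by simp
  also have "\<dots> = (LINT y|?lb. complex_of_real (h' y) * ek (- k) y) * fc g k"
    unfolding inner by simp
  also have "(LINT y|?lb. complex_of_real (h' y) * ek (- k) y) = fc h k"
    unfolding fch by (rule integral_lebesgue_on_cube_borel(1)[symmetric]) measurable
  finally show "fc (tconv g h) k = fc g k * fc h k" by (simp add: mult.commute)
qed

section \<open>Tools in the time variable\<close>

abbreviation \<I> :: "real \<Rightarrow> real measure" where
  "\<I> T \<equiv> lebesgue_on {0..T}"

lemma lebesgue_on_subset_integral: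
  fixes f :: "real \<Rightarrow> 'b::{banach, second_countable_topology}"
  assumes "A \<in> sets lebesgue" "B \<in> sets lebesgue" "A \<subseteq> B"
  shows "integral\<^sup>L (lebesgue_on A) f = (LINT x|lebesgue_on B. indicator A x *\<^sub>R f x)"
    and "integrable (lebesgue_on A) f \<longleftrightarrow> integrable (lebesgue_on B) (\<lambda>x. indicator A x *\<^sub>R f x)"
proof -
  have "indicator B x *\<^sub>R indicator A x *\<^sub>R f x = indicator A x *\<^sub>R f x" for x
    using assms(3) by (auto simp: indicator_def)
  moreover have "A \<inter> space lebesgue \<in> sets lebesgue" "B \<inter> space lebesgue \<in> sets lebesgue" using assms by auto
  ultimately show "integral\<^sup>L (lebesgue_on A) f = (LINT x|lebesgue_on B. indicator A x *\<^sub>R f x)"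
    "integrable (lebesgue_on A) f \<longleftrightarrow> integrable (lebesgue_on B) (\<lambda>x. indicator A x *\<^sub>R f x)"
    by (simp_all only: integral_restrict_space integrable_restrict_space)
qed

lemma integrable_lebesgue_on_subset:
  fixes f :: "real \<Rightarrow> 'b::{banach, second_countable_topology}"
  assumes "integrable (lebesgue_on B) f" "A \<in> sets lebesgue" "B \<in> sets lebesgue" "A \<subseteq> B"
  shows "integrable (lebesgue_on A) f"
proof -
  have "integrable (lebesgue_on B) (\<lambda>x. indicator A x *\<^sub>R f x)"
  proof (rule Bochner_Integration.integrable_bound[OF assms(1)])
    have "A \<in> sets (lebesgue_on B)" using assms by (auto simp: sets_restrict_space)
    then show "(\<lambda>x. indicator A x *\<^sub>R f x) \<in> borel_measurable (lebesgue_on B)"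
      using assms(1) by (intro borel_measurable_scaleR borel_measurable_indicator) auto
  qed (auto simp: indicator_def)
  then show ?thesis using lebesgue_on_subset_integral(2)[OF assms(2-4)] by blast
qed

lemma AE_lebesgue_on_subset:
  assumes "AE x in lebesgue_on B. P x" "A \<in> sets lebesgue" "B \<in> sets lebesgue" "A \<subseteq> B"
  shows "AE x in lebesgue_on A. P x"
proof -
  have "AE x in lebesgue. x \<in> B \<longrightarrow> P x" using assms by (subst (asm) AE_restrict_space_iff) auto
  then have "AE x in lebesgue. x \<in> A \<longrightarrow> P x" by eventually_elim (use assms in auto)
  then show ?thesis using assms by (subst AE_restrict_space_iff) auto
qed

lemma finite_measure_lebesgue_Icc [simp]: "finite_measure (lebesgue_on {a..b::real})"
  by (intro finite_measureI) (auto simp: emeasure_restrict_space emeasure_completion emeasure_lborel_Icc_eq)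

lemma continuous_on_indefinite_lebesgue:
  fixes f :: "real \<Rightarrow> 'b::euclidean_space"
  assumes "integrable (\<I> T) f"
  shows "continuous_on {0..T} (\<lambda>t. integral\<^sup>L (\<I> t) f)"
proof -
  have eq: "integral\<^sup>L (\<I> t) f = integral {0..t} f" if "t \<in> {0..T}" for t
    by (rule lebesgue_integral_eq_integral, rule integrable_lebesgue_on_subset[OF assms]) (use that in auto)
  have "continuous_on {0..T} (\<lambda>t. integral {0..t} f)"
    by (rule indefinite_integral_continuous_1) (rule integrable_on_lebesgue_on[OF assms], simp)
  then show ?thesis by (rule continuous_on_eq) (simp add: eq)
qed

text \<open>The squared modulus is the double integral of \<open>Re (f a * cnj (f b))\<close> over a
  square. The two triangles \<open>b \<le> a\<close> and \<open>a \<le> b\<close> contribute equally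
  by symmetry, and their common diagonal is null.\<close>

lemma cmod_indefinite_integral_sq_aux:
  fixes f :: "real \<Rightarrow> complex"
  assumes f: "integrable (\<I> t) f"
  shows "(cmod (LINT b|\<I> t. f b))\<^sup>2
    = 2 * (LINT a|\<I> t. Re (f a * cnj (LINT b|\<I> a. f b)))"
proof -
  let ?M = "\<I> t"
  interpret M: finite_measure ?M by simp
  interpret P: pair_sigma_finite ?M ?M ..
  define F where "F = (LINT b|?M. f b)"
  define H where "H a b = Re (f a * cnj (f b))" for a b
  have fm [measurable]: "f \<in> borel_measurable ?M" using f by auto
  have idm [measurable]: "(\<lambda>x. x) \<in> borel_measurable ?M"
    by (intro measurable_restrict_space1 measurable_completion) simp
  have [measurable]: "cnj \<in> borel_measurable borel"
    by (intro borel_measurable_continuous_onI continuous_intros)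
  have Hm [measurable]: "(\<lambda>(a, b). H a b) \<in> borel_measurable (?M \<Otimes>\<^sub>M ?M)" unfolding H_def by measurable
  have Hbd: "\<bar>H a b\<bar> \<le> cmod (f a) * cmod (f b)" for a b
    unfolding H_def by (rule order_trans[OF abs_Re_le_cmod]) (simp add: norm_mult)
  have Hb: "integrable ?M (\<lambda>b. H a b)" for a
    unfolding H_def by (intro integrable_Re integrable_mult_right) (use f in simp)
  have Hint: "integrable (?M \<Otimes>\<^sub>M ?M) (\<lambda>(a, b). H a b)"
  proof (rule P.Fubini_integrable[OF Hm])
    show "integrable ?M (\<lambda>a. LINT b|?M. norm (case (a, b) of (a, b) \<Rightarrow> H a b))"
    proof (rule Bochner_Integration.integrable_bound)
      show "integrable ?M (\<lambda>a. cmod (f a) * (LINT b|?M. cmod (f b)))" using f by simp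
      show "(\<lambda>a. LINT b|?M. norm (case (a, b) of (a, b) \<Rightarrow> H a b)) \<in> borel_measurable ?M"
        by (rule M.borel_measurable_lebesgue_integral) measurable
      have "(LINT b|?M. \<bar>H a b\<bar>) \<le> cmod (f a) * (LINT b|?M. cmod (f b))" for a
      proof -
        have "(LINT b|?M. \<bar>H a b\<bar>) \<le> (LINT b|?M. cmod (f a) * cmod (f b))"
          by (intro integral_mono integrable_abs Hb) (use f Hbd in auto)
        then show ?thesis by simp
      qed
      then show "AE a in ?M. norm (LINT b|?M. norm (case (a, b) of (a, b) \<Rightarrow> H a b)) \<le> norm (cmod (f a) * (LINT b|?M. cmod (f b)))"
        by auto
    qed
    show "AE a in ?M. integrable ?M (\<lambda>b. case (a, b) of (a, b) \<Rightarrow> H a b)" using Hb by simp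
  qed
  define L where "L a b = indicator {0..} (a - b) * H a b" for a b :: real
  define U where "U a b = indicator {0..} (b - a) * H a b" for a b :: real
  have Lm: "(\<lambda>(a, b). L a b) \<in> borel_measurable (?M \<Otimes>\<^sub>M ?M)" unfolding L_def by measurable
  have Um: "(\<lambda>(a, b). U a b) \<in> borel_measurable (?M \<Otimes>\<^sub>M ?M)" unfolding U_def by measurable
  have Lint: "integrable (?M \<Otimes>\<^sub>M ?M) (\<lambda>(a, b). L a b)"
    by (rule Bochner_Integration.integrable_bound[OF Hint Lm]) (auto simp: L_def indicator_def)
  have Uint: "integrable (?M \<Otimes>\<^sub>M ?M) (\<lambda>(a, b). U a b)"
    by (rule Bochner_Integration.integrable_bound[OF Hint Um]) (auto simp: U_def indicator_def)
  have UL: "U a b = L b a" for a b by (simp add: U_def L_def H_def mult.commute)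
  have Lb: "integrable ?M (\<lambda>b. L a b)" and Ub: "integrable ?M (\<lambda>b. U a b)" for a
  proof -
    show "integrable ?M (\<lambda>b. L a b)"
      by (rule Bochner_Integration.integrable_bound[OF Hb[of a]]) (auto simp: L_def indicator_def H_def)
    show "integrable ?M (\<lambda>b. U a b)"
      by (rule Bochner_Integration.integrable_bound[OF Hb[of a]]) (auto simp: U_def indicator_def H_def)
  qed
  have Lout: "integrable ?M (\<lambda>a. LINT b|?M. L a b)" and Uout: "integrable ?M (\<lambda>a. LINT b|?M. U a b)"
    using P.integrable_fst'[OF Lint] P.integrable_fst'[OF Uint] by auto
  have "(LINT a|?M. LINT b|?M. U a b) = (LINT b|?M. LINT a|?M. U a b)"
    using P.Fubini_integral[OF Uint] by simp
  also have "\<dots> = (LINT a|?M. LINT b|?M. L a b)" by (simp add: UL)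
  finally have U_eq: "(LINT a|?M. LINT b|?M. U a b) = (LINT a|?M. LINT b|?M. L a b)" .
  have sum: "(LINT b|?M. L a b) + (LINT b|?M. U a b) = Re (f a * cnj F)" for a
  proof -
    have "(LINT b|?M. L a b) + (LINT b|?M. U a b) = (LINT b|?M. L a b + U a b)" using Lb Ub by simp
    also have "\<dots> = (LINT b|?M. H a b)"
    proof (rule integral_cong_AE)
      have "AE b in lebesgue. b \<noteq> a"
        by (rule AE_not_in[of "{a}", simplified]) (auto simp: null_sets_completionI)
      then have "AE b in ?M. b \<noteq> a" by (subst AE_restrict_space_iff) auto
      then show "AE b in ?M. L a b + U a b = H a b"
        by eventually_elim (auto simp: L_def U_def indicator_def)
    qed (use Lb[of a] Ub[of a] Hb[of a] in auto)
    also have "\<dots> = Re (LINT b|?M. f a * cnj (f b))" unfolding H_def by (intro integral_Re) (use f in simp)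
    also have "\<dots> = Re (f a * cnj F)" using f by (simp add: F_def)
    finally show ?thesis .
  qed
  have inner: "(LINT b|?M. L a b) = Re (f a * cnj (LINT b|\<I> a. f b))" if "a \<in> {0..t}" for a
  proof -
    have fa: "integrable (\<I> a) f" by (rule integrable_lebesgue_on_subset[OF f]) (use that in auto)
    have "(LINT b|?M. L a b) = (LINT b|?M. indicator {0..a} b *\<^sub>R H a b)"
      by (rule Bochner_Integration.integral_cong) (auto simp: L_def indicator_def)
    also have "\<dots> = (LINT b|\<I> a. H a b)"
      by (rule lebesgue_on_subset_integral(1)[symmetric]) (use that in auto)
    also have "\<dots> = Re (LINT b|\<I> a. f a * cnj (f b))" unfolding H_def by (intro integral_Re) (use fa in simp)
    finally show ?thesis using fa by simp
  qed
  have fF: "integrable ?M (\<lambda>a. f a * cnj F)" using f by simp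
  have "(cmod F)\<^sup>2 = Re (F * cnj F)" by (simp add: complex_mult_cnj cmod_power2)
  also have "\<dots> = Re (LINT a|?M. f a * cnj F)" using f by (simp add: F_def)
  also have "\<dots> = (LINT a|?M. (LINT b|?M. L a b) + (LINT b|?M. U a b))" unfolding sum by (rule integral_Re[OF fF, symmetric])
  also have "\<dots> = 2 * (LINT a|?M. LINT b|?M. L a b)" using Lout Uout U_eq by simp
  also have "(LINT a|?M. LINT b|?M. L a b) = (LINT a|?M. Re (f a * cnj (LINT b|\<I> a. f b)))"
    by (rule Bochner_Integration.integral_cong) (simp_all add: inner)
  finally show ?thesis by (simp add: F_def)
qed

text \<open>Integrated form of the rule that the derivative of \<open>(cmod (a t))\<^sup>2\<close>
  is \<open>2 * Re (f t * cnj (a t))\<close>. It is valid at every \<open>t\<close> although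
  \<open>f\<close> is only integrable.\<close>

lemma cmod_indefinite_integral_sq:
  fixes f :: "real \<Rightarrow> complex"
  assumes f: "integrable (\<I> T) f" and t: "t \<in> {0..T}"
    and a: "\<And>t. t \<in> {0..T} \<Longrightarrow> a t = c + (LINT b|\<I> t. f b)"
  shows "integrable (\<I> T) (\<lambda>\<tau>. Re (f \<tau> * cnj (a \<tau>)))"
    and "(cmod (a t))\<^sup>2 = (cmod c)\<^sup>2 + 2 * (LINT \<tau>|\<I> t. Re (f \<tau> * cnj (a \<tau>)))"
proof -
  define G where "G t = (LINT b|\<I> t. f b)" for t
  have Gc: "continuous_on {0..T} G" unfolding G_def by (rule continuous_on_indefinite_lebesgue[OF f])
  have fG: "integrable (\<I> T) (\<lambda>\<tau>. f \<tau> * cnj (G \<tau>))"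
  proof -
    have "bounded (G ` {0..T})" by (intro compact_imp_bounded compact_continuous_image Gc) simp
    then obtain B where B: "\<And>\<tau>. \<tau> \<in> {0..T} \<Longrightarrow> cmod (G \<tau>) \<le> B"
      unfolding bounded_iff by blast
    show ?thesis
    proof (rule Bochner_Integration.integrable_bound)
      show "integrable (\<I> T) (\<lambda>\<tau>. complex_of_real B * f \<tau>)" using f by simp
      have "(\<lambda>\<tau>. cnj (G \<tau>)) \<in> borel_measurable (\<I> T)"
        by (intro continuous_imp_measurable_on_sets_lebesgue continuous_intros Gc) simp
      then show "(\<lambda>\<tau>. f \<tau> * cnj (G \<tau>)) \<in> borel_measurable (\<I> T)" using f by auto
      show "AE \<tau> in \<I> T. cmod (f \<tau> * cnj (G \<tau>)) \<le> cmod (complex_of_real B * f \<tau>)"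
      proof (rule AE_I2)
        fix \<tau> assume "\<tau> \<in> space (\<I> T)"
        then have "cmod (G \<tau>) \<le> \<bar>B\<bar>" using B[of \<tau>] by auto
        then show "cmod (f \<tau> * cnj (G \<tau>)) \<le> cmod (complex_of_real B * f \<tau>)"
          by (simp add: norm_mult mult_left_mono mult.commute[of "\<bar>B\<bar>"])
      qed
    qed
  qed
  have eq: "Re (f \<tau> * cnj (a \<tau>)) = Re (f \<tau> * cnj c) + Re (f \<tau> * cnj (G \<tau>))" if "\<tau> \<in> {0..T}" for \<tau>
    by (simp add: a[OF that] G_def algebra_simps)
  have i: "integrable (\<I> T) (\<lambda>\<tau>. Re (f \<tau> * cnj c) + Re (f \<tau> * cnj (G \<tau>)))"
    by (intro Bochner_Integration.integrable_add integrable_Re fG) (use f in simp)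
  show "integrable (\<I> T) (\<lambda>\<tau>. Re (f \<tau> * cnj (a \<tau>)))"
    by (rule iffD2[OF Bochner_Integration.integrable_cong i]) (auto simp del: complex_cnj_mult times_complex.sel intro!: eq)
  have ft: "integrable (\<I> t) f" by (rule integrable_lebesgue_on_subset[OF f]) (use t in auto)
  have fGt: "integrable (\<I> t) (\<lambda>\<tau>. f \<tau> * cnj (G \<tau>))"
    by (rule integrable_lebesgue_on_subset[OF fG]) (use t in auto)
  have "(LINT \<tau>|\<I> t. Re (f \<tau> * cnj (a \<tau>)))
     = (LINT \<tau>|\<I> t. Re (f \<tau> * cnj c) + Re (f \<tau> * cnj (G \<tau>)))"
    by (rule Bochner_Integration.integral_cong[OF refl eq]) (use t in auto)
  also have "\<dots> = (LINT \<tau>|\<I> t. Re (f \<tau> * cnj c)) + (LINT \<tau>|\<I> t. Re (f \<tau> * cnj (G \<tau>)))"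
    by (intro Bochner_Integration.integral_add integrable_Re fGt) (use ft in simp)
  also have "(LINT \<tau>|\<I> t. Re (f \<tau> * cnj c)) = Re (G t * cnj c)"
    using ft by (subst integral_Re) (auto simp: G_def)
  also have "2 * (Re (G t * cnj c) + (LINT \<tau>|\<I> t. Re (f \<tau> * cnj (G \<tau>)))) = 2 * Re (G t * cnj c) + (cmod (G t))\<^sup>2"
    using cmod_indefinite_integral_sq_aux[OF ft] by (simp add: G_def)
  also have "\<dots> = (cmod (a t))\<^sup>2 - (cmod c)\<^sup>2"
    unfolding a[OF t] G_def[symmetric] cmod_power2 by (simp add: power2_eq_square algebra_simps)
  finally show "(cmod (a t))\<^sup>2 = (cmod c)\<^sup>2 + 2 * (LINT \<tau>|\<I> t. Re (f \<tau> * cnj (a \<tau>)))" by simp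
qed

text \<open>Since \<open>y\<close> is only integrable, the inequality is iterated once:
  \<open>y \<le> G \<le> K\<close> with \<open>G\<close> continuous and \<open>K\<close>
  differentiable with derivative \<open>c * G \<le> c * K\<close>. Hence
  \<open>K t * exp (- c * t)\<close> does not increase.\<close>

lemma gronwall_integral:
  fixes y :: "real \<Rightarrow> real"
  assumes y: "integrable (\<I> T) y" and c: "0 \<le> c"
    and le: "\<And>t. t \<in> {0..T} \<Longrightarrow> y t \<le> A + c * (LINT \<tau>|\<I> t. y \<tau>)"
    and t: "t \<in> {0..T}"
  shows "y t \<le> A * exp (c * t)"
proof -
  define G where "G t = A + c * integral\<^sup>L (\<I> t) y" for t
  have Gc: "continuous_on {0..T} G"
    unfolding G_def by (intro continuous_intros continuous_on_indefinite_lebesgue y)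
  define K where "K t = A + c * integral {0..t} G" for t
  have eq: "integral\<^sup>L (\<I> t) y = integral {0..t} y" and yi: "y integrable_on {0..t}" if "t \<in> {0..T}" for t
  proof -
    have *: "integrable (\<I> t) y" by (rule integrable_lebesgue_on_subset[OF y]) (use that in auto)
    show "integral\<^sup>L (\<I> t) y = integral {0..t} y"
      by (rule lebesgue_integral_eq_integral[OF *]) simp
    show "y integrable_on {0..t}" by (rule integrable_on_lebesgue_on[OF *]) simp
  qed
  have GK: "G t \<le> K t" if "t \<in> {0..T}" for t
  proof -
    have "integral {0..t} y \<le> integral {0..t} G"
      using that le by (intro integral_le yi integrable_continuous_real continuous_on_subset[OF Gc]) (auto simp: G_def)
    then show ?thesis using c that by (simp add: G_def K_def eq mult_left_mono)
  qed
  have Kd: "(K has_real_derivative c * G x) (at x within {0..T})" if "x \<in> {0..T}" for x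
    unfolding K_def using integral_has_real_derivative[OF Gc that]
    by (auto intro!: derivative_eq_intros)
  define \<phi> where "\<phi> x = K x * exp (- c * x)" for x
  have \<phi>d: "(\<phi> has_real_derivative (c * G x - c * K x) * exp (- c * x)) (at x within {0..T})" if "x \<in> {0..T}" for x
    unfolding \<phi>_def using Kd[OF that] by (auto intro!: derivative_eq_intros simp: algebra_simps)
  have "\<phi> t \<le> \<phi> 0"
  proof (rule DERIV_nonpos_imp_decreasing_open[where f = \<phi> and a = 0 and b = t])
    show "0 \<le> t" using t by simp
    show "\<exists>y. DERIV \<phi> x :> y \<and> y \<le> 0" if "0 < x" "x < t" for x
    proof -
      have x: "x \<in> {0..T}" "x \<in> interior {0..T}" using that t by auto
      have "c * G x - c * K x \<le> 0" using GK[OF x(1)] c by (simp add: mult_left_mono)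
      then have "(c * G x - c * K x) * exp (- c * x) \<le> 0" by (simp add: mult_le_0_iff)
      moreover have "DERIV \<phi> x :> (c * G x - c * K x) * exp (- c * x)"
        using \<phi>d[OF x(1)] unfolding at_within_interior[OF x(2)] .
      ultimately show ?thesis by blast
    qed
    have "continuous_on {0..T} \<phi>" by (rule DERIV_continuous_on) (rule \<phi>d)
    then show "continuous_on {0..t} \<phi>" using t by (auto intro: continuous_on_subset)
  qed
  then have "K t * exp (- c * t) \<le> A" by (simp add: \<phi>_def K_def)
  then have "K t * exp (- c * t) * exp (c * t) \<le> A * exp (c * t)" by (intro mult_right_mono) auto
  then have "K t \<le> A * exp (c * t)" by (simp add: mult.assoc flip: exp_add)
  moreover have "y t \<le> G t" using le[OF t] by (simp add: G_def)
  ultimately show ?thesis using GK[OF t] by simp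
qed

text \<open>A sequence of finite sets that eventually contains every given finite set. It replaces
  the net behind \<open>infsum\<close> where measurability and dominated convergence call for
  sequences.\<close>

definition enum_set :: "nat \<Rightarrow> 'a::countable set" where
  "enum_set n = from_nat ` {..<n}"

lemma filterlim_enum_set: "filterlim enum_set (finite_subsets_at_top (UNIV :: 'a::countable set)) sequentially"
  unfolding filterlim_def le_filter_def eventually_filtermap
proof (intro allI impI)
  fix P assume "eventually P (finite_subsets_at_top (UNIV :: 'a set))"
  then obtain X where X: "finite X" "\<And>Y. finite Y \<Longrightarrow> X \<subseteq> Y \<Longrightarrow> P Y"
    unfolding eventually_finite_subsets_at_top by auto
  obtain N where N: "\<And>x. x \<in> X \<Longrightarrow> to_nat x < N"
    using finite_nat_set_iff_bounded[of "to_nat ` X"] X(1) by auto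
  show "eventually (\<lambda>n. P (enum_set n)) sequentially"
  proof (rule eventually_sequentiallyI[of N])
    fix n assume "n \<ge> N"
    show "P (enum_set n)"
    proof (rule X(2))
      show "X \<subseteq> enum_set n"
      proof
        fix x assume "x \<in> X"
        then have "to_nat x \<in> {..<n}" using N[of x] \<open>n \<ge> N\<close> by simp
        then show "x \<in> enum_set n" unfolding enum_set_def by (rule image_eqI[rotated]) simp
      qed
    qed (simp add: enum_set_def)
  qed
qed

lemma sum_enum_set_tendsto:
  "(f has_sum S) UNIV \<Longrightarrow> (\<lambda>n. sum f (enum_set n)) \<longlonglongrightarrow> S"
  unfolding has_sum_def by (rule filterlim_compose[OF _ filterlim_enum_set])

text \<open>The supremum of the partial sums is measurable in \<open>ennreal\<close>. Where the
  series diverges, \<open>infsum\<close> is 0 by convention, and so is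
  \<open>enn2real \<infinity>\<close>; the two functions thus agree everywhere and no summability is
  assumed.\<close>

lemma borel_measurable_infsum:
  fixes f :: "'k::countable \<Rightarrow> 'a \<Rightarrow> real"
  assumes m [measurable]: "\<And>k. f k \<in> borel_measurable M" and nn: "\<And>k x. 0 \<le> f k x"
  shows "(\<lambda>x. \<Sum>\<^sub>\<infinity>k. f k x) \<in> borel_measurable M"
proof -
  define S where "S x = (SUP n. ennreal (\<Sum>k\<in>enum_set n. f k x))" for x
  have "S \<in> borel_measurable M" unfolding S_def by measurable
  moreover have "(\<Sum>\<^sub>\<infinity>k. f k x) = enn2real (S x)" for x
  proof (cases "(\<lambda>k. f k x) summable_on UNIV")
    case True
    then have hs: "((\<lambda>k. f k x) has_sum (\<Sum>\<^sub>\<infinity>k. f k x)) UNIV" by simp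
    have mono: "incseq (\<lambda>n. ennreal (\<Sum>k\<in>enum_set n. f k x))"
      by (intro incseq_SucI ennreal_leI sum_mono2) (auto simp: enum_set_def nn)
    have "(\<lambda>n. ennreal (\<Sum>k\<in>enum_set n. f k x)) \<longlonglongrightarrow> ennreal (\<Sum>\<^sub>\<infinity>k. f k x)"
      by (intro tendsto_ennrealI sum_enum_set_tendsto hs)
    with LIMSEQ_SUP[OF mono] have "S x = ennreal (\<Sum>\<^sub>\<infinity>k. f k x)"
      unfolding S_def by (rule LIMSEQ_unique)
    then show ?thesis using nn by (simp add: infsum_nonneg)
  next
    case False
    have "S x = \<infinity>"
    proof (rule ccontr)
      assume "S x \<noteq> \<infinity>"
      then obtain r where r: "S x = ennreal r" "r \<ge> 0" by (cases "S x") auto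
      have "(\<lambda>k. f k x) summable_on UNIV"
      proof (rule summable_infsum_le_of_finite_sums(1)[OF nn])
        fix K :: "'k set" assume K: "finite K"
        have "eventually (\<lambda>Y. finite Y \<and> K \<subseteq> Y) (finite_subsets_at_top UNIV)"
          using K by (auto simp: eventually_finite_subsets_at_top)
        then have "eventually (\<lambda>n. finite (enum_set n :: 'k set) \<and> K \<subseteq> enum_set n) sequentially"
          using filterlim_enum_set unfolding filterlim_iff by blast
        then obtain n where n: "finite (enum_set n :: 'k set)" "K \<subseteq> enum_set n"
          by (auto simp: eventually_sequentially)
        have "ennreal (\<Sum>k\<in>enum_set n. f k x) \<le> ennreal r"
          unfolding r(1)[symmetric] S_def by (rule SUP_upper) simp
        then have "(\<Sum>k\<in>enum_set n. f k x) \<le> r" using r(2) by simp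
        moreover have "(\<Sum>k\<in>K. f k x) \<le> (\<Sum>k\<in>enum_set n. f k x)" by (rule sum_mono2[OF n]) (simp add: nn)
        ultimately show "(\<Sum>k\<in>K. f k x) \<le> r" by simp
      qed
      then show False using False by simp
    qed
    then show ?thesis using False by (simp add: infsum_not_exists)
  qed
  ultimately show ?thesis by simp
qed

text \<open>Dominated convergence along \<open>enum_set\<close> with the full sum as majorant. It
  turns bounds uniform in the set of modes into bounds for time integrals of Sobolev norms.\<close>

lemma integral_infsum_le:
  fixes f :: "'k::countable \<Rightarrow> 'a \<Rightarrow> real"
  assumes i: "\<And>k. integrable M (f k)" and nn: "\<And>k x. 0 \<le> f k x"
    and s: "AE x in M. (\<lambda>k. f k x) summable_on UNIV" and I: "integrable M (\<lambda>x. \<Sum>\<^sub>\<infinity>k. f k x)"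
    and le: "\<And>K. finite K \<Longrightarrow> (LINT x|M. (\<Sum>k\<in>K. f k x)) \<le> R"
  shows "(LINT x|M. (\<Sum>\<^sub>\<infinity>k. f k x)) \<le> R"
proof -
  have "(\<lambda>n. LINT x|M. (\<Sum>k\<in>enum_set n. f k x)) \<longlonglongrightarrow> (LINT x|M. (\<Sum>\<^sub>\<infinity>k. f k x))"
  proof (rule integral_dominated_convergence[where w = "\<lambda>x. \<Sum>\<^sub>\<infinity>k. f k x"])
    show "AE x in M. (\<lambda>n. \<Sum>k\<in>enum_set n. f k x) \<longlonglongrightarrow> (\<Sum>\<^sub>\<infinity>k. f k x)"
      using s by eventually_elim (rule sum_enum_set_tendsto, simp)
    show "AE x in M. norm (\<Sum>k\<in>enum_set n. f k x) \<le> (\<Sum>\<^sub>\<infinity>k. f k x)" for n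
      using s
    proof eventually_elim
      case (elim x)
      have "(\<Sum>k\<in>enum_set n. f k x) \<le> (\<Sum>\<^sub>\<infinity>k. f k x)"
        by (rule finite_sum_le_infsum[OF elim]) (auto simp: enum_set_def nn)
      then show ?case by (simp add: sum_nonneg nn)
    qed
  qed (use i I in auto)
  then show ?thesis by (rule LIMSEQ_le_const2) (auto intro!: le simp: enum_set_def)
qed

section \<open>Energy estimate for Fourier modes\<close>

definition Hsq :: "real \<Rightarrow> (int^'d \<Rightarrow> complex) \<Rightarrow> real" where
  "Hsq s c = (\<Sum>\<^sub>\<infinity>k. hm s c k)"

abbreviation inH :: "real \<Rightarrow> (int^'d \<Rightarrow> complex) \<Rightarrow> bool" where
  "inH s c \<equiv> (\<lambda>k. hm s c k) summable_on UNIV"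

lemma Hsq_nonneg [simp]: "0 \<le> Hsq s c"
  unfolding Hsq_def by (rule infsum_nonneg) simp

lemma sum_le_Hsq: "inH s c \<Longrightarrow> finite K \<Longrightarrow> (\<Sum>k\<in>K. hm s c k) \<le> Hsq s c"
  unfolding Hsq_def by (rule finite_sum_le_infsum) auto

lemma inH_mono: "inH s c \<Longrightarrow> r \<le> s \<Longrightarrow> inH r c"
  by (rule summable_on_comparison_test[of "\<lambda>k. hm s c k"]) (auto intro!: mult_right_mono hw_mono)

lemma Hsq_mono:
  assumes "inH s c" "r \<le> s" shows "Hsq r c \<le> Hsq s c"
  unfolding Hsq_def
  by (rule infsum_mono[OF inH_mono[OF assms] assms(1)]) (auto intro!: mult_right_mono hw_mono assms(2))

lemma inH_weight: "inH s c \<Longrightarrow> hm s c k \<le> Hsq s c"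
  using sum_le_Hsq[of s c "{k}"] by simp

lemma divergence_bound:
  fixes Fi :: "'d::finite \<Rightarrow> complex"
  shows "(cmod (\<Sum>i\<in>UNIV. \<i> * complex_of_real (2 * pi * real_of_int (k $ i)) * Fi i))\<^sup>2
    \<le> 4 * pi\<^sup>2 * ksq k * (\<Sum>i\<in>UNIV. (cmod (Fi i))\<^sup>2)"
proof -
  define S where "S = (\<Sum>i\<in>UNIV. \<i> * complex_of_real (2 * pi * real_of_int (k $ i)) * Fi i)"
  have "cmod S \<le> (\<Sum>i\<in>UNIV. (2 * pi * \<bar>real_of_int (k $ i)\<bar>) * cmod (Fi i))"
    unfolding S_def by (rule order_trans[OF norm_sum]) (simp add: norm_mult abs_mult)
  then have "(cmod S)\<^sup>2 \<le> (\<Sum>i\<in>UNIV. (2 * pi * \<bar>real_of_int (k $ i)\<bar>) * cmod (Fi i))\<^sup>2"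
    by (intro power_mono) auto
  also have "\<dots> \<le> (\<Sum>i\<in>UNIV. (2 * pi * \<bar>real_of_int (k $ i)\<bar>)\<^sup>2) * (\<Sum>i\<in>UNIV. (cmod (Fi i))\<^sup>2)"
    by (rule Cauchy_Schwarz_ineq_sum)
  also have "(\<Sum>i\<in>UNIV. (2 * pi * \<bar>real_of_int (k $ i)\<bar>)\<^sup>2) = 4 * pi\<^sup>2 * ksq k"
    by (simp add: ksq_def power_mult_distrib sum_distrib_left)
  finally show ?thesis by (simp add: S_def)
qed

text \<open>Young's inequality absorbs the drift and the source into the dissipation
  \<open>- 4 pi\<^sup>2 |k|\<^sup>2 |a|\<^sup>2\<close> of the mode.\<close>

lemma energy_mode:
  fixes a g h :: complex and Fi :: "'d::finite \<Rightarrow> complex"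
  assumes g: "g = - complex_of_real (4 * pi\<^sup>2 * ksq k) * a
      + (\<Sum>i\<in>UNIV. \<i> * complex_of_real (2 * pi * real_of_int (k $ i)) * Fi i) + h"
  shows "2 * Re (g * cnj a) \<le> - 2 * ((1 + ksq k) * (cmod a)\<^sup>2) + 3 * (cmod a)\<^sup>2
    + (\<Sum>i\<in>UNIV. (cmod (Fi i))\<^sup>2) + (cmod h)\<^sup>2 / (1 + ksq k)"
proof -
  define S where "S = (\<Sum>i\<in>UNIV. \<i> * complex_of_real (2 * pi * real_of_int (k $ i)) * Fi i)"
  define n where "n = ksq k"
  define A where "A = cmod a"
  have n: "0 \<le> n" by (simp add: n_def)
  have pi2: "9 \<le> pi\<^sup>2" using pi_gt3 power_mono[of 3 pi 2] by simp
  have Ssq: "(cmod S)\<^sup>2 \<le> 4 * pi\<^sup>2 * n * (\<Sum>i\<in>UNIV. (cmod (Fi i))\<^sup>2)"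
    unfolding S_def n_def by (rule divergence_bound)
  have R1: "Re (S * cnj a) \<le> cmod S * A" using complex_Re_le_cmod[of "S * cnj a"] by (simp add: norm_mult A_def)
  have R2: "Re (h * cnj a) \<le> cmod h * A" using complex_Re_le_cmod[of "h * cnj a"] by (simp add: norm_mult A_def)
  have Y1: "2 * (cmod S * A) \<le> 4 * pi\<^sup>2 * n * A\<^sup>2 + (\<Sum>i\<in>UNIV. (cmod (Fi i))\<^sup>2)"
  proof -
    define f where "f = sqrt (\<Sum>i\<in>UNIV. (cmod (Fi i))\<^sup>2)"
    define q where "q = 2 * pi * sqrt n"
    have f0: "0 \<le> f" and f2: "f\<^sup>2 = (\<Sum>i\<in>UNIV. (cmod (Fi i))\<^sup>2)" by (auto simp: f_def sum_nonneg)
    have q0: "0 \<le> q" and q2: "q\<^sup>2 = 4 * pi\<^sup>2 * n" using n by (auto simp: q_def power_mult_distrib)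
    have "(cmod S)\<^sup>2 \<le> (q * f)\<^sup>2" using Ssq by (simp add: power_mult_distrib q2 f2)
    then have "cmod S \<le> q * f" by (rule power2_le_imp_le) (use q0 f0 in simp)
    then have "2 * (cmod S * A) \<le> 2 * (q * f * A)" by (simp add: A_def mult_right_mono)
    also have "\<dots> \<le> (q * A)\<^sup>2 + f\<^sup>2" using sum_squares_bound[of "q * A" f] by (simp add: algebra_simps)
    finally show ?thesis by (simp add: power_mult_distrib q2 f2)
  qed
  have Y2: "2 * (cmod h * A) \<le> (1 + n) * A\<^sup>2 + (cmod h)\<^sup>2 / (1 + n)"
  proof -
    define r where "r = sqrt (1 + n)"
    have r: "r > 0" "r\<^sup>2 = 1 + n" using n by (auto simp: r_def)
    have "2 * (cmod h * A) = 2 * (r * A) * (cmod h / r)" using r by simp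
    also have "\<dots> \<le> (r * A)\<^sup>2 + (cmod h / r)\<^sup>2" by (rule sum_squares_bound)
    finally show ?thesis by (simp add: power_mult_distrib power_divide r)
  qed
  have "2 * Re (g * cnj a) = - 8 * pi\<^sup>2 * n * A\<^sup>2 + 2 * Re (S * cnj a) + 2 * Re (h * cnj a)"
    unfolding g S_def[symmetric] A_def cmod_power2 n_def by (simp add: power2_eq_square algebra_simps)
  also have "\<dots> \<le> - 4 * pi\<^sup>2 * n * A\<^sup>2 + (\<Sum>i\<in>UNIV. (cmod (Fi i))\<^sup>2) + (1 + n) * A\<^sup>2 + (cmod h)\<^sup>2 / (1 + n)"
    using R1 R2 Y1 Y2 by linarith
  also have "\<dots> \<le> - 2 * ((1 + n) * A\<^sup>2) + 3 * A\<^sup>2 + (\<Sum>i\<in>UNIV. (cmod (Fi i))\<^sup>2) + (cmod h)\<^sup>2 / (1 + n)"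
  proof -
    \<comment> \<open>Half of the dissipation is still unspent and must absorb
      \<open>3 * (n * A\<^sup>2)\<close>: moving \<open>- 2 * (1 + n) + 3\<close> to the other side
      of \<open>1 + n\<close> leaves exactly \<open>3 * n\<close>.\<close>
    have "3 * (n * A\<^sup>2) \<le> 4 * pi\<^sup>2 * (n * A\<^sup>2)" using pi2 n by (intro mult_right_mono) auto
    then show ?thesis by (simp add: algebra_simps)
  qed
  finally show ?thesis by (simp add: n_def A_def)
qed

lemma continuous_on_primitive:
  fixes f a :: "real \<Rightarrow> complex"
  assumes "integrable (\<I> T) f" and a: "\<And>t. t \<in> {0..T} \<Longrightarrow> a t = a 0 + (LINT \<tau>|\<I> t. f \<tau>)"
  shows "continuous_on {0..T} a"
proof -
  have "continuous_on {0..T} (\<lambda>t. a 0 + (LINT \<tau>|\<I> t. f \<tau>))"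
    by (intro continuous_intros continuous_on_indefinite_lebesgue assms(1))
  then show ?thesis by (rule continuous_on_eq) (simp add: a[symmetric])
qed

text \<open>Shared by the nonlinear and the linearised equation, which only have to supply the flux
  bound \<open>B\<close>. The flux is measured at the same order \<open>s\<close> as
  \<open>a\<close>: the derivative in the divergence is paid by the dissipation inside
  \<open>energy_mode\<close>. Because the mode identities hold at every time, so do the first two
  conclusions.\<close>

lemma energy_estimate:
  fixes a g h :: "real \<Rightarrow> int^'d \<Rightarrow> complex" and F :: "real \<Rightarrow> 'd \<Rightarrow> int^'d \<Rightarrow> complex"
  assumes T: "0 < T" and B: "0 \<le> B"
    and gi: "\<And>k. integrable (\<I> T) (\<lambda>t. g t k)"
    and a: "\<And>t k. t \<in> {0..T} \<Longrightarrow> a t k = a 0 k + (LINT \<tau>|\<I> t. g \<tau> k)"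
    and eq: "AE t in \<I> T. \<forall>k. g t k = - complex_of_real (4 * pi\<^sup>2 * ksq k) * a t k
      + (\<Sum>i\<in>UNIV. \<i> * complex_of_real (2 * pi * real_of_int (k $ i)) * F t i k) + h t k"
    and Fb: "AE t in \<I> T. \<forall>K. finite K \<longrightarrow>
      (\<Sum>k\<in>K. hw s k * (\<Sum>i\<in>UNIV. (cmod (F t i k))\<^sup>2)) \<le> B * Hsq s (a t)"
    and sa: "AE t in \<I> T. inH (s + 1) (a t)"
    and yi: "integrable (\<I> T) (\<lambda>t. Hsq s (a t))"
    and Yi: "integrable (\<I> T) (\<lambda>t. Hsq (s + 1) (a t))"
    and hs: "AE t in \<I> T. inH (s - 1) (h t)"
    and hi: "integrable (\<I> T) (\<lambda>t. Hsq (s - 1) (h t))"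
    and a0: "inH s (a 0)"
  shows "\<And>t. t \<in> {0..T} \<Longrightarrow> inH s (a t)"
    and "\<And>t. t \<in> {0..T} \<Longrightarrow>
      Hsq s (a t) \<le> (Hsq s (a 0) + (LINT t|\<I> T. Hsq (s - 1) (h t))) * exp ((3 + B) * t)"
    and "(LINT t|\<I> T. Hsq (s + 1) (a t))
      \<le> Hsq s (a 0) + (LINT t|\<I> T. Hsq (s - 1) (h t)) + (3 + B) * (LINT t|\<I> T. Hsq s (a t))"
proof -
  define E where "E = (LINT t|\<I> T. Hsq (s - 1) (h t))"
  have ac: "continuous_on {0..T} (\<lambda>t. a t k)" for k
    by (rule continuous_on_primitive[OF gi a])
  have asq: "integrable (\<I> T) (\<lambda>t. (cmod (a t k))\<^sup>2)" for k
    by (intro continuous_imp_integrable_real continuous_intros ac)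
  note sq = cmod_indefinite_integral_sq[OF gi _ a]
  have pw: "AE t in \<I> T. \<forall>K. finite K \<longrightarrow>
     (\<Sum>k\<in>K. hw s k * (2 * Re (g t k * cnj (a t k))))
       \<le> - 2 * (\<Sum>k\<in>K. hm (s + 1) (a t) k) + ((3 + B) * Hsq s (a t) + Hsq (s - 1) (h t))"
    using eq Fb sa hs
  proof eventually_elim
    case (elim t)
    show ?case
    proof (intro allI impI)
      fix K :: "(int^'d) set" assume K: "finite K"
      have w: "hw s k * (2 * Re (g t k * cnj (a t k))) \<le> - 2 * (hm (s + 1) (a t) k) + 3 * (hm s (a t) k)
         + hw s k * (\<Sum>i\<in>UNIV. (cmod (F t i k))\<^sup>2) + hm (s - 1) (h t) k" for k
      proof -
        have "hw s k * (2 * Re (g t k * cnj (a t k))) \<le> hw s k * (- 2 * ((1 + ksq k) * (cmod (a t k))\<^sup>2) + 3 * (cmod (a t k))\<^sup>2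
          + (\<Sum>i\<in>UNIV. (cmod (F t i k))\<^sup>2) + (cmod (h t k))\<^sup>2 / (1 + ksq k))"
          by (intro mult_left_mono energy_mode) (use elim(1) in auto)
        moreover have "hw (s + 1) k = hw s k * (1 + ksq k)" by (simp add: hw_add hw_1)
        moreover have "hw (s - 1) k = hw s k / (1 + ksq k)" by (simp add: hw_def powr_diff)
        ultimately show ?thesis by (simp add: algebra_simps)
      qed
      have "(\<Sum>k\<in>K. hw s k * (2 * Re (g t k * cnj (a t k)))) \<le> (\<Sum>k\<in>K. - 2 * (hm (s + 1) (a t) k) + 3 * (hm s (a t) k)
         + hw s k * (\<Sum>i\<in>UNIV. (cmod (F t i k))\<^sup>2) + hm (s - 1) (h t) k)"
        by (rule sum_mono) (rule w)
      also have "\<dots> = - 2 * (\<Sum>k\<in>K. hm (s + 1) (a t) k) + 3 * (\<Sum>k\<in>K. hm s (a t) k)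
         + (\<Sum>k\<in>K. hw s k * (\<Sum>i\<in>UNIV. (cmod (F t i k))\<^sup>2)) + (\<Sum>k\<in>K. hm (s - 1) (h t) k)"
        by (simp only: sum.distrib sum_distrib_left)
      also have "\<dots> \<le> - 2 * (\<Sum>k\<in>K. hm (s + 1) (a t) k) + 3 * Hsq s (a t) + B * Hsq s (a t) + Hsq (s - 1) (h t)"
        using sum_le_Hsq[OF inH_mono[OF elim(3)] K, of s] sum_le_Hsq[OF elim(4) K] elim(2) K by (intro add_mono) auto
      finally show "(\<Sum>k\<in>K. hw s k * (2 * Re (g t k * cnj (a t k))))
       \<le> - 2 * (\<Sum>k\<in>K. hm (s + 1) (a t) k) + ((3 + B) * Hsq s (a t) + Hsq (s - 1) (h t))"
        by (simp add: algebra_simps)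
    qed
  qed
  \<comment> \<open>One inequality serves twice: dropping the dissipation gives the hypothesis of
    Gronwall's lemma, dropping the first sum at time \<open>T\<close> gives the bound of order
    \<open>s + 1\<close>.\<close>
  have fin: "(\<Sum>k\<in>K. hm s (a t) k) + 2 * (LINT \<tau>|\<I> t. (\<Sum>k\<in>K. hm (s + 1) (a \<tau>) k))
      \<le> Hsq s (a 0) + E + (3 + B) * (LINT \<tau>|\<I> t. Hsq s (a \<tau>))"
    if K: "finite K" and t: "t \<in> {0..T}" for K t
  proof -
    have lin: "(LINT \<tau>|M. - 2 * f1 \<tau> + (c * f2 \<tau> + f3 \<tau>)) = - 2 * (LINT \<tau>|M. f1 \<tau>) + (c * (LINT \<tau>|M. f2 \<tau>) + (LINT \<tau>|M. f3 \<tau>))"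
      if "integrable M f1" "integrable M f2" "integrable M f3" for M :: "real measure" and f1 f2 f3 :: "real \<Rightarrow> real" and c :: real
      using that by simp
    have sub: "integrable (\<I> T) f \<Longrightarrow> integrable (\<I> t) f" for f :: "real \<Rightarrow> real"
      by (rule integrable_lebesgue_on_subset) (use t in auto)
    have i1: "integrable (\<I> t) (\<lambda>\<tau>. Re (g \<tau> k * cnj (a \<tau> k)))" for k
      by (rule sub) (rule sq(1)[OF t])
    have i2: "integrable (\<I> t) (\<lambda>\<tau>. (\<Sum>k\<in>K. hm (s + 1) (a \<tau>) k))"
      by (rule sub) (intro Bochner_Integration.integrable_sum integrable_mult_right asq)
    note i3 = sub[OF yi] and i4 = sub[OF hi]
    have "(\<Sum>k\<in>K. hm s (a t) k)
      = (\<Sum>k\<in>K. hm s (a 0) k) + (\<Sum>k\<in>K. hw s k * (2 * (LINT \<tau>|\<I> t. Re (g \<tau> k * cnj (a \<tau> k)))))"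
      unfolding sum.distrib[symmetric]
    proof (rule sum.cong[OF refl])
      fix k
      have "(cmod (a t k))\<^sup>2 = (cmod (a 0 k))\<^sup>2 + 2 * (LINT \<tau>|\<I> t. Re (g \<tau> k * cnj (a \<tau> k)))"
        by (rule sq(2)[OF t])
      then show "hm s (a t) k = hm s (a 0) k + hw s k * (2 * (LINT \<tau>|\<I> t. Re (g \<tau> k * cnj (a \<tau> k))))"
        by (simp only: distrib_left)
    qed
    also have "(\<Sum>k\<in>K. hw s k * (2 * (LINT \<tau>|\<I> t. Re (g \<tau> k * cnj (a \<tau> k)))))
        = (LINT \<tau>|\<I> t. (\<Sum>k\<in>K. hw s k * (2 * Re (g \<tau> k * cnj (a \<tau> k)))))"
      by (subst Bochner_Integration.integral_sum) (intro integrable_mult_right i1, simp only: integral_mult_right_zero)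
    also have "\<dots> \<le> (LINT \<tau>|\<I> t. - 2 * (\<Sum>k\<in>K. hm (s + 1) (a \<tau>) k) + ((3 + B) * Hsq s (a \<tau>) + Hsq (s - 1) (h \<tau>)))"
    proof (rule integral_mono_AE)
      show "integrable (\<I> t) (\<lambda>\<tau>. \<Sum>k\<in>K. hw s k * (2 * Re (g \<tau> k * cnj (a \<tau> k))))"
        by (intro Bochner_Integration.integrable_sum integrable_mult_right i1)
      show "integrable (\<I> t) (\<lambda>\<tau>. - 2 * (\<Sum>k\<in>K. hm (s + 1) (a \<tau>) k) + ((3 + B) * Hsq s (a \<tau>) + Hsq (s - 1) (h \<tau>)))"
        by (intro Bochner_Integration.integrable_add integrable_mult_right i2 i3 i4)
      have "AE t in \<I> t. \<forall>K. finite K \<longrightarrow>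
         (\<Sum>k\<in>K. hw s k * (2 * Re (g t k * cnj (a t k))))
       \<le> - 2 * (\<Sum>k\<in>K. hm (s + 1) (a t) k) + ((3 + B) * Hsq s (a t) + Hsq (s - 1) (h t))"
        by (rule AE_lebesgue_on_subset[OF pw]) (use t in auto)
      then show "AE \<tau> in \<I> t. (\<Sum>k\<in>K. hw s k * (2 * Re (g \<tau> k * cnj (a \<tau> k))))
       \<le> - 2 * (\<Sum>k\<in>K. hm (s + 1) (a \<tau>) k) + ((3 + B) * Hsq s (a \<tau>) + Hsq (s - 1) (h \<tau>))"
        by eventually_elim (use K in blast)
    qed
    also have "\<dots> = - 2 * (LINT \<tau>|\<I> t. (\<Sum>k\<in>K. hm (s + 1) (a \<tau>) k))
        + ((3 + B) * (LINT \<tau>|\<I> t. Hsq s (a \<tau>)) + (LINT \<tau>|\<I> t. Hsq (s - 1) (h \<tau>)))"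
      by (rule lin[OF i2 i3 i4])
    finally have main: "(\<Sum>k\<in>K. hm s (a t) k) \<le> (\<Sum>k\<in>K. hm s (a 0) k)
       + (- 2 * (LINT \<tau>|\<I> t. (\<Sum>k\<in>K. hm (s + 1) (a \<tau>) k))
        + ((3 + B) * (LINT \<tau>|\<I> t. Hsq s (a \<tau>)) + (LINT \<tau>|\<I> t. Hsq (s - 1) (h \<tau>))))"
      by simp
    have "(LINT \<tau>|\<I> t. Hsq (s - 1) (h \<tau>)) = (LINT \<tau>|\<I> T. indicator {0..t} \<tau> *\<^sub>R Hsq (s - 1) (h \<tau>))"
      by (rule lebesgue_on_subset_integral(1)) (use t in auto)
    also have "\<dots> \<le> E" unfolding E_def by (rule integral_mono'[OF hi]) (auto simp: indicator_def)
    finally show ?thesis using main sum_le_Hsq[OF a0 K] by linarith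
  qed
  have le: "(\<Sum>k\<in>K. hm s (a t) k) \<le> Hsq s (a 0) + E + (3 + B) * (LINT \<tau>|\<I> t. Hsq s (a \<tau>))"
    if "finite K" and "t \<in> {0..T}" for K t
  proof -
    have "0 \<le> (LINT \<tau>|\<I> t. (\<Sum>k\<in>K. hm (s + 1) (a \<tau>) k))"
      by (rule integral_nonneg_AE) (auto intro!: sum_nonneg)
    then show ?thesis using fin[OF that] by simp
  qed
  show inH: "inH s (a t)" if "t \<in> {0..T}" for t
    by (rule summable_infsum_le_of_finite_sums(1)[OF _ le]) (use that in auto)
  have "Hsq s (a t) \<le> (Hsq s (a 0) + E) + (3 + B) * (LINT \<tau>|\<I> t. Hsq s (a \<tau>))" if "t \<in> {0..T}" for t
    unfolding Hsq_def[of s "a t"] by (rule summable_infsum_le_of_finite_sums(2)[OF _ le]) (use that in auto)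
  then show "Hsq s (a t) \<le> (Hsq s (a 0) + (LINT t|\<I> T. Hsq (s - 1) (h t))) * exp ((3 + B) * t)"
    if "t \<in> {0..T}" for t
    using gronwall_integral[OF yi, of "3 + B" "Hsq s (a 0) + E" t] B that by (auto simp: E_def)
  show "(LINT t|\<I> T. Hsq (s + 1) (a t))
      \<le> Hsq s (a 0) + (LINT t|\<I> T. Hsq (s - 1) (h t)) + (3 + B) * (LINT t|\<I> T. Hsq s (a t))"
    unfolding Hsq_def[of "s + 1"] E_def[symmetric]
  proof (rule integral_infsum_le)
    fix K :: "(int^'d) set" assume K: "finite K"
    have "0 \<le> (LINT \<tau>|\<I> T. (\<Sum>k\<in>K. hm (s + 1) (a \<tau>) k))"
      by (rule integral_nonneg_AE) (auto intro!: sum_nonneg)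
    moreover have "0 \<le> (\<Sum>k\<in>K. hm s (a T) k)" by (auto intro!: sum_nonneg)
    ultimately show "(LINT \<tau>|\<I> T. (\<Sum>k\<in>K. hm (s + 1) (a \<tau>) k))
      \<le> Hsq s (a 0) + E + (3 + B) * (LINT t|\<I> T. Hsq s (a t))"
      using fin[OF K, of T] T by simp
  qed (use asq sa Yi in \<open>auto simp: Hsq_def\<close>)
qed

section \<open>Minimum principle\<close>

definition conv :: "(int^'d \<Rightarrow> complex) \<Rightarrow> (int^'d \<Rightarrow> complex) \<Rightarrow> int^'d \<Rightarrow> complex" where
  "conv X Y k = (\<Sum>\<^sub>\<infinity>l. X (k - l) * Y l)"

lemma abs_summable_on_product_UNIV:
  fixes X Y :: "'a \<Rightarrow> 'b::{real_normed_field, banach}"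
  assumes X: "(\<lambda>k. norm (X k)) summable_on UNIV" and Y: "(\<lambda>k. norm (Y k)) summable_on UNIV"
  shows "(\<lambda>(m, l). norm (X m * Y l)) summable_on UNIV"
proof -
  have "(\<lambda>p. norm ((\<lambda>(m, l). X m * Y l) p)) summable_on Sigma UNIV (\<lambda>_. UNIV)"
  proof (rule Infinite_Sum.abs_summable_on_Sigma_iff[THEN iffD2], intro conjI ballI)
    fix m
    show "(\<lambda>y. norm (case (m, y) of (m, l) \<Rightarrow> X m * Y l)) summable_on UNIV"
      using Y by (simp add: norm_mult summable_on_cmult_right)
    have "(\<lambda>m. norm (X m) * (\<Sum>\<^sub>\<infinity>l. norm (Y l))) summable_on UNIV"
      by (rule summable_on_cmult_left[OF X])
    then show "(\<lambda>x. norm (\<Sum>\<^sub>\<infinity>y. norm (case (x, y) of (m, l) \<Rightarrow> X m * Y l))) summable_on UNIV"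
      using Y by (simp add: norm_mult infsum_cmult_right' infsum_nonneg)
  qed
  then show ?thesis by (simp add: case_prod_unfold)
qed

lemma bij_shear: "bij (\<lambda>(k, l). (k - l, l) :: 'a::ab_group_add \<times> 'a)"
  by (rule bij_betw_byWitness[where f' = "\<lambda>(m, l). (m + l, l)"]) auto

text \<open>The shear of index pairs is a bijection, so all claims reduce to the absolutely summable
  family \<open>X m * Y l\<close>.\<close>

lemma conv_summable:
  assumes X: "l1 X" and Y: "l1 Y"
  shows "(\<lambda>l. X (k - l) * Y l) summable_on UNIV" "(\<lambda>l. cmod (X (k - l) * Y l)) summable_on UNIV"
    "l1 (conv X Y)" "(\<Sum>\<^sub>\<infinity>k. conv X Y k) = (\<Sum>\<^sub>\<infinity>k. X k) * (\<Sum>\<^sub>\<infinity>k. Y k)"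
proof -
  have "(\<lambda>(m, l). cmod (X m * Y l)) summable_on UNIV" by (rule abs_summable_on_product_UNIV[OF X Y])
  then have 1: "(\<lambda>p. cmod ((\<lambda>(k, l). X (k - l) * Y l) p)) summable_on Sigma UNIV (\<lambda>_. UNIV)"
    using summable_on_reindex_bij_betw[OF bij_shear, of "\<lambda>(m, l). cmod (X m * Y l)"]
    by (simp add: case_prod_unfold)
  note 2 = Infinite_Sum.abs_summable_on_Sigma_iff[THEN iffD1, OF 1]
  show 3: "(\<lambda>l. cmod (X (k - l) * Y l)) summable_on UNIV" for k using 2 by simp
  then show 4: "(\<lambda>l. X (k - l) * Y l) summable_on UNIV" for k by (rule abs_summable_summable)
  have s: "(\<lambda>k. \<Sum>\<^sub>\<infinity>l. cmod (X (k - l) * Y l)) summable_on UNIV" using 2 by (simp add: infsum_nonneg)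
  show "l1 (conv X Y)"
  proof (rule summable_on_comparison_test[OF s])
    show "cmod (conv X Y k) \<le> (\<Sum>\<^sub>\<infinity>l. cmod (X (k - l) * Y l))" for k
      unfolding conv_def by (rule norm_infsum_bound[OF 3])
  qed auto
  have 5: "(\<lambda>p. (\<lambda>(k, l). X (k - l) * Y l) p) summable_on Sigma UNIV (\<lambda>_. UNIV)"
    by (rule abs_summable_summable[OF 1])
  have 6: "(\<lambda>(m, l). X m * Y l) summable_on Sigma UNIV (\<lambda>_. UNIV)"
    using abs_summable_summable[of "\<lambda>(m, l). X m * Y l"] abs_summable_on_product_UNIV[OF X Y] by (simp add: case_prod_unfold)
  have "(\<Sum>\<^sub>\<infinity>k. conv X Y k) = (\<Sum>\<^sub>\<infinity>p\<in>Sigma UNIV (\<lambda>_. UNIV). (\<lambda>(k, l). X (k - l) * Y l) p)"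
    using infsum_Sigma_banach[OF 5] by (simp add: conv_def)
  also have "\<dots> = (\<Sum>\<^sub>\<infinity>p\<in>Sigma UNIV (\<lambda>_. UNIV). (\<lambda>(m, l). X m * Y l) p)"
    using infsum_reindex_bij_betw[OF bij_shear, of "\<lambda>(m, l). X m * Y l"] by (simp add: case_prod_unfold)
  also have "\<dots> = (\<Sum>\<^sub>\<infinity>m. \<Sum>\<^sub>\<infinity>l. X m * Y l)"
    using infsum_Sigma_banach[OF 6] by simp
  also have "\<dots> = (\<Sum>\<^sub>\<infinity>k. X k) * (\<Sum>\<^sub>\<infinity>k. Y k)"
    by (simp add: infsum_cmult_right' infsum_cmult_left')
  finally show "(\<Sum>\<^sub>\<infinity>k. conv X Y k) = (\<Sum>\<^sub>\<infinity>k. X k) * (\<Sum>\<^sub>\<infinity>k. Y k)" .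
qed

text \<open>Modulating both sequences by the character at \<open>x\<close> turns the claim into the
  product formula for total sums.\<close>

lemma ts_conv:
  assumes X: "l1 X" and Y: "l1 Y"
  shows "ts (conv X Y) x = ts X x * ts Y x"
proof -
  have "conv (\<lambda>k. X k * ek k x) (\<lambda>k. Y k * ek k x) k = conv X Y k * ek k x" for k
  proof -
    have "X (k - l) * ek (k - l) x * (Y l * ek l x) = X (k - l) * Y l * ek k x" for l
      using ek_add[of "k - l" l x] by simp
    then show ?thesis unfolding conv_def by (simp only: infsum_cmult_left')
  qed
  then show ?thesis
    using conv_summable(4)[of "\<lambda>k. X k * ek k x" "\<lambda>k. Y k * ek k x"] X Y
    by (simp add: ts_def norm_mult)
qed

text \<open>The Fourier multiplier of the \<open>i\<close>-th partial derivative.\<close>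

definition dk :: "'d \<Rightarrow> (int^'d \<Rightarrow> complex) \<Rightarrow> int^'d \<Rightarrow> complex" where
  "dk i c k = \<i> * complex_of_real (2 * pi * real_of_int (k $ i)) * c k"

lemma abs_nth_le_ksq: "\<bar>real_of_int (k $ i)\<bar> \<le> 1 + ksq k" "(real_of_int (k $ i))\<^sup>2 \<le> ksq k"
proof -
  show 1: "(real_of_int (k $ i))\<^sup>2 \<le> ksq k" unfolding ksq_def by (rule member_le_sum) auto
  have "2 * \<bar>real_of_int (k $ i)\<bar> \<le> 1 + (real_of_int (k $ i))\<^sup>2"
    using sum_squares_bound[of 1 "\<bar>real_of_int (k $ i)\<bar>"] by simp
  then show "\<bar>real_of_int (k $ i)\<bar> \<le> 1 + ksq k" using 1 by linarith
qed

lemma cmod_dk_le: "cmod (dk i c k) \<le> 2 * pi * ((1 + ksq k) * cmod (c k))"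
  unfolding dk_def using abs_nth_le_ksq(1)[of k i] by (simp add: norm_mult mult_right_mono)

lemma cmod_dk_dk_le: "cmod (dk i (dk i c) k) \<le> 4 * pi\<^sup>2 * ((1 + ksq k) * cmod (c k))"
proof -
  have "cmod (dk i (dk i c) k) = 4 * pi\<^sup>2 * ((real_of_int (k $ i))\<^sup>2 * cmod (c k))"
    by (simp add: dk_def norm_mult power2_eq_square)
  also have "\<dots> \<le> 4 * pi\<^sup>2 * ((1 + ksq k) * cmod (c k))"
    using abs_nth_le_ksq(2)[of k i] by (intro mult_left_mono mult_right_mono) auto
  finally show ?thesis .
qed

text \<open>Leibniz rule, because \<open>k $ i\<close> is the sum of \<open>(k - l) $ i\<close> and
  \<open>l $ i\<close>.\<close>

lemma dk_conv:
  assumes "l1 X" "l1 Y" "l1 (dk i X)" "l1 (dk i Y)"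
  shows "dk i (conv X Y) k = conv (dk i X) Y k + conv X (dk i Y) k"
proof -
  have "conv (dk i X) Y k + conv X (dk i Y) k = (\<Sum>\<^sub>\<infinity>l. dk i X (k - l) * Y l + X (k - l) * dk i Y l)"
    unfolding conv_def using assms by (intro infsum_add[symmetric] conv_summable)
  also have "\<dots> = (\<Sum>\<^sub>\<infinity>l. (\<i> * complex_of_real (2 * pi * real_of_int (k $ i))) * (X (k - l) * Y l))"
    by (rule infsum_cong) (simp add: dk_def algebra_simps)
  also have "\<dots> = dk i (conv X Y) k" by (simp only: infsum_cmult_right' conv_def dk_def)
  finally show ?thesis ..
qed

text \<open>Termwise differentiation under a summable majorant. Derivatives are taken within
  \<open>S\<close> so that the end points of the time interval are included.\<close>

lemma has_real_derivative_infsum: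
  fixes f f' :: "'k::countable \<Rightarrow> real \<Rightarrow> real"
  assumes S: "convex S" and x: "x \<in> S"
    and d: "\<And>k x. x \<in> S \<Longrightarrow> (f k has_real_derivative f' k x) (at x within S)"
    and D: "\<And>k x. x \<in> S \<Longrightarrow> \<bar>f' k x\<bar> \<le> D k" "D summable_on UNIV"
    and s: "\<And>x. x \<in> S \<Longrightarrow> (\<lambda>k. f k x) summable_on UNIV"
  shows "((\<lambda>x. \<Sum>\<^sub>\<infinity>k. f k x) has_real_derivative (\<Sum>\<^sub>\<infinity>k. f' k x)) (at x within S)"
proof -
  have "uniform_limit S (\<lambda>K x. \<Sum>k\<in>K. f' k x) (\<lambda>x. \<Sum>\<^sub>\<infinity>k. f' k x) (finite_subsets_at_top UNIV)"
    by (rule Weierstrass_m_test_general[where M = D]) (use D in auto)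
  then have ul: "uniform_limit S (\<lambda>n x. \<Sum>k\<in>enum_set n. f' k x) (\<lambda>x. \<Sum>\<^sub>\<infinity>k. f' k x) sequentially"
    by (rule filterlim_compose[OF _ filterlim_enum_set])
  have lim: "(\<lambda>n. \<Sum>k\<in>enum_set n. f k x) \<longlonglongrightarrow> (\<Sum>\<^sub>\<infinity>k. f k x)" if "x \<in> S" for x
    by (rule sum_enum_set_tendsto) (use s[OF that] in simp)
  have "\<exists>g. \<forall>x\<in>S. (\<lambda>n. \<Sum>k\<in>enum_set n. f k x) \<longlonglongrightarrow> g x \<and> (g has_derivative (\<lambda>h. (\<Sum>\<^sub>\<infinity>k. f' k x) * h)) (at x within S)"
  proof (rule has_derivative_sequence[where f = "\<lambda>n x. \<Sum>k\<in>enum_set n. f k x"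
      and f' = "\<lambda>n x h. (\<Sum>k\<in>enum_set n. f' k x) * h", OF S _ _ x lim[OF x]])
    show "((\<lambda>x. \<Sum>k\<in>enum_set n. f k x) has_derivative (\<lambda>h. (\<Sum>k\<in>enum_set n. f' k x) * h)) (at x within S)" if "x \<in> S" for n x
    proof -
      have "((\<lambda>x. \<Sum>k\<in>enum_set n. f k x) has_real_derivative (\<Sum>k\<in>enum_set n. f' k x)) (at x within S)"
        by (intro derivative_intros d that)
      then show ?thesis unfolding has_field_derivative_def .
    qed
    fix e :: real assume e: "e > 0"
    show "\<forall>\<^sub>F n in sequentially. \<forall>x\<in>S. \<forall>h. norm ((\<Sum>k\<in>enum_set n. f' k x) * h - (\<Sum>\<^sub>\<infinity>k. f' k x) * h) \<le> e * norm h"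
      using uniform_limitD[OF ul e]
    proof eventually_elim
      case (elim n)
      show ?case
      proof (intro ballI allI)
        fix x h assume "x \<in> S"
        then have "\<bar>(\<Sum>k\<in>enum_set n. f' k x) - (\<Sum>\<^sub>\<infinity>k. f' k x)\<bar> \<le> e" using elim by (auto simp: dist_real_def less_imp_le)
        then show "norm ((\<Sum>k\<in>enum_set n. f' k x) * h - (\<Sum>\<^sub>\<infinity>k. f' k x) * h) \<le> e * norm h"
          by (simp add: abs_mult mult_right_mono flip: left_diff_distrib)
      qed
    qed
  qed
  then obtain g where g: "\<And>x. x \<in> S \<Longrightarrow> (\<lambda>n. \<Sum>k\<in>enum_set n. f k x) \<longlonglongrightarrow> g x"
    "\<And>x. x \<in> S \<Longrightarrow> (g has_real_derivative (\<Sum>\<^sub>\<infinity>k. f' k x)) (at x within S)"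
    unfolding has_field_derivative_def by blast
  have "g x = (\<Sum>\<^sub>\<infinity>k. f k x)" if "x \<in> S" for x using LIMSEQ_unique[OF g(1)[OF that] lim[OF that]] .
  then show ?thesis
    using g(2)[OF x] x unfolding has_field_derivative_def by (metis (no_types, lifting) has_derivative_transform)
qed

lemma Re_ts: "l1 c \<Longrightarrow> Re (ts c x) = (\<Sum>\<^sub>\<infinity>k. Re (c k * ek k x))"
  by (rule infsumI[symmetric, OF has_sum_Re[OF ts_has_sum]])

lemma Re_ts_summable: "l1 c \<Longrightarrow> (\<lambda>k. Re (c k * ek k x)) summable_on UNIV"
  by (rule has_sum_imp_summable[OF has_sum_Re[OF ts_has_sum]])

lemma ek_add_axis: "ek k (x + h *\<^sub>R axis i 1) = ek k x * cis (2 * pi * real_of_int (k $ i) * h)"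
proof -
  have "kdot k (h *\<^sub>R axis i 1) = real_of_int (k $ i) * h"
    unfolding kdot_def axis_def by (simp add: if_distrib[of "\<lambda>a. _ * a"] cong: if_cong)
  then show ?thesis unfolding ek_add_right by (simp add: ek_def mult.assoc)
qed

lemma has_real_derivative_Re_ts_axis:
  assumes c: "l1 c" and d: "l1 (dk i c)"
  shows "((\<lambda>h. Re (ts c (x + h *\<^sub>R axis i 1))) has_real_derivative Re (ts (dk i c) (x + h *\<^sub>R axis i 1))) (at h)"
proof -
  have "((\<lambda>h. \<Sum>\<^sub>\<infinity>k. Re (c k * ek k (x + h *\<^sub>R axis i 1))) has_real_derivative
     (\<Sum>\<^sub>\<infinity>k. Re (dk i c k * ek k (x + h *\<^sub>R axis i 1)))) (at h within UNIV)"
  proof (rule has_real_derivative_infsum[where D = "\<lambda>k. cmod (dk i c k)"])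
    fix k and h :: real
    define z where "z = c k * ek k x"
    define q where "q = 2 * pi * real_of_int (k $ i)"
    have e1: "Re (c k * ek k (x + h *\<^sub>R axis i 1)) = Re z * cos (q * h) - Im z * sin (q * h)" for h
    proof -
      have "c k * ek k (x + h *\<^sub>R axis i 1) = z * cis (q * h)" by (simp only: ek_add_axis z_def q_def mult.assoc)
      then show ?thesis by simp
    qed
    have e2: "Re (dk i c k * ek k (x + h *\<^sub>R axis i 1)) = - (q * Re z * sin (q * h)) - q * Im z * cos (q * h)"
    proof -
      have "dk i c k * ek k (x + h *\<^sub>R axis i 1) = \<i> * complex_of_real q * (z * cis (q * h))"
        by (simp only: ek_add_axis z_def q_def dk_def mult.assoc)
      then have "dk i c k * ek k (x + h *\<^sub>R axis i 1) = \<i> * (complex_of_real q * (z * cis (q * h)))" by (simp only: mult.assoc)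
      then show ?thesis by (simp add: algebra_simps)
    qed
    show "((\<lambda>h. Re (c k * ek k (x + h *\<^sub>R axis i 1))) has_real_derivative Re (dk i c k * ek k (x + h *\<^sub>R axis i 1))) (at h)"
      unfolding e1 e2 by (auto intro!: derivative_eq_intros simp: algebra_simps)
    show "\<bar>Re (dk i c k * ek k (x + h *\<^sub>R axis i 1))\<bar> \<le> cmod (dk i c k)"
      by (rule order_trans[OF abs_Re_le_cmod]) (simp add: norm_mult)
  qed (use d Re_ts_summable[OF c] in auto)
  then show ?thesis using Re_ts[OF c] Re_ts[OF d] by simp
qed

text \<open>If \<open>D\<close> were negative, \<open>f'\<close> would be negative just to the right
  of its zero, and the mean value theorem would push \<open>f\<close> below its minimum.\<close>

lemma second_derivative_nonneg_at_min:
  fixes f f' :: "real \<Rightarrow> real"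
  assumes d: "\<And>h. (f has_real_derivative f' h) (at h)" and d2: "(f' has_real_derivative D) (at 0)"
    and min: "\<And>h. f 0 \<le> f h"
  shows "f' 0 = 0" "0 \<le> D"
proof -
  show f'0: "f' 0 = 0"
    by (rule DERIV_local_min[OF d, of 1]) (use min in auto)
  show "0 \<le> D"
  proof (rule ccontr)
    assume "\<not> 0 \<le> D"
    then obtain \<delta> where \<delta>: "\<delta> > 0" "\<And>h. h > 0 \<Longrightarrow> h < \<delta> \<Longrightarrow> f' 0 > f' (0 + h)"
      using DERIV_neg_dec_right[OF d2] by auto
    obtain z where z: "0 < z" "z < \<delta>/2" "f (\<delta>/2) - f 0 = (\<delta>/2 - 0) * f' z"
      using MVT2[of 0 "\<delta>/2" f f'] d \<delta>(1) by auto
    have "f' z < 0" using \<delta>(2)[of z] z f'0 \<delta>(1) by simp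
    then have "(\<delta>/2 - 0) * f' z < 0" using \<delta>(1) by (intro mult_pos_neg) auto
    then have "f (\<delta>/2) < f 0" using z(3) by linarith
    then show False using min[of "\<delta>/2"] by simp
  qed
qed


lemma l1_add:
  assumes "l1 X" "l1 Y" shows "l1 (\<lambda>k. X k + Y k)"
  by (rule summable_on_comparison_test[OF summable_on_add[OF assms]]) (simp_all add: norm_triangle_ineq)

lemma ts_add:
  assumes "l1 X" "l1 Y" shows "ts (\<lambda>k. X k + Y k) x = ts X x + ts Y x"
  unfolding ts_def distrib_right using assms
  by (intro infsum_add has_sum_imp_summable[OF ts_has_sum])

lemma l1_sum: "finite I \<Longrightarrow> (\<And>i. i \<in> I \<Longrightarrow> l1 (X i)) \<Longrightarrow> l1 (\<lambda>k. \<Sum>i\<in>I. X i k)"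
  by (induction I rule: finite_induct) (auto intro!: l1_add)

lemma ts_sum: "finite I \<Longrightarrow> (\<And>i. i \<in> I \<Longrightarrow> l1 (X i)) \<Longrightarrow> ts (\<lambda>k. \<Sum>i\<in>I. X i k) x = (\<Sum>i\<in>I. ts (X i) x)"
proof (induction I rule: finite_induct)
  case empty
  then show ?case by (simp add: ts_def)
next
  case (insert i I)
  then show ?case by (simp add: ts_add l1_sum)
qed

lemma l1_comparison: "(\<And>k. cmod (X k) \<le> y k) \<Longrightarrow> y summable_on UNIV \<Longrightarrow> l1 X"
  by (rule summable_on_comparison_test) auto

text \<open>Supplies majorants that do not depend on time for convolutions of time-dependent
  sequences.\<close>

lemma conv_bound:
  assumes x: "x summable_on UNIV" and y: "y summable_on UNIV"
    and X: "\<And>k. cmod (X k) \<le> x k" and Y: "\<And>k. cmod (Y k) \<le> y k"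
  shows "cmod (conv X Y k) \<le> cmod (conv (\<lambda>k. complex_of_real (x k)) (\<lambda>k. complex_of_real (y k)) k)"
proof -
  have x0: "0 \<le> x k" and y0: "0 \<le> y k" for k using X[of k] Y[of k] norm_ge_zero order_trans by blast+
  have xl: "l1 (\<lambda>k. complex_of_real (x k))" and yl: "l1 (\<lambda>k. complex_of_real (y k))" using x y x0 y0 by auto
  note sXY = conv_summable(2)[OF l1_comparison[OF X x] l1_comparison[OF Y y]]
  note sxy = conv_summable(2)[OF xl yl]
  have "cmod (conv X Y k) \<le> (\<Sum>\<^sub>\<infinity>l. cmod (X (k - l) * Y l))" unfolding conv_def by (rule norm_infsum_bound[OF sXY])
  also have "\<dots> \<le> (\<Sum>\<^sub>\<infinity>l. cmod (complex_of_real (x (k - l)) * complex_of_real (y l)))"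
    by (rule infsum_mono[OF sXY sxy]) (auto simp: norm_mult x0 y0 intro!: mult_mono X Y)
  also have "\<dots> = (\<Sum>\<^sub>\<infinity>l. x (k - l) * y l)" by (simp add: norm_mult x0 y0)
  also have "\<dots> = cmod (complex_of_real (\<Sum>\<^sub>\<infinity>l. x (k - l) * y l))" by (simp add: infsum_nonneg x0 y0)
  also have "complex_of_real (\<Sum>\<^sub>\<infinity>l. x (k - l) * y l) = conv (\<lambda>k. complex_of_real (x k)) (\<lambda>k. complex_of_real (y k)) k"
  proof -
    have "(\<lambda>l. x (k - l) * y l) summable_on UNIV" using sxy[of k] by (simp add: norm_mult x0 y0)
    then have "((\<lambda>l. complex_of_real (x (k - l) * y l)) has_sum complex_of_real (\<Sum>\<^sub>\<infinity>l. x (k - l) * y l)) UNIV"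
      by (intro has_sum_of_real has_sum_infsum)
    then show ?thesis unfolding conv_def by (simp add: infsumI)
  qed
  finally show ?thesis .
qed

text \<open>Minimum principle: at a negative minimum of \<open>exp (- \<lambda> t) p(t, x)\<close> the gradient
  term vanishes, the Laplacian is nonnegative, and the zeroth order coefficient is
  dominated by \<open>\<lambda>\<close>.\<close>

lemma minimum_principle:
  fixes a g :: "real \<Rightarrow> int^'d \<Rightarrow> complex" and w :: "'d \<Rightarrow> int^'d \<Rightarrow> complex"
  assumes T: "0 < T"
    and A: "(\<lambda>k. (1 + ksq k) * A k) summable_on UNIV"
    and aA: "\<And>t k. t \<in> {0..T} \<Longrightarrow> cmod (a t k) \<le> A k"
    and wM: "\<And>i k. cmod (w i k) \<le> M"
    and sym: "\<And>t k. t \<in> {0..T} \<Longrightarrow> a t (- k) = cnj (a t k)"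
    and gi: "\<And>k. integrable (\<I> T) (\<lambda>t. g t k)"
    and a: "\<And>t k. t \<in> {0..T} \<Longrightarrow> a t k = a 0 k + (LINT \<tau>|\<I> t. g \<tau> k)"
    and eq: "AE t in \<I> T. \<forall>k. g t k = - complex_of_real (4 * pi\<^sup>2 * ksq k) * a t k
      + (\<Sum>i\<in>UNIV. dk i (conv (a t) (\<lambda>l. w i l * a t l)) k)"
    and init: "\<And>x. x \<in> cube \<Longrightarrow> 0 \<le> Re (ts (a 0) x)"
    and t: "t \<in> {0..T}" and x: "x \<in> cube"
  shows "0 \<le> Re (ts (a t) x)"
proof -
  have M0: "0 \<le> M" using wM[of undefined 0] norm_ge_zero order_trans by blast
  have A0: "0 \<le> A k" for k using order_trans[OF norm_ge_zero aA[of 0 k]] T by simp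
  have As: "A summable_on UNIV"
  proof (rule summable_on_comparison_test[OF A])
    show "A k \<le> (1 + ksq k) * A k" for k using mult_right_mono[of 1 "1 + ksq k" "A k"] A0[of k] by simp
  qed (rule A0)
  define B where "B k = (1 + ksq k) * A k" for k
  have Bs: "B summable_on UNIV" using A by (simp add: B_def[abs_def])
  have B0: "0 \<le> B k" for k by (simp add: B_def A0)
  define c where "c t i l = w i l * a t l" for t i l
  have cA: "cmod (c t i l) \<le> M * A l" if "t \<in> {0..T}" for t i l
    unfolding c_def norm_mult by (rule mult_mono) (use wM aA that M0 in auto)
  have al: "l1 (a t)" if "t \<in> {0..T}" for t by (rule l1_comparison[OF aA[OF that] As])
  have cl: "l1 (c t i)" if "t \<in> {0..T}" for t i
    by (rule l1_comparison[OF cA[OF that]]) (rule summable_on_cmult_right[OF As])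
  have dab: "cmod (dk i (a t) k) \<le> 2 * pi * B k" if "t \<in> {0..T}" for t i k
    unfolding B_def by (rule order_trans[OF cmod_dk_le]) (use aA[OF that, of k] in \<open>auto intro!: mult_left_mono\<close>)
  have ddab: "cmod (dk i (dk i (a t)) k) \<le> 4 * pi\<^sup>2 * B k" if "t \<in> {0..T}" for t i k
    unfolding B_def by (rule order_trans[OF cmod_dk_dk_le]) (use aA[OF that, of k] in \<open>auto intro!: mult_left_mono\<close>)
  have dcb: "cmod (dk i (c t i) k) \<le> 2 * pi * M * B k" if "t \<in> {0..T}" for t i k
  proof -
    have "cmod (dk i (c t i) k) \<le> 2 * pi * ((1 + ksq k) * cmod (c t i k))" by (rule cmod_dk_le)
    also have "\<dots> \<le> 2 * pi * ((1 + ksq k) * (M * A k))" by (intro mult_left_mono cA[OF that]) auto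
    finally show ?thesis by (simp add: B_def mult_ac)
  qed
  have dal: "l1 (dk i (a t))" if "t \<in> {0..T}" for t i
    by (rule l1_comparison[OF dab[OF that]]) (rule summable_on_cmult_right[OF Bs])
  have ddal: "l1 (dk i (dk i (a t)))" if "t \<in> {0..T}" for t i
    by (rule l1_comparison[OF ddab[OF that]]) (rule summable_on_cmult_right[OF Bs])
  have dcl: "l1 (dk i (c t i))" if "t \<in> {0..T}" for t i
    by (rule l1_comparison[OF dcb[OF that]]) (rule summable_on_cmult_right[OF Bs])
  \<comment> \<open>The right-hand side with the Leibniz rule carried out. It equals
    \<open>g\<close> for almost every time, but is continuous in time, so each mode becomes
    continuously differentiable.\<close>
  define G where "G t k = (\<Sum>i\<in>UNIV. dk i (dk i (a t)) k) + (\<Sum>i\<in>UNIV. conv (dk i (a t)) (c t i) k + conv (a t) (dk i (c t i)) k)" for t k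
  have lap: "(\<Sum>i\<in>UNIV. dk i (dk i (a t)) k) = - complex_of_real (4 * pi\<^sup>2 * ksq k) * a t k" for t k
  proof -
    have "(\<Sum>i\<in>UNIV. dk i (dk i (a t)) k) = (\<Sum>i\<in>UNIV. complex_of_real ((real_of_int (k $ i))\<^sup>2) * (- complex_of_real (4 * pi\<^sup>2) * a t k))"
      by (rule sum.cong) (simp_all add: dk_def power2_eq_square)
    also have "\<dots> = complex_of_real (ksq k) * (- complex_of_real (4 * pi\<^sup>2) * a t k)"
      by (simp only: ksq_def of_real_sum sum_distrib_right)
    finally show ?thesis by simp
  qed
  have gG: "AE t in \<I> T. \<forall>k. g t k = G t k"
    using eq AE_space
  proof eventually_elim
    case (elim t)
    then have t: "t \<in> {0..T}" by simp
    have "dk i (conv (a t) (\<lambda>l. w i l * a t l)) k = conv (dk i (a t)) (c t i) k + conv (a t) (dk i (c t i)) k" for i k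
    proof -
      have "dk i (conv (a t) (c t i)) k = conv (dk i (a t)) (c t i) k + conv (a t) (dk i (c t i)) k"
        by (rule dk_conv[OF al[OF t] cl[OF t] dal[OF t] dcl[OF t]])
      then show ?thesis by (simp only: c_def[abs_def])
    qed
    then show ?case using elim(1) unfolding G_def lap by simp
  qed
  \<comment> \<open>A summable majorant of \<open>G\<close> independent of time, for termwise
    differentiation in time.\<close>
  define D where "D k = real CARD('d) * (4 * pi\<^sup>2 * B k) + (\<Sum>i\<in>(UNIV::'d set).
      cmod (conv (\<lambda>k. complex_of_real (2 * pi * B k)) (\<lambda>k. complex_of_real (M * A k)) k)
    + cmod (conv (\<lambda>k. complex_of_real (A k)) (\<lambda>k. complex_of_real (2 * pi * M * B k)) k))" for k
  have GD: "cmod (G t k) \<le> D k" if "t \<in> {0..T}" for t k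
    unfolding G_def D_def
  proof (rule order_trans[OF norm_triangle_ineq add_mono])
    show "cmod (\<Sum>i\<in>UNIV. dk i (dk i (a t)) k) \<le> real CARD('d) * (4 * pi\<^sup>2 * B k)"
      using sum_norm_bound[of "UNIV :: 'd set" "\<lambda>i. dk i (dk i (a t)) k"] ddab[OF that] by auto
    show "cmod (\<Sum>i\<in>UNIV. conv (dk i (a t)) (c t i) k + conv (a t) (dk i (c t i)) k) \<le> (\<Sum>i\<in>(UNIV::'d set).
      cmod (conv (\<lambda>k. complex_of_real (2 * pi * B k)) (\<lambda>k. complex_of_real (M * A k)) k)
    + cmod (conv (\<lambda>k. complex_of_real (A k)) (\<lambda>k. complex_of_real (2 * pi * M * B k)) k))"
      by (intro sum_norm_le order_trans[OF norm_triangle_ineq] add_mono conv_bound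
           summable_on_cmult_right As Bs dab[OF that] cA[OF that] aA[OF that] dcb[OF that])
  qed
  have Ds: "D summable_on UNIV"
  proof -
    have e1: "l1 (\<lambda>k. complex_of_real (2 * pi * B k))"
      by (rule l1_comparison[OF _ summable_on_cmult_right[OF Bs, of "2 * pi"]]) (simp add: norm_mult B0)
    have e2: "l1 (\<lambda>k. complex_of_real (2 * pi * M * B k))"
      by (rule l1_comparison[OF _ summable_on_cmult_right[OF Bs, of "2 * pi * M"]]) (simp add: norm_mult B0 M0)
    have e3: "l1 (\<lambda>k. complex_of_real (A k))"
      by (rule l1_comparison[OF _ As]) (simp add: A0)
    have e4: "l1 (\<lambda>k. complex_of_real (M * A k))"
      by (rule l1_comparison[OF _ summable_on_cmult_right[OF As, of M]]) (simp add: norm_mult A0 M0)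
    show ?thesis
      unfolding D_def[abs_def] sum_constant
      by (intro summable_on_add summable_on_cmult_right Bs conv_summable(3) e1 e2 e3 e4)
  qed
  have acont: "continuous_on {0..T} (\<lambda>t. a t k)" for k
    by (rule continuous_on_primitive[OF gi a])
  have convcont: "continuous_on {0..T} (\<lambda>t. conv (X t) (Y t) k)"
    if X: "\<And>k. continuous_on {0..T} (\<lambda>t. X t k)" "\<And>t k. t \<in> {0..T} \<Longrightarrow> cmod (X t k) \<le> x k" "x summable_on UNIV"
    and Y: "\<And>k. continuous_on {0..T} (\<lambda>t. Y t k)" "\<And>t k. t \<in> {0..T} \<Longrightarrow> cmod (Y t k) \<le> y k" "y summable_on UNIV"
    for X Y :: "real \<Rightarrow> int^'d \<Rightarrow> complex" and x y k
  proof -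
    have x0: "0 \<le> x k" and y0: "0 \<le> y k" for k
      using order_trans[OF norm_ge_zero X(2)[of 0 k]] order_trans[OF norm_ge_zero Y(2)[of 0 k]] T by simp_all
    have xl: "l1 (\<lambda>k. complex_of_real (x k))" and yl: "l1 (\<lambda>k. complex_of_real (y k))" using X(3) Y(3) x0 y0 by auto
    have "uniform_limit {0..T} (\<lambda>K t. \<Sum>l\<in>K. X t (k - l) * Y t l) (\<lambda>t. \<Sum>\<^sub>\<infinity>l. X t (k - l) * Y t l) (finite_subsets_at_top UNIV)"
    proof (rule Weierstrass_m_test_general)
      show "cmod (X t (k - l) * Y t l) \<le> cmod (complex_of_real (x (k - l)) * complex_of_real (y l))" if "t \<in> {0..T}" for l t
        using X(2)[OF that] Y(2)[OF that] x0 y0 by (auto simp: norm_mult intro!: mult_mono)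
      show "(\<lambda>l. cmod (complex_of_real (x (k - l)) * complex_of_real (y l))) summable_on UNIV"
        by (rule conv_summable(2)[OF xl yl])
    qed
    then show ?thesis unfolding conv_def
      by (rule uniform_limit_theorem[rotated])
         (auto intro!: eventually_finite_subsets_at_top_weakI continuous_intros X(1) Y(1))
  qed
  have Gcont: "continuous_on {0..T} (\<lambda>t. G t k)" for k
    unfolding G_def
  proof (intro continuous_on_add continuous_on_sum)
    show "continuous_on {0..T} (\<lambda>t. dk i (dk i (a t)) k)" for i
      unfolding dk_def by (intro continuous_intros acont)
    show "continuous_on {0..T} (\<lambda>t. conv (dk i (a t)) (c t i) k)" for i
      by (rule convcont[OF _ dab _ _ cA])
         (auto simp: dk_def c_def intro!: continuous_intros acont summable_on_cmult_right[OF As] summable_on_cmult_right[OF Bs])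
    show "continuous_on {0..T} (\<lambda>t. conv (a t) (dk i (c t i)) k)" for i
      by (rule convcont[OF acont aA As _ dcb])
         (auto simp: dk_def c_def intro!: continuous_intros acont summable_on_cmult_right[OF Bs])
  qed
  have aG: "a t k = a 0 k + integral {0..t} (\<lambda>\<tau>. G \<tau> k)" if t: "t \<in> {0..T}" for t k
  proof -
    have gm: "integrable (\<I> t) (\<lambda>t. g t k)" by (rule integrable_lebesgue_on_subset[OF gi]) (use t in auto)
    have Gm: "integrable (\<I> t) (\<lambda>t. G t k)"
      by (rule continuous_imp_integrable_real, rule continuous_on_subset[OF Gcont]) (use t in auto)
    have "AE \<tau> in \<I> t. \<forall>k. g \<tau> k = G \<tau> k" by (rule AE_lebesgue_on_subset[OF gG]) (use t in auto)
    then have "(LINT \<tau>|\<I> t. g \<tau> k) = (LINT \<tau>|\<I> t. G \<tau> k)"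
      using gm Gm by (intro integral_cong_AE) (auto elim!: eventually_mono)
    also have "\<dots> = integral {0..t} (\<lambda>\<tau>. G \<tau> k)" by (rule lebesgue_integral_eq_integral[OF Gm]) simp
    finally show ?thesis using a[OF t] by simp
  qed
  have ader: "((\<lambda>t. a t k) has_vector_derivative G t k) (at t within {0..T})" if t: "t \<in> {0..T}" for t k
  proof -
    have "((\<lambda>t. a 0 k + integral {0..t} (\<lambda>\<tau>. G \<tau> k)) has_vector_derivative 0 + G t k) (at t within {0..T})"
      by (intro has_vector_derivative_add has_vector_derivative_const integral_has_vector_derivative Gcont t)
    then have "((\<lambda>t. a 0 k + integral {0..t} (\<lambda>\<tau>. G \<tau> k)) has_vector_derivative G t k) (at t within {0..T})" by simp
    then show ?thesis unfolding has_vector_derivative_def by (rule has_derivative_transform[OF t, rotated]) (rule aG)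
  qed
  define Q where "Q t x = Re (ts (G t) x)" for t x
  have Pder: "((\<lambda>t. Re (ts (a t) x)) has_real_derivative Q t x) (at t within {0..T})" if t: "t \<in> {0..T}" for t x
  proof -
    have "((\<lambda>t. \<Sum>\<^sub>\<infinity>k. Re (a t k * ek k x)) has_real_derivative (\<Sum>\<^sub>\<infinity>k. Re (G t k * ek k x))) (at t within {0..T})"
    proof (rule has_real_derivative_infsum[where D = D])
      show "((\<lambda>t. Re (a t k * ek k x)) has_real_derivative Re (G t k * ek k x)) (at t within {0..T})" if "t \<in> {0..T}" for k t
        unfolding has_real_derivative_iff_has_vector_derivative
        using bounded_linear.has_vector_derivative[OF bounded_linear_compose[OF bounded_linear_Re bounded_linear_mult_left] ader[OF that], of k "ek k x"]
        by simp
      show "\<bar>Re (G t k * ek k x)\<bar> \<le> D k" if "t \<in> {0..T}" for k t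
        by (rule order_trans[OF abs_Re_le_cmod]) (use GD[OF that] in \<open>simp add: norm_mult\<close>)
      show "(\<lambda>k. Re (a t k * ek k x)) summable_on UNIV" if "t \<in> {0..T}" for t by (rule Re_ts_summable[OF al[OF that]])
    qed (use Ds t in auto)
    moreover have "(\<Sum>\<^sub>\<infinity>k. Re (G t k * ek k x)) = Q t x"
      unfolding Q_def by (rule Re_ts[symmetric], rule l1_comparison[OF GD[OF t] Ds])
    ultimately have "((\<lambda>t. \<Sum>\<^sub>\<infinity>k. Re (a t k * ek k x)) has_derivative (*) (Q t x)) (at t within {0..T})"
      unfolding has_field_derivative_def by (simp only:)
    then show ?thesis unfolding has_field_derivative_def
      by (rule has_derivative_transform[OF t, rotated]) (rule Re_ts[OF al])
  qed
  have tsG: "ts (G t) x = (\<Sum>i\<in>UNIV. ts (dk i (dk i (a t))) x)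
      + (\<Sum>i\<in>UNIV. ts (dk i (a t)) x * ts (c t i) x + ts (a t) x * ts (dk i (c t i)) x)" if t: "t \<in> {0..T}" for t x
  proof -
    note l = al[OF t] cl[OF t] dal[OF t] ddal[OF t] dcl[OF t]
    have l3: "l1 (conv (dk i (a t)) (c t i))" "l1 (conv (a t) (dk i (c t i)))" for i by (intro conv_summable(3) l)+
    have "ts (G t) x = ts (\<lambda>k. \<Sum>i\<in>UNIV. dk i (dk i (a t)) k) x + ts (\<lambda>k. \<Sum>i\<in>UNIV. conv (dk i (a t)) (c t i) k + conv (a t) (dk i (c t i)) k) x"
      unfolding G_def[abs_def] by (rule ts_add) (auto intro!: l1_sum l1_add l l3)
    also have "ts (\<lambda>k. \<Sum>i\<in>UNIV. dk i (dk i (a t)) k) x = (\<Sum>i\<in>UNIV. ts (dk i (dk i (a t))) x)"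
      by (rule ts_sum) (auto intro!: l)
    also have "ts (\<lambda>k. \<Sum>i\<in>UNIV. conv (dk i (a t)) (c t i) k + conv (a t) (dk i (c t i)) k) x
       = (\<Sum>i\<in>UNIV. ts (\<lambda>k. conv (dk i (a t)) (c t i) k + conv (a t) (dk i (c t i)) k) x)"
      by (rule ts_sum) (auto intro!: l1_add l3)
    also have "\<dots> = (\<Sum>i\<in>UNIV. ts (dk i (a t)) x * ts (c t i) x + ts (a t) x * ts (dk i (c t i)) x)"
      by (simp add: ts_add l3 ts_conv l)
    finally show ?thesis .
  qed
  \<comment> \<open>Bounds the divergence of the drift field, the zeroth order coefficient produced
    by the Leibniz rule, uniformly in time and space.\<close>
  define \<Lambda> where "\<Lambda> = real CARD('d) * (\<Sum>\<^sub>\<infinity>k. 2 * pi * M * B k)"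
  have \<Lambda>: "(\<Sum>i\<in>UNIV. Re (ts (dk i (c t i)) x)) \<le> \<Lambda>" if t: "t \<in> {0..T}" for t x
  proof -
    have "Re (ts (dk i (c t i)) x) \<le> (\<Sum>\<^sub>\<infinity>k. 2 * pi * M * B k)" for i
    proof -
      have "Re (ts (dk i (c t i)) x) \<le> (\<Sum>\<^sub>\<infinity>k. cmod (dk i (c t i) k))"
        by (rule order_trans[OF complex_Re_le_cmod norm_ts_le[OF dcl[OF t]]])
      also have "\<dots> \<le> (\<Sum>\<^sub>\<infinity>k. 2 * pi * M * B k)"
        by (rule infsum_mono[OF dcl[OF t] summable_on_cmult_right[OF Bs]]) (rule dcb[OF t])
      finally show ?thesis .
    qed
    then have "(\<Sum>i\<in>UNIV. Re (ts (dk i (c t i)) x)) \<le> (\<Sum>i\<in>(UNIV::'d set). (\<Sum>\<^sub>\<infinity>k. 2 * pi * M * B k))" by (intro sum_mono)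
    then show ?thesis by (simp add: \<Lambda>_def)
  qed
  \<comment> \<open>The \<open>+ 1\<close> makes the final comparison strict: at a negative value,
    \<open>lam\<close> times it lies strictly below \<open>\<Lambda>\<close> times it.\<close>
  define lam where "lam = \<Lambda> + 1"
  define w where "w z = exp (- lam * fst z) * Re (ts (a (fst z)) (snd z))" for z :: "real \<times> (real^'d)"
  have Pcont: "continuous_on ({0..T} \<times> UNIV) (\<lambda>z. ts (a (fst z)) (snd z))"
  proof -
    have "uniform_limit ({0..T} \<times> UNIV) (\<lambda>K z. \<Sum>k\<in>K. a (fst z) k * ek k (snd z)) (\<lambda>z. \<Sum>\<^sub>\<infinity>k. a (fst z) k * ek k (snd z)) (finite_subsets_at_top UNIV)"
      by (rule Weierstrass_m_test_general[where M = A]) (use aA As in \<open>auto simp: norm_mult\<close>)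
    then show ?thesis unfolding ts_def
      by (rule uniform_limit_theorem[rotated])
         (auto intro!: eventually_finite_subsets_at_top_weakI continuous_intros
            continuous_on_compose2[OF acont] continuous_on_compose2[OF continuous_on_ek[of UNIV]])
  qed
  have wc: "continuous_on ({0..T} \<times> cube) w"
    unfolding w_def by (intro continuous_intros continuous_on_subset[OF Pcont]) auto
  have cK: "compact ({0..T} \<times> (cube :: (real^'d) set))" by (intro compact_Times) (auto simp: cube_def)
  have neK: "{0..T} \<times> (cube :: (real^'d) set) \<noteq> {}" using t x by auto
  obtain z where z: "z \<in> {0..T} \<times> cube" "\<forall>y\<in>{0..T} \<times> cube. w z \<le> w y"
    using continuous_attains_inf[OF cK neK wc] by (elim bexE)
  obtain t0 x0 where zt: "z = (t0, x0)" by force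
  have t0: "t0 \<in> {0..T}" and x0: "x0 \<in> cube" using z(1) zt by auto
  \<comment> \<open>Periodicity extends minimality from the cube to the whole space, so a minimum on
    a face is still interior for the spatial derivatives.\<close>
  have wmin: "exp (- lam * t0) * Re (ts (a t0) x0) \<le> exp (- lam * t) * Re (ts (a t) x)"
    if "t \<in> {0..T}" for t x
  proof -
    have "w z \<le> w (t, tfrac x)" using z(2) that tfrac_in_cube by blast
    then show ?thesis by (simp add: w_def zt ts_tfrac)
  qed
  show ?thesis
  proof (rule ccontr)
    assume neg: "\<not> 0 \<le> Re (ts (a t) x)"
    have P0: "Re (ts (a t0) x0) < 0"
    proof -
      have "exp (- lam * t) * Re (ts (a t) x) < 0" using neg by (simp add: mult_less_0_iff)
      then have "exp (- lam * t0) * Re (ts (a t0) x0) < 0" using wmin[OF t, of x] by simp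
      then show ?thesis by (simp add: mult_less_0_iff)
    qed
    have t0pos: "t0 > 0" using init[OF x0] P0 t0 by (cases "t0 = 0") auto
    have spatial: "Re (ts (dk i (a t0)) x0) = 0" "0 \<le> Re (ts (dk i (dk i (a t0))) x0)" for i
    proof -
      define f where "f h = Re (ts (a t0) (x0 + h *\<^sub>R axis i 1))" for h
      define f' where "f' h = Re (ts (dk i (a t0)) (x0 + h *\<^sub>R axis i 1))" for h
      have d1: "(f has_real_derivative f' h) (at h)" for h
        unfolding f_def f'_def by (rule has_real_derivative_Re_ts_axis[OF al[OF t0] dal[OF t0]])
      have d2: "(f' has_real_derivative Re (ts (dk i (dk i (a t0))) (x0 + 0 *\<^sub>R axis i 1))) (at 0)"
        unfolding f'_def by (rule has_real_derivative_Re_ts_axis[OF dal[OF t0] ddal[OF t0]])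
      have m: "f 0 \<le> f h" for h using wmin[OF t0, of "x0 + h *\<^sub>R axis i 1"] by (simp add: f_def)
      from second_derivative_nonneg_at_min[OF d1 d2 m]
      show "Re (ts (dk i (a t0)) x0) = 0" "0 \<le> Re (ts (dk i (dk i (a t0))) x0)" by (simp_all add: f'_def)
    qed
    \<comment> \<open>Vanishing imaginary parts make the full gradient vanish at the minimum, and
      let \<open>Re\<close> factor through the product with \<open>ts (a t0) x0\<close>.\<close>
    have real1: "Im (ts (dk i (a t0)) x0) = 0" for i
      by (rule ts_real) (simp add: dk_def sym[OF t0])
    have real0: "Im (ts (a t0) x0) = 0" by (rule ts_real) (simp add: sym[OF t0])
    have "Q t0 x0 = (\<Sum>i\<in>UNIV. Re (ts (dk i (dk i (a t0))) x0)) + Re (ts (a t0) x0) * (\<Sum>i\<in>UNIV. Re (ts (dk i (c t0 i)) x0))"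
      unfolding Q_def tsG[OF t0] using spatial(1) real1 real0 by (simp add: sum_distrib_left)
    moreover have "0 \<le> (\<Sum>i\<in>UNIV. Re (ts (dk i (dk i (a t0))) x0))" by (intro sum_nonneg spatial)
    moreover have "Re (ts (a t0) x0) * \<Lambda> \<le> Re (ts (a t0) x0) * (\<Sum>i\<in>UNIV. Re (ts (dk i (c t0 i)) x0))"
      using P0 by (intro mult_left_mono_neg \<Lambda>[OF t0]) auto
    moreover have "lam * Re (ts (a t0) x0) = Re (ts (a t0) x0) * \<Lambda> + Re (ts (a t0) x0)"
      by (simp add: lam_def algebra_simps)
    ultimately have Qpos: "lam * Re (ts (a t0) x0) < Q t0 x0" using P0 by linarith
    have "((\<lambda>t. exp (- lam * t) * Re (ts (a t) x0)) has_real_derivative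
        exp (- lam * t0) * (Q t0 x0 - lam * Re (ts (a t0) x0))) (at t0 within {0..T})"
    proof -
      have "((\<lambda>t. exp (- lam * t)) has_real_derivative exp (- lam * t0) * - lam) (at t0 within {0..T})"
        by (auto intro!: derivative_eq_intros)
      from DERIV_mult[OF this Pder[OF t0, of x0]] show ?thesis by (simp add: algebra_simps)
    qed
    moreover have "0 < exp (- lam * t0) * (Q t0 x0 - lam * Re (ts (a t0) x0))" using Qpos by simp
    \<comment> \<open>The minimum may sit at \<open>t0 = T\<close>, so only earlier times are
      compared: a positive derivative gives smaller values just before \<open>t0\<close>.\<close>
    ultimately obtain \<delta> where \<delta>: "\<delta> > 0" "\<And>h. h > 0 \<Longrightarrow> t0 - h \<in> {0..T} \<Longrightarrow> h < \<delta> \<Longrightarrow>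
        exp (- lam * (t0 - h)) * Re (ts (a (t0 - h)) x0) < exp (- lam * t0) * Re (ts (a t0) x0)"
      using has_real_derivative_pos_inc_left by blast
    define h where "h = min (\<delta>/2) t0"
    have h: "h > 0" "t0 - h \<in> {0..T}" "h < \<delta>" using \<delta>(1) t0pos t0 by (auto simp: h_def min_def)
    show False using \<delta>(2)[OF h] wmin[OF h(2), of x0] by simp
  qed
qed

section \<open>A priori bounds for the nonlinear equation\<close>

definition lattice_const :: "('d::finite) itself \<Rightarrow> real \<Rightarrow> real" where
  "lattice_const (_ :: 'd itself) al = (\<Sum>\<^sub>\<infinity>k::int^'d. hw (- al) k)"

lemma lattice_const_nonneg: "0 \<le> lattice_const TYPE('d::finite) al"
  unfolding lattice_const_def by (rule infsum_nonneg) simp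

text \<open>Cauchy-Schwarz, giving \<open>c\<close> the weight \<open>hw (s/2)\<close> and leaving
  the lattice sum of order \<open>s - 2 * r\<close>. Every threshold involving \<open>d/2\<close>
  comes from its convergence.\<close>

lemma weighted_l1:
  fixes c :: "int^'d \<Rightarrow> complex"
  assumes c: "inH s c" and rs: "s - 2 * r > real CARD('d) / 2"
  shows "(\<lambda>k. hw r k * cmod (c k)) summable_on UNIV"
    "(\<Sum>\<^sub>\<infinity>k. hw r k * cmod (c k)) \<le> sqrt (lattice_const TYPE('d) (s - 2 * r)) * sqrt (Hsq s c)"
proof -
  have 1: "(hw (r - s/2) k)\<^sup>2 = hw (- (s - 2 * r)) k" for k :: "int^'d"
    by (simp add: power2_eq_square algebra_simps flip: hw_add)
  have 2: "(hw (s/2) k * cmod (c k))\<^sup>2 = hm s c k" for k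
    by (simp add: power_mult_distrib hw_half_sq)
  have 3: "hw (r - s/2) k * (hw (s/2) k * cmod (c k)) = hw r k * cmod (c k)" for k
    by (simp add: mult.assoc[symmetric] flip: hw_add)
  note cs = infsum_cauchy_schwarz[of "\<lambda>k. hw (r - s/2) k" "\<lambda>k. hw (s/2) k * cmod (c k)"]
  show "(\<lambda>k. hw r k * cmod (c k)) summable_on UNIV"
    "(\<Sum>\<^sub>\<infinity>k. hw r k * cmod (c k)) \<le> sqrt (lattice_const TYPE('d) (s - 2 * r)) * sqrt (Hsq s c)"
    using cs lattice_sum_summable[OF rs] c unfolding 1 2 3 lattice_const_def Hsq_def by auto
qed

text \<open>In Cauchy-Schwarz the square summable derivative of \<open>w\<close> replaces the
  lattice sum: no \<open>d/2\<close> is lost, and \<open>c\<close> is needed at an order one below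
  \<open>2 * r\<close>.\<close>

lemma weighted_l1_product:
  fixes w c :: "int^'d \<Rightarrow> complex"
  assumes w: "inH 1 w" and c: "inH (2 * r - 1) c"
  shows "(\<lambda>k. hw r k * cmod (w k * c k)) summable_on UNIV"
    "(\<Sum>\<^sub>\<infinity>k. hw r k * cmod (w k * c k)) \<le> sqrt (Hsq 1 w) * sqrt (Hsq (2 * r - 1) c)"
proof -
  have 1: "(hw (1/2) k * cmod (w k))\<^sup>2 = hm 1 w k" for k
    using hw_half_sq[of 1 k] by (simp add: power_mult_distrib)
  have 2: "(hw ((2 * r - 1)/2) k * cmod (c k))\<^sup>2 = hm (2 * r - 1) c k" for k
    using hw_half_sq[of "2 * r - 1" k] by (simp add: power_mult_distrib)
  have 3: "hw (1/2) k * cmod (w k) * (hw ((2 * r - 1)/2) k * cmod (c k)) = hw r k * cmod (w k * c k)" for k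
  proof -
    have "hw (1/2) k * hw ((2 * r - 1)/2) k = hw r k" by (simp add: field_simps flip: hw_add)
    then show ?thesis by (simp add: norm_mult mult_ac)
  qed
  note cs = infsum_cauchy_schwarz[of "\<lambda>k. hw (1/2) k * cmod (w k)" "\<lambda>k. hw ((2 * r - 1)/2) k * cmod (c k)"]
  show "(\<lambda>k. hw r k * cmod (w k * c k)) summable_on UNIV"
    "(\<Sum>\<^sub>\<infinity>k. hw r k * cmod (w k * c k)) \<le> sqrt (Hsq 1 w) * sqrt (Hsq (2 * r - 1) c)"
    using cs w c unfolding 1 2 3 Hsq_def by auto
qed

lemma hnorm_sq: "(hnorm s g)\<^sup>2 = Hsq s (fc g)"
  by (simp add: hnorm_def hweight_def[abs_def] Hsq_def hw_def infsum_nonneg)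

lemma hnorm_eq: "hnorm s g = sqrt (Hsq s (fc g))"
  by (simp add: hnorm_def hweight_def[abs_def] Hsq_def hw_def)

lemma in_H_iff: "in_H s g \<longleftrightarrow> in_L2 g \<and> inH s (fc g)"
  by (simp add: in_H_def hweight_def[abs_def] hw_def)

lemma in_L2H_facts:
  assumes u: "in_L2H s T u"
  shows "(\<lambda>t. fc (u t) k) \<in> borel_measurable (\<I> T)"
    and "AE t in \<I> T. in_L1 (u t) \<and> inH s (fc (u t))"
    and "(\<lambda>t. Hsq r (fc (u t))) \<in> borel_measurable (\<I> T)"
    and "r \<le> s \<Longrightarrow> integrable (\<I> T) (\<lambda>t. Hsq r (fc (u t)))"
    and "integrable (\<I> T) (\<lambda>t. fc (u t) k)"
proof -
  show m: "(\<lambda>t. fc (u t) k) \<in> borel_measurable (\<I> T)" for k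
    using u by (simp add: in_L2H_def)
  have "AE t in \<I> T. in_H s (u t)" using u by (simp add: in_L2H_def)
  then show ae: "AE t in \<I> T. in_L1 (u t) \<and> inH s (fc (u t))"
    by eventually_elim (simp add: in_H_iff in_L2_imp_in_L1)
  show mH: "(\<lambda>t. Hsq r (fc (u t))) \<in> borel_measurable (\<I> T)" for r
    unfolding Hsq_def by (rule borel_measurable_infsum) (use m in auto)
  have isT: "integrable (\<I> T) (\<lambda>t. Hsq s (fc (u t)))"
    using u by (simp add: in_L2H_def hnorm_sq)
  show "integrable (\<I> T) (\<lambda>t. Hsq r (fc (u t)))" if "r \<le> s"
    by (rule Bochner_Integration.integrable_bound[OF isT mH])
       (use ae in eventually_elim, use that in \<open>simp add: Hsq_mono\<close>)
  interpret finite_measure "\<I> T" by simp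
  show "integrable (\<I> T) (\<lambda>t. fc (u t) k)"
  proof (rule Bochner_Integration.integrable_bound[OF _ m])
    show "integrable (\<I> T) (\<lambda>t. 1 + hw (- s) k * Hsq s (fc (u t)))"
      using isT by simp
    show "AE t in \<I> T. norm (fc (u t) k) \<le> norm (1 + hw (- s) k * Hsq s (fc (u t)))"
      using ae
    proof eventually_elim
      case (elim t)
      have "(cmod (fc (u t) k))\<^sup>2 = hw (- s) k * (hm s (fc (u t)) k)"
        by (simp flip: mult.assoc hw_add)
      \<comment> \<open>A single mode is controlled by the norm, and
        \<open>2 * z \<le> 1 + z\<^sup>2\<close> trades its modulus for the integrable square on the
        bounded time interval.\<close>
      also have "\<dots> \<le> hw (- s) k * Hsq s (fc (u t))" using elim by (intro mult_left_mono inH_weight) auto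
      moreover have "2 * cmod (fc (u t) k) \<le> 1 + (cmod (fc (u t) k))\<^sup>2"
        using sum_squares_bound[of 1 "cmod (fc (u t) k)"] by simp
      ultimately have "cmod (fc (u t) k) \<le> 1 + hw (- s) k * Hsq s (fc (u t))" using norm_ge_zero[of "fc (u t) k"] by linarith
      then show ?case by simp
    qed
  qed
qed

lemma ess_bdd_by_mono: "ess_bdd_by g b \<Longrightarrow> b \<le> B \<Longrightarrow> ess_bdd_by g B"
  unfolding ess_bdd_by_def by (auto elim!: eventually_mono)

lemma ess_bdd_integrals:
  assumes "ess_bdd_by g B"
  shows "in_L2 g" "(LINT x|\<T>. (g x)\<^sup>2) \<le> B\<^sup>2" "cmod (fc g k) \<le> B"
proof -
  have m: "g \<in> borel_measurable \<T>" and ae: "AE x in \<T>. \<bar>g x\<bar> \<le> B"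
    using assms by (auto simp: ess_bdd_by_def)
  have ae2: "AE x in \<T>. (g x)\<^sup>2 \<le> B\<^sup>2"
    using ae by eventually_elim (metis abs_ge_zero power2_abs power_mono)
  have i: "integrable \<T> (\<lambda>x. (g x)\<^sup>2)"
    by (rule Bochner_Integration.integrable_bound[OF integrable_const_cube[of "B\<^sup>2"]]) (use m ae2 in auto)
  show "in_L2 g" using m i by (simp add: in_L2_def)
  have "(LINT x|\<T>. (g x)\<^sup>2) \<le> (LINT x|lebesgue_on (cube :: (real^'a) set). B\<^sup>2)"
    by (rule integral_mono_AE[OF i _ ae2]) simp
  then show "(LINT x|\<T>. (g x)\<^sup>2) \<le> B\<^sup>2" by (simp add: measure_cube)
  have "cmod (fc g k) \<le> (LINT x|\<T>. \<bar>g x\<bar>)" by (rule norm_fc_le[OF ess_bdd_in_L1[OF assms]])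
  also have "\<dots> \<le> (LINT x|lebesgue_on (cube :: (real^'a) set). B)"
    by (rule integral_mono_AE[OF _ _ ae]) (use ess_bdd_in_L1[OF assms] in \<open>auto simp: in_L1_def\<close>)
  finally show "cmod (fc g k) \<le> B" by (simp add: measure_cube)
qed

text \<open>Bessel's inequality for \<open>Wd i\<close> and for its \<open>d\<close> derivatives
  \<open>Wdd i j\<close>, each bounded by \<open>M\<close>, explains the factor
  \<open>1 + d\<close>; the derivatives dominate the weight \<open>ksq\<close> because
  \<open>4 * pi\<^sup>2 \<ge> 1\<close>.\<close>

lemma W2inf_facts:
  fixes W :: "real^'d \<Rightarrow> real"
  assumes W: "W2inf_mean0_bdd W Wd Wdd M"
  shows "ess_bdd_by (Wd i) M" "inH 1 (fc (Wd i))" "Hsq 1 (fc (Wd i)) \<le> (1 + real CARD('d)) * M\<^sup>2"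
proof -
  obtain a b c where ab: "ess_bdd_by W a" "\<And>i. ess_bdd_by (Wd i) (b i)" "\<And>i j. ess_bdd_by (Wdd i j) (c i j)"
    "a + (\<Sum>i\<in>UNIV. b i) + (\<Sum>i\<in>UNIV. \<Sum>j\<in>UNIV. c i j) \<le> M"
    using W unfolding W2inf_mean0_bdd_def by blast
  note nn = ess_bdd_by_nonneg[OF ab(1)] ess_bdd_by_nonneg[OF ab(2)] ess_bdd_by_nonneg[OF ab(3)]
  have S1: "b i \<le> (\<Sum>i\<in>UNIV. b i)" for i by (rule member_le_sum) (use nn in auto)
  have S2: "c i j \<le> (\<Sum>i\<in>UNIV. \<Sum>j\<in>UNIV. c i j)" for i j
  proof -
    have "c i j \<le> (\<Sum>j\<in>UNIV. c i j)" by (rule member_le_sum) (use nn in auto)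
    also have "\<dots> \<le> (\<Sum>i\<in>UNIV. \<Sum>j\<in>UNIV. c i j)" by (rule member_le_sum) (use nn in \<open>auto intro: sum_nonneg\<close>)
    finally show ?thesis .
  qed
  have S3: "0 \<le> (\<Sum>i\<in>UNIV. b i)" "0 \<le> (\<Sum>i\<in>UNIV. \<Sum>j\<in>UNIV. c i j)" by (auto intro!: sum_nonneg nn)
  have bM: "ess_bdd_by (Wd i) M" for i using ess_bdd_by_mono[OF ab(2)] S1[of i] S3 ab(4) nn(1) by (smt (verit))
  have cM: "ess_bdd_by (Wdd i j) M" for i j using ess_bdd_by_mono[OF ab(3)] S2[of i j] S3 ab(4) nn(1) by (smt (verit))
  show "ess_bdd_by (Wd i) M" by (rule bM)
  have dd: "fc (Wdd i j) k = dk j (fc (Wd i)) k" for i j k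
    using W by (simp add: W2inf_mean0_bdd_def weak_pd_def dk_def)
  have le: "(\<Sum>k\<in>K. hm 1 (fc (Wd i)) k) \<le> (1 + real CARD('d)) * M\<^sup>2" if K: "finite K" for K
  proof -
    have "1 \<le> pi\<^sup>2" by (rule one_le_power) (use pi_gt3 in linarith)
    then have pi1: "1 \<le> 4 * pi\<^sup>2" by linarith
    have "hm 1 (fc (Wd i)) k \<le> (cmod (fc (Wd i) k))\<^sup>2 + (\<Sum>j\<in>UNIV. (cmod (fc (Wdd i j) k))\<^sup>2)" for k
    proof -
      have "(cmod (fc (Wdd i j) k))\<^sup>2 = 4 * pi\<^sup>2 * ((real_of_int (k $ j))\<^sup>2 * (cmod (fc (Wd i) k))\<^sup>2)" for j
        by (simp add: dd dk_def norm_mult power_mult_distrib)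
      then have "(\<Sum>j\<in>UNIV. (cmod (fc (Wdd i j) k))\<^sup>2) = 4 * pi\<^sup>2 * (ksq k * (cmod (fc (Wd i) k))\<^sup>2)"
        by (simp add: ksq_def sum_distrib_left sum_distrib_right)
      moreover have "1 * (ksq k * (cmod (fc (Wd i) k))\<^sup>2) \<le> 4 * pi\<^sup>2 * (ksq k * (cmod (fc (Wd i) k))\<^sup>2)"
        by (rule mult_right_mono[OF pi1]) simp
      ultimately show ?thesis by (simp add: hw_1 distrib_right)
    qed
    then have "(\<Sum>k\<in>K. hm 1 (fc (Wd i)) k) \<le> (\<Sum>k\<in>K. (cmod (fc (Wd i) k))\<^sup>2 + (\<Sum>j\<in>UNIV. (cmod (fc (Wdd i j) k))\<^sup>2))"
      by (rule sum_mono)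
    also have "\<dots> = (\<Sum>k\<in>K. (cmod (fc (Wd i) k))\<^sup>2) + (\<Sum>j\<in>UNIV. \<Sum>k\<in>K. (cmod (fc (Wdd i j) k))\<^sup>2)"
      by (simp add: sum.distrib) (rule sum.swap)
    also have "\<dots> \<le> M\<^sup>2 + (\<Sum>j\<in>(UNIV::'d set). M\<^sup>2)"
      by (intro add_mono sum_mono order_trans[OF bessel[OF ess_bdd_integrals(1)[OF bM] K] ess_bdd_integrals(2)[OF bM]]
           order_trans[OF bessel[OF ess_bdd_integrals(1)[OF cM] K] ess_bdd_integrals(2)[OF cM]])
    finally show ?thesis by (simp add: distrib_right)
  qed
  show "inH 1 (fc (Wd i))" by (rule summable_infsum_le_of_finite_sums(1)[OF _ le]) auto
  show "Hsq 1 (fc (Wd i)) \<le> (1 + real CARD('d)) * M\<^sup>2"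
    unfolding Hsq_def by (rule summable_infsum_le_of_finite_sums(2)[OF _ le]) auto
qed

lemma inH_l1:
  fixes c :: "int^'d \<Rightarrow> complex"
  assumes "inH s c" "s > real CARD('d) / 2" shows "l1 c"
  using weighted_l1(1)[OF assms(1), of 0] assms(2) by simp

lemma l1_bounded_mult:
  assumes "l1 c" "\<And>k. cmod (w k) \<le> M" shows "l1 (\<lambda>k. w k * c k)"
proof (rule l1_comparison)
  show "cmod (w k * c k) \<le> M * cmod (c k)" for k
    unfolding norm_mult by (rule mult_right_mono[OF assms(2)]) simp
qed (rule summable_on_cmult_right[OF assms(1)])

lemma in_L1_tconv:
  assumes "ess_bdd_by g B" "in_L1 h" shows "in_L1 (tconv g h)"
  unfolding in_L1_def
  using integrable_mult_bounded[of "\<lambda>_. 1::real" "tconv g h" "B * (LINT y|\<T>. \<bar>h y\<bar>)"]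
    borel_measurable_lebesgue_on_cube[OF tconv_facts(1)[OF assms]] tconv_facts(2)[OF assms] by simp

section \<open>Positivity, mass and Sobolev bounds for a fixed solution\<close>

locale aggregation =
  fixes T M :: real and \<beta> :: nat and \<phi> W :: "real^'d \<Rightarrow> real" and Wd Wdd \<rho> vr
  assumes T0: "0 < T" and beta: "real \<beta> \<ge> 3 + real CARD('d)"
    and prob: "prob_density \<phi>" and phiH: "in_H (real \<beta>) \<phi>"
    and W: "W2inf_mean0_bdd W Wd Wdd M" and sol: "agg_diff_sol \<beta> T \<phi> Wd \<rho> vr"
begin

abbreviation "w i \<equiv> fc (Wd i)"
abbreviation "a t \<equiv> fc (\<rho> t)"
abbreviation "g t \<equiv> fc (vr t)"
abbreviation "bv t i \<equiv> tconv (Wd i) (\<rho> t)"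
abbreviation "Fl t i \<equiv> fc (\<lambda>x. \<rho> t x * bv t i x)"

lemma W_bounded: "ess_bdd_by (Wd i) M" and w_H1: "inH 1 (w i)" "Hsq 1 (w i) \<le> (1 + real CARD('d)) * M\<^sup>2"
  using W2inf_facts[OF W] by auto

lemma w_le: "cmod (w i k) \<le> M"
  by (rule ess_bdd_integrals(3)[OF W_bounded])

lemma rho_L2H: "in_L2H (real \<beta> + 1) T \<rho>" and vr_L2H: "in_L2H (real \<beta> - 1) T vr"
  and a_eq: "\<And>t k. t \<in> {0..T} \<Longrightarrow> a t k = a 0 k + (LINT \<tau>|\<I> t. g \<tau> k)"
  and a_0: "a 0 = fc \<phi>"
  using sol by (auto simp: agg_diff_sol_def in_H1H_def)

lemma phi_inH: "inH (real \<beta>) (fc \<phi>)"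
  using phiH by (simp add: in_H_iff)

lemma d_pos: "real CARD('d) > 0"
  by simp

lemma AE_rho: "AE t in \<I> T. in_L1 (\<rho> t) \<and> inH (real \<beta> + 1) (a t)"
  by (rule in_L2H_facts(2)[OF rho_L2H])

lemma a_l1: "inH (real \<beta> + 1) (a t) \<Longrightarrow> l1 (a t)"
  using beta d_pos by (intro inH_l1[of "real \<beta> + 1"]) (assumption, linarith)

text \<open>The regularity of \<open>\<rho>\<close> enters only through \<open>l1 (a t)\<close>,
  which survives multiplication by the bounded sequence \<open>w i\<close>; the product formula then
  applies to the flux.\<close>

lemma drift_product:
  assumes "in_L1 (\<rho> t)" "inH (real \<beta> + 1) (a t)"
  shows "in_L1 (bv t i)" "fc (bv t i) = (\<lambda>l. w i l * a t l)" "l1 (fc (bv t i))"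
    "((\<lambda>l. a t (k - l) * (w i l * a t l)) has_sum Fl t i k) UNIV"
    "Fl t i k = conv (a t) (\<lambda>l. w i l * a t l) k"
proof -
  show b1: "in_L1 (bv t i)" by (rule in_L1_tconv[OF W_bounded assms(1)])
  show b2: "fc (bv t i) = (\<lambda>l. w i l * a t l)" using tconv_facts(3)[OF W_bounded assms(1)] by auto
  show b3: "l1 (fc (bv t i))" unfolding b2 by (rule l1_bounded_mult[OF a_l1[OF assms(2)] w_le])
  show 1: "((\<lambda>l. a t (k - l) * (w i l * a t l)) has_sum Fl t i k) UNIV"
    using fc_product(2)[OF assms(1) b1 b3, of k] unfolding b2 .
  show "Fl t i k = conv (a t) (\<lambda>l. w i l * a t l) k"
    unfolding conv_def by (rule infsumI[symmetric, OF 1])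
qed

lemma AE_eq: "AE t in \<I> T. \<forall>k. g t k = - complex_of_real (4 * pi\<^sup>2 * ksq k) * a t k
      + (\<Sum>i\<in>UNIV. \<i> * complex_of_real (2 * pi * real_of_int (k $ i)) * Fl t i k)"
  using sol unfolding agg_diff_sol_def fc_lap_def fc_div_def by blast

text \<open>A time-independent majorant of the modes. As \<open>\<beta> - 1 \<ge> d + 2\<close>, its second moments are
  summable, so the Fourier series of \<open>\<rho>\<close> is a classical solution.\<close>

definition majorant :: "int^'d \<Rightarrow> real" where
  "majorant k = cmod (fc \<phi> k) + (LINT t|\<I> T. cmod (g t k))"

lemma a_le_majorant: "t \<in> {0..T} \<Longrightarrow> cmod (a t k) \<le> majorant k"
proof -
  assume t: "t \<in> {0..T}"
  note gi = in_L2H_facts(5)[OF vr_L2H, of k]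
  have "cmod (LINT \<tau>|\<I> t. g \<tau> k) \<le> (LINT \<tau>|\<I> t. cmod (g \<tau> k))"
    by (rule integral_norm_bound)
  also have "\<dots> = (LINT \<tau>|\<I> T. indicator {0..t} \<tau> *\<^sub>R cmod (g \<tau> k))"
    by (rule lebesgue_on_subset_integral(1)) (use t in auto)
  also have "\<dots> \<le> (LINT \<tau>|\<I> T. cmod (g \<tau> k))"
    by (rule integral_mono') (use gi in \<open>auto simp: indicator_def\<close>)
  finally show ?thesis
    unfolding a_eq[OF t] a_0 majorant_def by (intro order_trans[OF norm_triangle_ineq] add_left_mono)
qed

text \<open>The lower bound on \<open>\<beta>\<close> is spent here: after two derivatives,
  \<open>\<beta> - 1\<close> leaves at least \<open>d > d/2\<close> for the lattice sum. The
  estimate \<open>sqrt y \<le> 1 + y\<close> passes from the norm to its square, which is integrable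
  in time.\<close>

lemma majorant_summable: "(\<lambda>k. (1 + ksq k) * majorant k) summable_on UNIV"
proof -
  have 1: "(\<lambda>k. hw 1 k * cmod (fc \<phi> k)) summable_on UNIV"
    by (rule weighted_l1(1)[OF phi_inH]) (use beta d_pos in linarith)
  have b: "(real \<beta> - 1) - 2 * 1 > real CARD('d) / 2" using beta d_pos by linarith
  define L where "L = sqrt (lattice_const TYPE('d) ((real \<beta> - 1) - 2 * 1))"
  have L0: "0 \<le> L" by (simp add: L_def lattice_const_nonneg)
  note gi = in_L2H_facts(5)[OF vr_L2H]
  interpret finite_measure "\<I> T" by simp
  have iR: "integrable (\<I> T) (\<lambda>t. L * (1 + Hsq (real \<beta> - 1) (g t)))"
    using in_L2H_facts(4)[OF vr_L2H order_refl] by simp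
  have 2: "(\<lambda>k. hw 1 k * (LINT t|\<I> T. cmod (g t k))) summable_on UNIV"
  proof (rule summable_infsum_le_of_finite_sums(1))
    fix K :: "(int^'d) set" assume K: "finite K"
    have "(\<Sum>k\<in>K. hw 1 k * (LINT t|\<I> T. cmod (g t k)))
        = (LINT t|\<I> T. (\<Sum>k\<in>K. hw 1 k * cmod (g t k)))" using gi by simp
    also have "\<dots> \<le> (LINT t|\<I> T. L * (1 + Hsq (real \<beta> - 1) (g t)))"
    proof (rule integral_mono_AE[OF _ iR])
      show "integrable (\<I> T) (\<lambda>t. \<Sum>k\<in>K. hw 1 k * cmod (g t k))" using gi by simp
      show "AE t in \<I> T. (\<Sum>k\<in>K. hw 1 k * cmod (g t k)) \<le> L * (1 + Hsq (real \<beta> - 1) (g t))"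
        using in_L2H_facts(2)[OF vr_L2H]
      proof eventually_elim
        case (elim t)
        then have gH: "inH (real \<beta> - 1) (g t)" by simp
        have "(\<Sum>k\<in>K. hw 1 k * cmod (g t k)) \<le> (\<Sum>\<^sub>\<infinity>k. hw 1 k * cmod (g t k))"
          by (rule finite_sum_le_infsum[OF weighted_l1(1)[OF gH b] K]) auto
        also have "\<dots> \<le> L * sqrt (Hsq (real \<beta> - 1) (g t))" unfolding L_def by (rule weighted_l1(2)[OF gH b])
        also have "\<dots> \<le> L * (1 + Hsq (real \<beta> - 1) (g t))"
        proof (rule mult_left_mono[OF _ L0])
          show "sqrt (Hsq (real \<beta> - 1) (g t)) \<le> 1 + Hsq (real \<beta> - 1) (g t)"
            by (rule real_le_lsqrt) (auto simp: power2_eq_square algebra_simps)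
        qed
        finally show ?case .
      qed
    qed
    finally show "(\<Sum>k\<in>K. hw 1 k * (LINT t|\<I> T. cmod (g t k))) \<le> (LINT t|\<I> T. L * (1 + Hsq (real \<beta> - 1) (g t)))" .
  qed auto
  show ?thesis using summable_on_add[OF 1 2] by (simp add: majorant_def hw_1 distrib_left)
qed

text \<open>The density is nonnegative only almost everywhere, but its series is continuous: the set
  where it is negative inside the cube is open and negligible, hence empty, and the closure adds the
  faces.\<close>

lemma phi_ts_nonneg:
  assumes x: "x \<in> cube" shows "0 \<le> Re (ts (fc \<phi>) x)"
proof -
  have l: "l1 (fc \<phi>)" by (rule inH_l1[OF phi_inH]) (use beta d_pos in linarith)
  have cont: "continuous_on S (\<lambda>x. Re (ts (fc \<phi>) x))" for S
    by (intro continuous_on_Re continuous_on_subset[OF continuous_on_ts[OF l]]) auto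
  have "AE x in \<T>. 0 \<le> Re (ts (fc \<phi>) x)"
  proof -
    have "in_L1 \<phi>" and "AE x in \<T>. 0 \<le> \<phi> x" using prob by (simp_all add: prob_density_def in_L1_def)
    from fourier_inversion[OF this(1) l] this(2) show ?thesis
    proof eventually_elim
      case (elim x)
      then show ?case by (metis Re_complex_of_real)
    qed
  qed
  then have ae: "AE x in lebesgue. x \<in> cube \<longrightarrow> 0 \<le> Re (ts (fc \<phi>) x)"
    by (subst (asm) AE_restrict_space_iff) auto
  define U where "U = box 0 One \<inter> {x. Re (ts (fc \<phi>) x) < 0}"
  have oU: "open U" unfolding U_def by (intro open_Int open_box open_Collect_less cont continuous_intros)
  have sub: "box 0 (One :: real^'d) \<subseteq> cube" by (auto simp: mem_cube mem_box_open_cube less_imp_le)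
  have "negligible U"
  proof -
    obtain N where N: "N \<in> null_sets lebesgue" "{x \<in> space lebesgue. \<not> (x \<in> cube \<longrightarrow> 0 \<le> Re (ts (fc \<phi>) x))} \<subseteq> N"
      using ae unfolding eventually_ae_filter by blast
    then have "U \<subseteq> N" using sub by (auto simp: U_def)
    then show ?thesis using N(1) by (meson negligible_iff_null_sets negligible_subset)
  qed
  then have "U = {}" using open_not_negligible[OF oU] by auto
  then have box: "0 \<le> Re (ts (fc \<phi>) x)" if "x \<in> box 0 One" for x using that by (force simp: U_def)
  have "(1/2) *\<^sub>R One \<in> box 0 (One :: real^'d)" by (simp add: mem_box_open_cube)
  then have "closure (box 0 (One :: real^'d)) = cube" unfolding cube_def by (intro closure_box) auto
  then show ?thesis using continuous_ge_on_closure[OF cont, of x "box 0 One" 0] box x by auto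
qed

lemma rho_nonneg:
  assumes "t \<in> {0..T}" "x \<in> cube" shows "0 \<le> Re (ts (a t) x)"
proof (rule minimum_principle[OF T0 majorant_summable a_le_majorant w_le _ in_L2H_facts(5)[OF vr_L2H] a_eq _ _ assms])
  show "AE t in \<I> T. \<forall>k. g t k = - complex_of_real (4 * pi\<^sup>2 * ksq k) * a t k
      + (\<Sum>i\<in>UNIV. dk i (conv (a t) (\<lambda>l. w i l * a t l)) k)"
    using AE_eq AE_rho
  proof eventually_elim
    case (elim t)
    then show ?case using drift_product(5)[of t] by (simp add: dk_def)
  qed
qed (auto simp: fc_uminus a_0 phi_ts_nonneg)

text \<open>In divergence form both the Laplacian and the drift have no mode \<open>k = 0\<close>,
  so that mode keeps its initial value, the integral of \<open>\<phi>\<close>.\<close>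

lemma mass_one: "t \<in> {0..T} \<Longrightarrow> a t 0 = 1"
proof -
  assume t: "t \<in> {0..T}"
  have "AE \<tau> in \<I> T. g \<tau> 0 = 0"
    using AE_eq
  proof eventually_elim
    case (elim \<tau>)
    then show ?case using elim[rule_format, of 0] by (simp add: ksq_def)
  qed
  then have "AE \<tau> in \<I> t. g \<tau> 0 = 0"
    by (rule AE_lebesgue_on_subset) (use t in auto)
  then have "(LINT \<tau>|\<I> t. g \<tau> 0) = 0" by (rule integral_eq_zero_AE)
  moreover have "fc \<phi> 0 = 1"
    using prob unfolding fc_eq prob_density_def by simp
  ultimately show ?thesis using a_eq[OF t, of 0] by (simp add: a_0)
qed

text \<open>Positivity and conservation of mass give \<open>\<parallel>\<rho>(t)\<parallel> = 1\<close> in \<open>L\<^sup>1\<close>; without this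
  the quadratic drift would only allow a bound that is local in time.\<close>

lemma AE_drift_le: "AE t in \<I> T. \<forall>i x. \<bar>bv t i x\<bar> \<le> M"
  using AE_rho AE_space
proof eventually_elim
  case (elim t)
  then have L: "in_L1 (\<rho> t)" and l: "l1 (a t)" and t: "t \<in> {0..T}" by (auto intro: a_l1)
  have "AE x in \<T>. \<bar>\<rho> t x\<bar> = \<rho> t x"
    using fourier_inversion[OF L l] AE_space
  proof eventually_elim
    case (elim x)
    then have "\<rho> t x = Re (ts (a t) x)" by (metis Re_complex_of_real)
    then show ?case using rho_nonneg[OF t, of x] elim by simp
  qed
  then have "(LINT x|\<T>. \<bar>\<rho> t x\<bar>) = (LINT x|\<T>. \<rho> t x)"
    using L by (intro integral_cong_AE) (auto simp: in_L1_def)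
  moreover have "complex_of_real (LINT x|\<T>. \<rho> t x) = 1"
    using mass_one[OF t] by (simp add: fc_eq)
  ultimately have "(LINT x|\<T>. \<bar>\<rho> t x\<bar>) = 1" by simp
  then show ?case using tconv_facts(2)[OF W_bounded L] by simp
qed

end

text \<open>Gronwall constants for the squared \<open>H\<^sup>m\<close> norms of \<open>\<rho>\<close>, where \<open>r\<close> bounds those of the initial
  datum. The constant of level \<open>m + 1\<close> only involves level \<open>m\<close>, because the Fourier coefficients of
  \<open>\<nabla>W * \<rho>\<close> gain one square summable derivative from \<open>\<nabla>W\<close>.\<close>

primrec sobolev_bound :: "real \<Rightarrow> real \<Rightarrow> real \<Rightarrow> real \<Rightarrow> nat \<Rightarrow> real" where
  "sobolev_bound d T M r 0 = r * exp ((3 + d * M\<^sup>2) * T)"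
| "sobolev_bound d T M r (Suc m) =
     r * exp ((3 + d * (2 powr real (Suc m) * ((1 + d) * M\<^sup>2 * sobolev_bound d T M r m))) * T)"

lemma Hsq_zero [simp]: "Hsq s (\<lambda>k. 0) = 0"
  by (simp add: Hsq_def)

context aggregation
begin

text \<open>The energy estimate without source. The condition \<open>s \<le> \<beta>\<close> keeps
  the dissipation order \<open>s + 1\<close> within the given regularity of
  \<open>\<rho>\<close>.\<close>

lemma sobolev_step:
  assumes s: "s \<le> real \<beta>" and B: "0 \<le> B" and t: "t \<in> {0..T}"
    and Fb: "AE t in \<I> T. \<forall>K. finite K \<longrightarrow>
      (\<Sum>k\<in>K. hw s k * (\<Sum>i\<in>UNIV. (cmod (Fl t i k))\<^sup>2)) \<le> B * Hsq s (a t)"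
  shows "inH s (a t)" "Hsq s (a t) \<le> Hsq s (fc \<phi>) * exp ((3 + B) * T)"
proof -
  have a0: "inH s (a 0)" unfolding a_0 by (rule inH_mono[OF phi_inH s])
  have eq: "AE t in \<I> T. \<forall>k. g t k = - complex_of_real (4 * pi\<^sup>2 * ksq k) * a t k
      + (\<Sum>i\<in>UNIV. \<i> * complex_of_real (2 * pi * real_of_int (k $ i)) * Fl t i k) + (\<lambda>t k. 0) t k"
    using AE_eq by simp
  have sa: "AE t in \<I> T. inH (s + 1) (a t)"
    using AE_rho by eventually_elim (use s in \<open>auto intro: inH_mono\<close>)
  have yi: "integrable (\<I> T) (\<lambda>t. Hsq s (a t))" "integrable (\<I> T) (\<lambda>t. Hsq (s + 1) (a t))"
    by (rule in_L2H_facts(4)[OF rho_L2H], use s in simp)+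
  note ee = energy_estimate[where F = "\<lambda>t. Fl t" and h = "\<lambda>t k. 0" and g = "\<lambda>t. g t" and a = "\<lambda>t. a t",
      OF T0 B in_L2H_facts(5)[OF vr_L2H] a_eq eq Fb sa yi _ _ a0]
  show "inH s (a t)" by (rule ee(1)[OF _ _ _ t]) auto
  have "Hsq s (a t) \<le> (Hsq s (a 0) + (LINT t|\<I> T. Hsq (s - 1) (\<lambda>k::int^'d. 0))) * exp ((3 + B) * t)"
    by (rule ee(2)[OF _ _ _ t]) auto
  also have "\<dots> = Hsq s (fc \<phi>) * exp ((3 + B) * t)" by (simp add: a_0)
  also have "\<dots> \<le> Hsq s (fc \<phi>) * exp ((3 + B) * T)"
    using t B by (intro mult_left_mono) auto
  finally show "Hsq s (a t) \<le> Hsq s (fc \<phi>) * exp ((3 + B) * T)" .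
qed

text \<open>Start of the induction: the uniform drift bound makes the flux constant independent of
  \<open>\<rho>\<close>, so no norm of \<open>\<rho>\<close> from a lower level is required.\<close>

lemma flux_L2_bound:
  "AE t in \<I> T. \<forall>K. finite K \<longrightarrow>
      (\<Sum>k\<in>K. hw 0 k * (\<Sum>i\<in>UNIV. (cmod (Fl t i k))\<^sup>2)) \<le> (real CARD('d) * M\<^sup>2) * Hsq 0 (a t)"
  using AE_rho AE_drift_le
proof eventually_elim
  case (elim t)
  then have L: "in_L1 (\<rho> t)" and l: "l1 (a t)" and bM: "\<And>i x. \<bar>bv t i x\<bar> \<le> M" by (auto intro: a_l1)
  note P = parseval[OF L l]
  have R2: "(LINT x|\<T>. (\<rho> t x)\<^sup>2) = Hsq 0 (a t)"
    using infsumI[OF P(2)] by (simp add: Hsq_def)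
  have i: "integrable \<T> (\<lambda>x. M\<^sup>2 * (\<rho> t x)\<^sup>2)" using P(1) by (simp add: in_L2_def)
  have le: "(\<rho> t x * bv t i x)\<^sup>2 \<le> M\<^sup>2 * (\<rho> t x)\<^sup>2" for i x
  proof -
    have "(bv t i x)\<^sup>2 \<le> M\<^sup>2" using power_mono[OF bM[of i x], of 2] by simp
    then show ?thesis by (simp add: power_mult_distrib mult.commute[of "M\<^sup>2"] mult_left_mono)
  qed
  have "(\<Sum>k\<in>K. (cmod (Fl t i k))\<^sup>2) \<le> M\<^sup>2 * Hsq 0 (a t)" if K: "finite K" for K i
  proof -
    have m: "(\<lambda>x. \<rho> t x * bv t i x) \<in> borel_measurable \<T>"
      using drift_product(1)[of t i] L elim by (auto simp: in_L1_def)
    have i2: "integrable \<T> (\<lambda>x. (\<rho> t x * bv t i x)\<^sup>2)"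
      by (rule Bochner_Integration.integrable_bound[OF i]) (use m le in auto)
    have "in_L2 (\<lambda>x. \<rho> t x * bv t i x)" using m i2 by (simp add: in_L2_def)
    then have "(\<Sum>k\<in>K. (cmod (Fl t i k))\<^sup>2) \<le> (LINT x|\<T>. (\<rho> t x * bv t i x)\<^sup>2)" by (rule bessel[OF _ K])
    also have "\<dots> \<le> (LINT x|\<T>. M\<^sup>2 * (\<rho> t x)\<^sup>2)" by (rule integral_mono[OF i2 i]) (rule le)
    finally show ?thesis by (simp add: R2)
  qed
  then have "(\<Sum>i\<in>UNIV. \<Sum>k\<in>K. (cmod (Fl t i k))\<^sup>2) \<le> (\<Sum>i\<in>(UNIV::'d set). M\<^sup>2 * Hsq 0 (a t))" if "finite K" for K
    using that by (intro sum_mono)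
  then show ?case
    by (simp add: sum.swap[of _ "UNIV :: 'd set"] mult.assoc)
qed

lemma drift_weighted:
  assumes t: "inH (2 * r - 1) (a t)"
  shows "(\<lambda>k. hw r k * cmod (w i k * a t k)) summable_on UNIV"
    "(\<Sum>\<^sub>\<infinity>k. hw r k * cmod (w i k * a t k))\<^sup>2 \<le> (1 + real CARD('d)) * M\<^sup>2 * Hsq (2 * r - 1) (a t)"
proof -
  note wp = weighted_l1_product[OF w_H1(1) t]
  show "(\<lambda>k. hw r k * cmod (w i k * a t k)) summable_on UNIV" by (rule wp(1))
  have "(\<Sum>\<^sub>\<infinity>k. hw r k * cmod (w i k * a t k))\<^sup>2 \<le> (sqrt (Hsq 1 (w i)) * sqrt (Hsq (2 * r - 1) (a t)))\<^sup>2"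
    by (intro power_mono wp(2) infsum_nonneg) simp
  also have "\<dots> = Hsq 1 (w i) * Hsq (2 * r - 1) (a t)" by (simp add: power_mult_distrib)
  also have "\<dots> \<le> (1 + real CARD('d)) * M\<^sup>2 * Hsq (2 * r - 1) (a t)"
    by (intro mult_right_mono w_H1(2)) simp
  finally show "(\<Sum>\<^sub>\<infinity>k. hw r k * cmod (w i k * a t k))\<^sup>2 \<le> (1 + real CARD('d)) * M\<^sup>2 * Hsq (2 * r - 1) (a t)" .
qed

text \<open>One factor of the flux carries the whole order \<open>m + 1\<close>, the drift costs
  only order \<open>m\<close>, bounded by the induction hypothesis; Gronwall's inequality is thus
  linear in the unknown norm. The same \<open>r\<close> serves at every level because the norms of
  \<open>\<phi>\<close> increase with the order.\<close>

lemma rho_sobolev_bound: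
  assumes kk: "kk \<le> \<beta>" and r: "Hsq (real kk) (fc \<phi>) \<le> r"
  shows "m \<le> kk \<Longrightarrow> \<forall>t\<in>{0..T}. inH (real m) (a t) \<and> Hsq (real m) (a t) \<le> sobolev_bound (real CARD('d)) T M r m"
proof (induction m)
  case 0
  have "Hsq 0 (fc \<phi>) \<le> r"
    using order_trans[OF Hsq_mono[OF inH_mono[OF phi_inH], of "real kk" 0] r] kk by simp
  then have "Hsq 0 (fc \<phi>) * exp ((3 + real CARD('d) * M\<^sup>2) * T) \<le> r * exp ((3 + real CARD('d) * M\<^sup>2) * T)"
    by (intro mult_right_mono) auto
  moreover have "inH 0 (a t) \<and> Hsq 0 (a t) \<le> Hsq 0 (fc \<phi>) * exp ((3 + real CARD('d) * M\<^sup>2) * T)" if "t \<in> {0..T}" for t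
    using sobolev_step[OF _ _ that flux_L2_bound] by simp
  ultimately show ?case unfolding of_nat_0 sobolev_bound.simps by (meson order_trans)
next
  case (Suc m)
  let ?R = "sobolev_bound (real CARD('d)) T M r m"
  define B where "B = real CARD('d) * (2 powr real (Suc m) * ((1 + real CARD('d)) * M\<^sup>2 * ?R))"
  have IH: "inH (real m) (a t)" "Hsq (real m) (a t) \<le> ?R" if "t \<in> {0..T}" for t
    using Suc that by auto
  have R0: "0 \<le> ?R" using order_trans[OF Hsq_nonneg IH(2)[of 0]] T0 by simp
  have B0: "0 \<le> B" unfolding B_def using R0 by (intro mult_nonneg_nonneg) auto
  have Fb: "AE t in \<I> T. \<forall>K. finite K \<longrightarrow>
      (\<Sum>k\<in>K. hw (real (Suc m)) k * (\<Sum>i\<in>UNIV. (cmod (Fl t i k))\<^sup>2)) \<le> B * Hsq (real (Suc m)) (a t)"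
    using AE_rho AE_space
  proof eventually_elim
    case (elim t)
    then have t: "t \<in> {0..T}" and L: "in_L1 (\<rho> t)" and H: "inH (real \<beta> + 1) (a t)" by auto
    have Hm: "inH (real (Suc m)) (a t)" by (rule inH_mono[OF H]) (use Suc.prems kk in simp)
    \<comment> \<open>Half the order is the weight on moduli of coefficients; the derivative taken
      from the gradient of \<open>W\<close> brings the requirement down to exactly the previous
      level.\<close>
    have r2: "2 * (\<bar>real (Suc m)\<bar>/2) - 1 = real m" by (simp add: field_simps)
    have one: "(\<Sum>k\<in>K. hw (real (Suc m)) k * (cmod (Fl t i k))\<^sup>2)
        \<le> 2 powr real (Suc m) * ((1 + real CARD('d)) * M\<^sup>2 * ?R) * Hsq (real (Suc m)) (a t)" if K: "finite K" for K i
    proof -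
      have dw: "(\<lambda>k. hw (\<bar>real (Suc m)\<bar>/2) k * cmod (w i k * a t k)) summable_on UNIV"
        "(\<Sum>\<^sub>\<infinity>k. hw (\<bar>real (Suc m)\<bar>/2) k * cmod (w i k * a t k))\<^sup>2 \<le> (1 + real CARD('d)) * M\<^sup>2 * Hsq (real m) (a t)"
        using drift_weighted[of "\<bar>real (Suc m)\<bar>/2" t i] IH(1)[OF t] unfolding r2 by auto
      have "(\<Sum>k\<in>K. hw (real (Suc m)) k * (cmod (Fl t i k))\<^sup>2)
        \<le> 2 powr \<bar>real (Suc m)\<bar> * (\<Sum>\<^sub>\<infinity>l. hw (\<bar>real (Suc m)\<bar>/2) l * cmod (w i l * a t l))\<^sup>2 * (\<Sum>\<^sub>\<infinity>k. hw (real (Suc m)) k * (cmod (a t k))\<^sup>2)"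
        by (rule weighted_convolution[OF drift_product(4)[OF L H] Hm dw(1) K])
      also have "\<dots> \<le> 2 powr \<bar>real (Suc m)\<bar> * ((1 + real CARD('d)) * M\<^sup>2 * ?R) * Hsq (real (Suc m)) (a t)"
        unfolding Hsq_def[of "real (Suc m)", symmetric]
        by (intro mult_right_mono mult_left_mono order_trans[OF dw(2)] IH(2)[OF t]) auto
      finally show ?thesis by simp
    qed
    show ?case
    proof (intro allI impI)
      fix K :: "(int^'d) set" assume K: "finite K"
      have "(\<Sum>k\<in>K. hw (real (Suc m)) k * (\<Sum>i\<in>UNIV. (cmod (Fl t i k))\<^sup>2))
         = (\<Sum>i\<in>UNIV. \<Sum>k\<in>K. hw (real (Suc m)) k * (cmod (Fl t i k))\<^sup>2)"
        unfolding sum_distrib_left by (rule sum.swap)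
      also have "\<dots> \<le> (\<Sum>i\<in>(UNIV::'d set). 2 powr real (Suc m) * ((1 + real CARD('d)) * M\<^sup>2 * ?R) * Hsq (real (Suc m)) (a t))"
        by (intro sum_mono one K)
      also have "\<dots> = B * Hsq (real (Suc m)) (a t)" by (simp add: B_def)
      finally show "(\<Sum>k\<in>K. hw (real (Suc m)) k * (\<Sum>i\<in>UNIV. (cmod (Fl t i k))\<^sup>2)) \<le> B * Hsq (real (Suc m)) (a t)" .
    qed
  qed
  have "Hsq (real (Suc m)) (fc \<phi>) \<le> r"
    by (rule order_trans[OF Hsq_mono r]) (use Suc.prems kk in \<open>auto intro: inH_mono[OF phi_inH]\<close>)
  then have "Hsq (real (Suc m)) (fc \<phi>) * exp ((3 + B) * T) \<le> r * exp ((3 + B) * T)"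
    by (intro mult_right_mono) auto
  moreover have "sobolev_bound (real CARD('d)) T M r (Suc m) = r * exp ((3 + B) * T)" by (simp add: B_def)
  moreover have "inH (real (Suc m)) (a t) \<and> Hsq (real (Suc m)) (a t) \<le> Hsq (real (Suc m)) (fc \<phi>) * exp ((3 + B) * T)"
    if "t \<in> {0..T}" for t
    using sobolev_step[OF _ B0 that Fb] Suc.prems kk by simp
  ultimately show ?case by (simp only:) (meson order_trans)
qed

end

section \<open>The linearised equation\<close>

text \<open>The factor with which the squared \<open>H\<^sup>1\<^sup>-\<^sup>s\<close> norm of \<open>u\<close> controls that of the flux
  \<open>u (\<nabla>W * \<rho>) + \<rho> (\<nabla>W * u)\<close>: in both products \<open>u\<close> carries the negative norm, and the
  other factor enters through an \<open>l\<^sup>1\<close> norm of its coefficients with weight \<open>|k|\<^sup>s\<^sup>-\<^sup>1\<close>.\<close>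

definition flux_const :: "real \<Rightarrow> real \<Rightarrow> real \<Rightarrow> real \<Rightarrow> real \<Rightarrow> real" where
  "flux_const d M L s R = d * (2 * (2 powr \<bar>1 - s\<bar> * ((1 + d) * M\<^sup>2 * R)) + 2 * (2 powr \<bar>1 - s\<bar> * (L * R) * M\<^sup>2))"

lemma cmod_add_sq_le: "(cmod (x + y))\<^sup>2 \<le> 2 * (cmod x)\<^sup>2 + 2 * (cmod y)\<^sup>2"
proof -
  have "(cmod (x + y))\<^sup>2 \<le> (cmod x + cmod y)\<^sup>2" by (intro power_mono norm_triangle_ineq) simp
  also have "\<dots> \<le> 2 * (cmod x)\<^sup>2 + 2 * (cmod y)\<^sup>2"
    using sum_squares_bound[of "cmod x" "cmod y"] by (simp add: power2_sum)
  finally show ?thesis .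
qed

lemma cmod_add3_sq_le: "(cmod (x + y + z))\<^sup>2 \<le> 3 * ((cmod x)\<^sup>2 + (cmod y)\<^sup>2 + (cmod z)\<^sup>2)"
proof -
  have "(cmod (x + y + z))\<^sup>2 \<le> (cmod x + cmod y + cmod z)\<^sup>2"
    by (intro power_mono order_trans[OF norm_triangle_ineq add_right_mono] norm_triangle_ineq) simp
  also have "\<dots> \<le> 3 * ((cmod x)\<^sup>2 + (cmod y)\<^sup>2 + (cmod z)\<^sup>2)"
    using sum_squares_bound[of "cmod x" "cmod y"] sum_squares_bound[of "cmod x" "cmod z"] sum_squares_bound[of "cmod y" "cmod z"]
    by (simp add: power2_eq_square algebra_simps)
  finally show ?thesis .
qed

context aggregation
begin

text \<open>Energy order \<open>1 - s\<close> is dictated by the source: it is measured one order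
  below, at \<open>- s\<close>, and the dissipation lives one order above, at \<open>2 - s\<close>.
  \<open>C1\<close> is the Gronwall factor, \<open>C2\<close> comes from the dissipation after
  integrating the \<open>C1\<close> bound over a time of length \<open>T\<close>, \<open>C3\<close>
  from solving the equation for the time derivative.\<close>

lemma linear_estimate:
  assumes s: "1 \<le> s" and kk: "kk \<le> \<beta>" and kks: "real kk > s - 1 + real CARD('d) / 2"
    and Hphi: "Hsq (real kk) (fc \<phi>) \<le> r"
    and f: "in_L2H 0 T f" and lin: "lin_sol T Wd \<rho> f u v"
  defines "R \<equiv> sobolev_bound (real CARD('d)) T M r kk"
  defines "B \<equiv> flux_const (real CARD('d)) M (lattice_const TYPE('d) (real kk - (s - 1))) s R"
  defines "N \<equiv> LINT t|\<I> T. Hsq (- s) (fc (f t))"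
  defines "C1 \<equiv> exp ((3 + B) * T)"
  defines "C2 \<equiv> 1 + (3 + B) * (T * C1)"
  defines "C3 \<equiv> 3 * (16 * pi ^ 4 * C2 + 4 * pi\<^sup>2 * B * (T * C1) + 1)"
  shows "\<And>t. t \<in> {0..T} \<Longrightarrow> Hsq (1 - s) (fc (u t)) \<le> C1 * N"
    and "(LINT t|\<I> T. Hsq (2 - s) (fc (u t))) \<le> C2 * N"
    and "(LINT t|\<I> T. Hsq (- s) (fc (v t))) \<le> C3 * N"
proof -
  let ?L = "lattice_const TYPE('d) (real kk - (s - 1))"
  let ?u = "\<lambda>t. fc (u t)"
  let ?Fu = "\<lambda>t i. fc (\<lambda>x. u t x * bv t i x + \<rho> t x * tconv (Wd i) (u t) x)"
  have u2: "in_L2H 2 T u" and v0: "in_L2H 0 T v" and u0: "\<And>k. ?u 0 k = 0"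
    and ueq: "\<And>t k. t \<in> {0..T} \<Longrightarrow> ?u t k = ?u 0 k + (LINT \<tau>|\<I> t. fc (v \<tau>) k)"
    using lin by (auto simp: lin_sol_def in_H1H_def)
  have eq: "AE t in \<I> T. \<forall>k. fc (v t) k = - complex_of_real (4 * pi\<^sup>2 * ksq k) * ?u t k
      + (\<Sum>i\<in>UNIV. \<i> * complex_of_real (2 * pi * real_of_int (k $ i)) * ?Fu t i k) + fc (f t) k"
    using lin unfolding lin_sol_def fc_lap_def fc_div_def by blast
  have aR: "inH (real kk) (a t)" "Hsq (real kk) (a t) \<le> R" if "t \<in> {0..T}" for t
    using rho_sobolev_bound[OF kk Hphi, of kk] that by (auto simp: R_def)
  have R0: "0 \<le> R" using order_trans[OF Hsq_nonneg aR(2)[of 0]] T0 by simp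
  have L0: "0 \<le> ?L" by (rule lattice_const_nonneg)
  have B0: "0 \<le> B" unfolding B_def flux_const_def using R0 L0
    by (intro mult_nonneg_nonneg add_nonneg_nonneg) auto
  have Fb: "AE t in \<I> T. \<forall>K. finite K \<longrightarrow>
      (\<Sum>k\<in>K. hw (1 - s) k * (\<Sum>i\<in>UNIV. (cmod (?Fu t i k))\<^sup>2)) \<le> B * Hsq (1 - s) (?u t)"
    using AE_rho in_L2H_facts(2)[OF u2] AE_space
  proof eventually_elim
    case (elim t)
    then have t: "t \<in> {0..T}" and L: "in_L1 (\<rho> t)" and H: "inH (real \<beta> + 1) (a t)"
      and Lu: "in_L1 (u t)" and Hu2: "inH 2 (?u t)" by auto
    have Hu: "inH (1 - s) (?u t)" by (rule inH_mono[OF Hu2]) (use s in simp)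
    \<comment> \<open>Here \<open>q = (s - 1) / 2\<close>, the weight that a multiplier on order
      \<open>1 - s\<close> must carry. For the drift of \<open>\<rho>\<close> this requires order
      \<open>s - 2\<close> of \<open>\<rho>\<close>; for \<open>\<rho>\<close> itself the excess
      \<open>kk - (s - 1)\<close> has to beat \<open>d/2\<close>.\<close>
    define q where "q = \<bar>1 - s\<bar>/2"
    have q: "2 * q - 1 = s - 2" "real kk - 2 * q = real kk - (s - 1)" using s by (simp_all add: q_def field_simps)
    have aq: "inH (2 * q - 1) (a t)" unfolding q by (rule inH_mono[OF aR(1)[OF t]]) (use kks in \<open>simp add: field_simps\<close>)
    let ?F1 = "\<lambda>i. fc (\<lambda>x. u t x * bv t i x)"
    let ?F2 = "\<lambda>i. fc (\<lambda>x. \<rho> t x * tconv (Wd i) (u t) x)"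
    let ?wu = "\<lambda>i l. w i l * ?u t l"
    have F1: "in_L1 (\<lambda>x. u t x * bv t i x)"
      "((\<lambda>l. ?u t (k - l) * (w i l * a t l)) has_sum ?F1 i k) UNIV" for i k
      using fc_product[OF Lu drift_product(1)[OF L H] drift_product(3)[OF L H]] unfolding drift_product(2)[OF L H] by auto
    have tu: "in_L1 (tconv (Wd i) (u t))" "fc (tconv (Wd i) (u t)) = (?wu i)" for i
      using in_L1_tconv[OF W_bounded Lu] tconv_facts(3)[OF W_bounded Lu] by auto
    have F2: "in_L1 (\<lambda>x. \<rho> t x * tconv (Wd i) (u t) x)"
      "((\<lambda>l. (w i (k - l) * ?u t (k - l)) * a t l) has_sum ?F2 i k) UNIV" for i k
      using fc_product[OF tu(1) L a_l1[OF H]] unfolding tu(2) by (auto simp: mult.commute)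
    \<comment> \<open>In the second product the rough factor is the drift generated by
      \<open>u\<close>; since \<open>cmod (w i k) \<le> M\<close>, it is no rougher than
      \<open>u\<close>, and \<open>\<rho>\<close> acts as the multiplier.\<close>
    have wu: "inH (1 - s) (?wu i)" "Hsq (1 - s) (?wu i) \<le> M\<^sup>2 * Hsq (1 - s) (?u t)" for i
    proof -
      have le: "hw (1 - s) k * (cmod (w i k * ?u t k))\<^sup>2 \<le> M\<^sup>2 * (hm (1 - s) (?u t) k)" for k
      proof -
        have "(cmod (w i k))\<^sup>2 * (hm (1 - s) (?u t) k) \<le> M\<^sup>2 * (hm (1 - s) (?u t) k)"
          by (intro mult_right_mono power_mono w_le) auto
        then show ?thesis by (simp add: norm_mult power_mult_distrib mult_ac)
      qed
      have sm: "(\<lambda>k. M\<^sup>2 * (hm (1 - s) (?u t) k)) summable_on UNIV" by (rule summable_on_cmult_right[OF Hu])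
      show 1: "inH (1 - s) (?wu i)" by (rule summable_on_comparison_test[OF sm le]) auto
      show "Hsq (1 - s) (?wu i) \<le> M\<^sup>2 * Hsq (1 - s) (?u t)"
        using infsum_mono[OF 1 sm le] by (simp add: Hsq_def infsum_cmult_right')
    qed
    note wl = weighted_l1[OF aR(1)[OF t], of q, unfolded q(2)]
    have kl: "real kk - (s - 1) > real CARD('d) / 2" using kks by simp
    have al: "(\<Sum>\<^sub>\<infinity>k. hw q k * cmod (a t k))\<^sup>2 \<le> ?L * R"
    proof -
      have "(\<Sum>\<^sub>\<infinity>k. hw q k * cmod (a t k))\<^sup>2 \<le> (sqrt ?L * sqrt (Hsq (real kk) (a t)))\<^sup>2"
        by (intro power_mono wl(2)[OF kl] infsum_nonneg) simp
      also have "\<dots> = ?L * Hsq (real kk) (a t)" using L0 by (simp add: power_mult_distrib)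
      also have "\<dots> \<le> ?L * R" by (intro mult_left_mono aR(2)[OF t] L0)
      finally show ?thesis .
    qed
    have dl: "(\<Sum>\<^sub>\<infinity>k. hw q k * cmod (w i k * a t k))\<^sup>2 \<le> (1 + real CARD('d)) * M\<^sup>2 * R" for i
    proof -
      have "Hsq (2 * q - 1) (a t) \<le> R" unfolding q
        by (rule order_trans[OF Hsq_mono[OF aR(1)[OF t]] aR(2)[OF t]]) (use kks in \<open>simp add: field_simps\<close>)
      then have "(1 + real CARD('d)) * M\<^sup>2 * Hsq (2 * q - 1) (a t) \<le> (1 + real CARD('d)) * M\<^sup>2 * R"
        by (intro mult_left_mono) auto
      then show ?thesis using drift_weighted(2)[OF aq, of i] by (rule order_trans[rotated])
    qed
    have one: "(\<Sum>k\<in>K. hw (1 - s) k * (cmod (?Fu t i k))\<^sup>2)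
       \<le> (2 * (2 powr \<bar>1 - s\<bar> * ((1 + real CARD('d)) * M\<^sup>2 * R)) + 2 * (2 powr \<bar>1 - s\<bar> * (?L * R) * M\<^sup>2)) * Hsq (1 - s) (?u t)"
      if K: "finite K" for K i
    proof -
      have 1: "(\<Sum>k\<in>K. hm (1 - s) (?F1 i) k)
         \<le> 2 powr \<bar>1 - s\<bar> * ((1 + real CARD('d)) * M\<^sup>2 * R) * Hsq (1 - s) (?u t)"
      proof -
        have "(\<Sum>k\<in>K. hm (1 - s) (?F1 i) k)
          \<le> 2 powr \<bar>1 - s\<bar> * (\<Sum>\<^sub>\<infinity>l. hw (\<bar>1 - s\<bar>/2) l * cmod (w i l * a t l))\<^sup>2 * (\<Sum>\<^sub>\<infinity>k. hm (1 - s) (?u t) k)"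
          by (rule weighted_convolution[OF F1(2) Hu drift_weighted(1)[OF aq, unfolded q_def] K])
        also have "\<dots> \<le> 2 powr \<bar>1 - s\<bar> * ((1 + real CARD('d)) * M\<^sup>2 * R) * Hsq (1 - s) (?u t)"
          unfolding Hsq_def[symmetric] q_def[symmetric]
          by (intro mult_right_mono mult_left_mono dl) auto
        finally show ?thesis .
      qed
      have 2: "(\<Sum>k\<in>K. hm (1 - s) (?F2 i) k)
         \<le> 2 powr \<bar>1 - s\<bar> * (?L * R) * (M\<^sup>2 * Hsq (1 - s) (?u t))"
      proof -
        have "(\<Sum>k\<in>K. hm (1 - s) (?F2 i) k)
          \<le> 2 powr \<bar>1 - s\<bar> * (\<Sum>\<^sub>\<infinity>l. hw (\<bar>1 - s\<bar>/2) l * cmod (a t l))\<^sup>2 * (\<Sum>\<^sub>\<infinity>k. hw (1 - s) k * (cmod (w i k * ?u t k))\<^sup>2)"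
          by (rule weighted_convolution[OF F2(2) wu(1) wl(1)[OF kl, unfolded q_def] K])
        also have "\<dots> \<le> 2 powr \<bar>1 - s\<bar> * (?L * R) * (M\<^sup>2 * Hsq (1 - s) (?u t))"
          unfolding Hsq_def[symmetric] q_def[symmetric]
          by (intro mult_mono mult_left_mono al wu(2)) (auto intro!: mult_nonneg_nonneg L0 R0)
        finally show ?thesis .
      qed
      have "hw (1 - s) k * (cmod (?Fu t i k))\<^sup>2 \<le> 2 * (hm (1 - s) (?F1 i) k)
         + 2 * (hm (1 - s) (?F2 i) k)" for k
        using mult_left_mono[OF cmod_add_sq_le, of "hw (1 - s) k" "?F1 i k" "?F2 i k"]
        unfolding fc_add[OF F1(1) F2(1)] by (simp add: distrib_left mult.left_commute)
      then have "(\<Sum>k\<in>K. hw (1 - s) k * (cmod (?Fu t i k))\<^sup>2) \<le> (\<Sum>k\<in>K. 2 * (hm (1 - s) (?F1 i) k)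
         + 2 * (hm (1 - s) (?F2 i) k))" by (rule sum_mono)
      also have "\<dots> = 2 * (\<Sum>k\<in>K. hm (1 - s) (?F1 i) k)
         + 2 * (\<Sum>k\<in>K. hm (1 - s) (?F2 i) k)"
        by (simp only: sum.distrib sum_distrib_left)
      also have "\<dots> \<le> 2 * (2 powr \<bar>1 - s\<bar> * ((1 + real CARD('d)) * M\<^sup>2 * R) * Hsq (1 - s) (?u t))
         + 2 * (2 powr \<bar>1 - s\<bar> * (?L * R) * (M\<^sup>2 * Hsq (1 - s) (?u t)))"
        using 1 2 by simp
      finally show ?thesis by (simp add: algebra_simps)
    qed
    show ?case
    proof (intro allI impI)
      fix K :: "(int^'d) set" assume K: "finite K"
      have "(\<Sum>k\<in>K. hw (1 - s) k * (\<Sum>i\<in>UNIV. (cmod (?Fu t i k))\<^sup>2)) = (\<Sum>i\<in>UNIV. \<Sum>k\<in>K. hw (1 - s) k * (cmod (?Fu t i k))\<^sup>2)"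
        unfolding sum_distrib_left by (rule sum.swap)
      also have "\<dots> \<le> (\<Sum>i\<in>(UNIV::'d set). (2 * (2 powr \<bar>1 - s\<bar> * ((1 + real CARD('d)) * M\<^sup>2 * R)) + 2 * (2 powr \<bar>1 - s\<bar> * (?L * R) * M\<^sup>2)) * Hsq (1 - s) (?u t))"
        by (intro sum_mono one K)
      also have "\<dots> = B * Hsq (1 - s) (?u t)" unfolding B_def flux_const_def sum_constant by (simp only: mult.assoc)
      finally show "(\<Sum>k\<in>K. hw (1 - s) k * (\<Sum>i\<in>UNIV. (cmod (?Fu t i k))\<^sup>2)) \<le> B * Hsq (1 - s) (?u t)" .
    qed
  qed
  have e: "1 - s + 1 = 2 - s" "1 - s - 1 = - s" by simp_all
  have sa: "AE t in \<I> T. inH (1 - s + 1) (?u t)"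
    using in_L2H_facts(2)[OF u2] by eventually_elim (use s in \<open>auto intro: inH_mono\<close>)
  have hs: "AE t in \<I> T. inH (1 - s - 1) (fc (f t))"
    using in_L2H_facts(2)[OF f] by eventually_elim (erule conjE, erule inH_mono, use s in simp)
  have yi: "integrable (\<I> T) (\<lambda>t. Hsq (1 - s) (?u t))" "integrable (\<I> T) (\<lambda>t. Hsq (1 - s + 1) (?u t))"
    by (rule in_L2H_facts(4)[OF u2], use s in simp)+
  have hi: "integrable (\<I> T) (\<lambda>t. Hsq (1 - s - 1) (fc (f t)))"
    by (rule in_L2H_facts(4)[OF f]) (use s in simp)
  have u0': "fc (u 0) = (\<lambda>k. 0)" using u0 by auto
  have a0: "inH (1 - s) (?u 0)" unfolding u0' by simp
  note ee = energy_estimate[where F = ?Fu and h = "\<lambda>t. fc (f t)" and g = "\<lambda>t. fc (v t)" and a = ?u,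
      OF T0 B0 in_L2H_facts(5)[OF v0] ueq eq Fb sa yi hs hi a0, unfolded e, folded N_def]
  have N0: "0 \<le> N" unfolding N_def by (rule integral_nonneg_AE) auto
  show c1: "Hsq (1 - s) (?u t) \<le> C1 * N" if t: "t \<in> {0..T}" for t
  proof -
    have "Hsq (1 - s) (?u t) \<le> N * exp ((3 + B) * t)" using ee(2)[OF _ t] by (simp add: u0')
    also have "\<dots> \<le> N * C1" unfolding C1_def using t B0 N0 by (intro mult_left_mono) auto
    finally show ?thesis by (simp add: mult.commute)
  qed
  interpret fin: finite_measure "\<I> T" by simp
  have y1: "(LINT t|\<I> T. Hsq (1 - s) (?u t)) \<le> T * C1 * N"
  proof -
    have "(LINT t|\<I> T. Hsq (1 - s) (?u t)) \<le> (LINT t|\<I> T. C1 * N)"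
      by (rule integral_mono[OF yi(1)]) (use c1 in auto)
    also have "\<dots> = T * C1 * N" using T0 by (simp add: measure_restrict_space)
    finally show ?thesis .
  qed
  show c2: "(LINT t|\<I> T. Hsq (2 - s) (?u t)) \<le> C2 * N"
  proof -
    have "(LINT t|\<I> T. Hsq (2 - s) (?u t)) \<le> N + (3 + B) * (LINT t|\<I> T. Hsq (1 - s) (?u t))"
      using ee(3) by (simp add: u0')
    also have "\<dots> \<le> N + (3 + B) * (T * C1 * N)" using y1 B0 by (intro add_left_mono mult_left_mono) auto
    finally show ?thesis by (simp add: C2_def algebra_simps)
  qed
  \<comment> \<open>The equation read as a formula for \<open>v\<close>: 3 is the cost of squaring
    three terms, \<open>16 * pi ^ 4\<close> the squared symbol constant of the Laplacian and
    \<open>4 * pi\<^sup>2\<close> that of the divergence.\<close>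
  have vle: "AE t in \<I> T. Hsq (- s) (fc (v t))
     \<le> 3 * (16 * pi ^ 4 * Hsq (2 - s) (?u t) + 4 * pi\<^sup>2 * (B * Hsq (1 - s) (?u t)) + Hsq (- s) (fc (f t)))"
    using eq Fb sa hs
  proof eventually_elim
    case (elim t)
    define S where "S k = (\<Sum>i\<in>UNIV. \<i> * complex_of_real (2 * pi * real_of_int (k $ i)) * ?Fu t i k)" for k
    have pw: "hm (- s) (fc (v t)) k \<le> 3 * (16 * pi ^ 4 * (hm (2 - s) (?u t) k)
        + 4 * pi\<^sup>2 * (hw (1 - s) k * (\<Sum>i\<in>UNIV. (cmod (?Fu t i k))\<^sup>2)) + hm (- s) (fc (f t)) k)" for k
    proof -
      have h1: "hw (- s) k * ksq k \<le> hw (1 - s) k"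
        using hw_add[of "- s" 1 k] by (simp add: hw_1 distrib_left)
      have h2: "hw (- s) k * (ksq k)\<^sup>2 \<le> hw (2 - s) k"
      proof -
        have "hw (2 - s) k = hw (- s) k * ((1 + ksq k) * (1 + ksq k))"
          using hw_add[of "- s" 2 k] hw_add[of 1 1 k] by (simp add: hw_1)
        moreover have "(ksq k)\<^sup>2 \<le> (1 + ksq k) * (1 + ksq k)" by (simp add: power2_eq_square algebra_simps)
        ultimately show ?thesis by (simp add: mult_left_mono)
      qed
      have "(cmod (fc (v t) k))\<^sup>2 \<le> 3 * ((cmod (- complex_of_real (4 * pi\<^sup>2 * ksq k) * ?u t k))\<^sup>2 + (cmod (S k))\<^sup>2 + (cmod (fc (f t) k))\<^sup>2)"
        unfolding S_def by (subst elim(1)[rule_format]) (rule cmod_add3_sq_le)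
      also have "(cmod (- complex_of_real (4 * pi\<^sup>2 * ksq k) * ?u t k))\<^sup>2 = 16 * pi ^ 4 * ((ksq k)\<^sup>2 * (cmod (?u t k))\<^sup>2)"
      proof -
        have "cmod (- complex_of_real (4 * pi\<^sup>2 * ksq k) * ?u t k) = 4 * pi\<^sup>2 * ksq k * cmod (?u t k)"
          by (simp only: norm_mult norm_minus_cancel norm_of_real) simp
        moreover have "(4 * pi\<^sup>2 * ksq k * cmod (?u t k))\<^sup>2 = 16 * pi ^ 4 * ((ksq k)\<^sup>2 * (cmod (?u t k))\<^sup>2)"
          by (simp add: power_mult_distrib)
        ultimately show ?thesis by (simp only:)
      qed
      finally have "(cmod (fc (v t) k))\<^sup>2 \<le> 3 * (16 * pi ^ 4 * ((ksq k)\<^sup>2 * (cmod (?u t k))\<^sup>2)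
          + 4 * pi\<^sup>2 * ksq k * (\<Sum>i\<in>UNIV. (cmod (?Fu t i k))\<^sup>2) + (cmod (fc (f t) k))\<^sup>2)"
        unfolding S_def
        by (elim order_trans, intro mult_left_mono add_mono order_refl divergence_bound) simp
      then have "hm (- s) (fc (v t)) k \<le> hw (- s) k * (3 * (16 * pi ^ 4 * ((ksq k)\<^sup>2 * (cmod (?u t k))\<^sup>2)
          + 4 * pi\<^sup>2 * ksq k * (\<Sum>i\<in>UNIV. (cmod (?Fu t i k))\<^sup>2) + (cmod (fc (f t) k))\<^sup>2))"
        by (rule mult_left_mono) simp
      also have "\<dots> = 3 * (16 * pi ^ 4 * ((hw (- s) k * (ksq k)\<^sup>2) * (cmod (?u t k))\<^sup>2)
          + 4 * pi\<^sup>2 * ((hw (- s) k * ksq k) * (\<Sum>i\<in>UNIV. (cmod (?Fu t i k))\<^sup>2)) + hm (- s) (fc (f t)) k)"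
        by (simp add: distrib_left mult_ac)
      also have "\<dots> \<le> 3 * (16 * pi ^ 4 * (hm (2 - s) (?u t) k)
        + 4 * pi\<^sup>2 * (hw (1 - s) k * (\<Sum>i\<in>UNIV. (cmod (?Fu t i k))\<^sup>2)) + hm (- s) (fc (f t)) k)"
        using h1 h2 by (intro mult_left_mono add_mono mult_right_mono) (auto intro: sum_nonneg)
      finally show ?thesis .
    qed
    show ?case
      unfolding Hsq_def[of "- s" "fc (v t)"]
    proof (rule summable_infsum_le_of_finite_sums(2))
      fix K :: "(int^'d) set" assume K: "finite K"
      have "(\<Sum>k\<in>K. hm (- s) (fc (v t)) k) \<le> (\<Sum>k\<in>K. 3 * (16 * pi ^ 4 * (hm (2 - s) (?u t) k)
        + 4 * pi\<^sup>2 * (hw (1 - s) k * (\<Sum>i\<in>UNIV. (cmod (?Fu t i k))\<^sup>2)) + hm (- s) (fc (f t)) k))"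
        by (rule sum_mono) (rule pw)
      also have "\<dots> = 3 * (16 * pi ^ 4 * (\<Sum>k\<in>K. hm (2 - s) (?u t) k)
        + 4 * pi\<^sup>2 * (\<Sum>k\<in>K. hw (1 - s) k * (\<Sum>i\<in>UNIV. (cmod (?Fu t i k))\<^sup>2)) + (\<Sum>k\<in>K. hm (- s) (fc (f t)) k))"
        by (simp only: sum.distrib sum_distrib_left[symmetric])
      also have "\<dots> \<le> 3 * (16 * pi ^ 4 * Hsq (2 - s) (?u t) + 4 * pi\<^sup>2 * (B * Hsq (1 - s) (?u t)) + Hsq (- s) (fc (f t)))"
        using elim(2) K sum_le_Hsq[OF elim(3) K] sum_le_Hsq[OF elim(4) K] unfolding e
        by (intro mult_left_mono add_mono) auto
      finally show "(\<Sum>k\<in>K. hm (- s) (fc (v t)) k)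
         \<le> 3 * (16 * pi ^ 4 * Hsq (2 - s) (?u t) + 4 * pi\<^sup>2 * (B * Hsq (1 - s) (?u t)) + Hsq (- s) (fc (f t)))" .
    qed simp
  qed
  note i1 = yi(1) and i2 = yi(2)[unfolded e] and i3 = hi[unfolded e]
  have iv: "integrable (\<I> T) (\<lambda>t. Hsq (- s) (fc (v t)))"
    by (rule in_L2H_facts(4)[OF v0]) (use s in simp)
  have "(LINT t|\<I> T. Hsq (- s) (fc (v t)))
    \<le> (LINT t|\<I> T. 3 * (16 * pi ^ 4 * Hsq (2 - s) (?u t) + 4 * pi\<^sup>2 * (B * Hsq (1 - s) (?u t)) + Hsq (- s) (fc (f t))))"
    by (rule integral_mono_AE[OF iv _ vle]) (use i1 i2 i3 in simp)
  also have "\<dots> = 3 * (16 * pi ^ 4 * (LINT t|\<I> T. Hsq (2 - s) (?u t))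
      + 4 * pi\<^sup>2 * (B * (LINT t|\<I> T. Hsq (1 - s) (?u t))) + N)"
    using i1 i2 i3 by (simp add: N_def)
  also have "\<dots> \<le> 3 * (16 * pi ^ 4 * (C2 * N) + 4 * pi\<^sup>2 * (B * (T * C1 * N)) + N)"
    using c2 y1 B0 by (intro mult_left_mono add_mono) auto
  also have "\<dots> = C3 * N" by (simp add: C3_def algebra_simps)
  finally show "(LINT t|\<I> T. Hsq (- s) (fc (v t))) \<le> C3 * N" .
qed

end

theorem theoremA4:
  fixes \<beta> :: nat and T M s :: real
  assumes "even \<beta>" and "real \<beta> \<ge> 3 + real CARD('d)"
    and "T > 0" and "M > 0"
    and "1 \<le> s" and "s < real \<beta> + 1 - real CARD('d) / 2"
  shows "\<exists>C :: real \<Rightarrow> real. \<forall>(\<phi> :: real^'d \<Rightarrow> real) W Wd Wdd \<rho> vr f u v.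
      prob_density \<phi> \<and> in_H (real \<beta>) \<phi>
      \<and> W2inf_mean0_bdd W Wd Wdd M
      \<and> agg_diff_sol \<beta> T \<phi> Wd \<rho> vr
      \<and> in_L2H 0 T f
      \<and> lin_sol T Wd \<rho> f u v
      \<longrightarrow> ereal (L2H_norm (2 - s) T u) + LinfH_norm (1 - s) T u + ereal (L2H_norm (- s) T v)
          \<le> ereal (C (hnorm (real_of_int (min (int \<beta>) (\<lfloor>s - 1 + real CARD('d) / 2\<rfloor> + 1))) \<phi>)
                    * L2H_norm (- s) T f)"
proof -
  \<comment> \<open>A natural number, since the bounds for \<open>\<rho>\<close> are obtained by
    induction on the order; \<open>pos\<close> shows that \<open>nat\<close> loses nothing.\<close>
  define kk where "kk = nat (min (int \<beta>) (\<lfloor>s - 1 + real CARD('d) / 2\<rfloor> + 1))"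
  have pos: "0 \<le> min (int \<beta>) (\<lfloor>s - 1 + real CARD('d) / 2\<rfloor> + 1)"
  proof -
    have "0 \<le> s - 1 + real CARD('d) / 2" using assms(5) by simp
    then have "0 \<le> \<lfloor>s - 1 + real CARD('d) / 2\<rfloor>" by simp
    then show ?thesis by simp
  qed
  have kk_eq: "real_of_int (min (int \<beta>) (\<lfloor>s - 1 + real CARD('d) / 2\<rfloor> + 1)) = real kk"
    using pos by (simp add: kk_def)
  have kk: "kk \<le> \<beta>" by (simp add: kk_def)
  \<comment> \<open>Both arguments of the minimum exceed \<open>s - 1 + d/2\<close>:
    \<open>\<beta>\<close> by the upper bound on \<open>s\<close>, the other by rounding.\<close>
  have kks: "real kk > s - 1 + real CARD('d) / 2"
    unfolding kk_eq[symmetric] using assms(6) by (simp add: min_def)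
  \<comment> \<open>Functions of a single number \<open>x\<close>, which will be the norm of
    \<open>\<phi>\<close> of order \<open>kk\<close>: they are fixed before any datum is chosen,
    which is the claimed uniformity.\<close>
  define Bx where "Bx x = flux_const (real CARD('d)) M (lattice_const TYPE('d) (real kk - (s - 1))) s
      (sobolev_bound (real CARD('d)) T M (x\<^sup>2) kk)" for x
  define C1 where "C1 x = exp ((3 + Bx x) * T)" for x
  define C2 where "C2 x = 1 + (3 + Bx x) * (T * C1 x)" for x
  define C3 where "C3 x = 3 * (16 * pi ^ 4 * C2 x + 4 * pi\<^sup>2 * Bx x * (T * C1 x) + 1)" for x
  show ?thesis
  \<comment> \<open>\<open>C1\<close>, \<open>C2\<close> and \<open>C3\<close> compare squared
    norms, hence the square roots.\<close>
  proof (intro exI[of _ "\<lambda>x. sqrt (C2 x) + sqrt (C1 x) + sqrt (C3 x)"] allI impI, elim conjE)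
    fix \<phi> W :: "real^'d \<Rightarrow> real" and Wd Wdd \<rho> vr f u v
    assume h: "prob_density \<phi>" "in_H (real \<beta>) \<phi>" "W2inf_mean0_bdd W Wd Wdd M" "agg_diff_sol \<beta> T \<phi> Wd \<rho> vr"
      and f: "in_L2H 0 T f" and lin: "lin_sol T Wd \<rho> f u v"
    interpret aggregation T M \<beta> \<phi> W Wd Wdd \<rho> vr
      by unfold_locales (use h assms in auto)
    define x where "x = hnorm (real kk) \<phi>"
    have "Hsq (real kk) (fc \<phi>) \<le> x\<^sup>2" by (simp add: x_def hnorm_sq)
    note le = linear_estimate[OF assms(5) kk kks this f lin, folded Bx_def, folded C1_def, folded C2_def, folded C3_def]
    define N where "N = (LINT t|\<I> T. Hsq (- s) (fc (f t)))"
    have nf: "L2H_norm (- s) T f = sqrt N" by (simp add: L2H_norm_def hnorm_sq N_def)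
    have n2: "L2H_norm (2 - s) T u \<le> sqrt (C2 x) * sqrt N"
      using real_sqrt_le_mono[OF le(2)] by (simp add: L2H_norm_def hnorm_sq N_def real_sqrt_mult)
    have n3: "L2H_norm (- s) T v \<le> sqrt (C3 x) * sqrt N"
      using real_sqrt_le_mono[OF le(3)] by (simp add: L2H_norm_def hnorm_sq N_def real_sqrt_mult)
    have u2: "in_L2H 2 T u" using lin by (simp add: lin_sol_def)
    have n1: "LinfH_norm (1 - s) T u \<le> ereal (sqrt (C1 x) * sqrt N)"
      unfolding LinfH_norm_def
    proof (rule esssup_I)
      show "(\<lambda>t. ereal (hnorm (1 - s) (u t))) \<in> borel_measurable (\<I> T)"
        unfolding hnorm_eq using in_L2H_facts(3)[OF u2, of "1 - s"] by measurable
      show "AE t in \<I> T. ereal (hnorm (1 - s) (u t)) \<le> ereal (sqrt (C1 x) * sqrt N)"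
        using real_sqrt_le_mono[OF le(1)] by (auto simp: hnorm_eq N_def real_sqrt_mult)
    qed
    have "ereal (L2H_norm (2 - s) T u) + LinfH_norm (1 - s) T u + ereal (L2H_norm (- s) T v)
      \<le> ereal (sqrt (C2 x) * sqrt N) + ereal (sqrt (C1 x) * sqrt N) + ereal (sqrt (C3 x) * sqrt N)"
      by (intro add_mono n1) (use n2 n3 in auto)
    then show "ereal (L2H_norm (2 - s) T u) + LinfH_norm (1 - s) T u + ereal (L2H_norm (- s) T v)
      \<le> ereal ((sqrt (C2 (hnorm (real_of_int (min (int \<beta>) (\<lfloor>s - 1 + real CARD('d) / 2\<rfloor> + 1))) \<phi>))
         + sqrt (C1 (hnorm (real_of_int (min (int \<beta>) (\<lfloor>s - 1 + real CARD('d) / 2\<rfloor> + 1))) \<phi>))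
         + sqrt (C3 (hnorm (real_of_int (min (int \<beta>) (\<lfloor>s - 1 + real CARD('d) / 2\<rfloor> + 1))) \<phi>))) * L2H_norm (- s) T f)"
      unfolding kk_eq x_def[symmetric] nf by (simp add: distrib_right)
  qed
qed

end
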